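(* Let $n\in\mathbb{N}$, let $m\in\mathbb{R}$, and assume that $a\in ES^{m}(\mathbb{Z}^n\times\mathbb{T}^n)$. Let $\varphi\in RO$ and let $t^{-m}\varphi$ denote the product of the functions $t\mapsto t^{-m}$ and $\varphi$. Then $$T_a\colon H^{\varphi}(\mathbb{Z}^n)\to H^{t^{-m}\varphi}(\mathbb{Z}^n)$$ is a (bounded) Fredholm operator. Furthermore, with $$\mathscr{K}:=\{u\in H^{\infty}(\mathbb{Z}^n):T_au=0\},\qquad \mathscr{K}^{\dagger}:=\{u\in H^{\infty}(\mathbb{Z}^n):(T_a)^{\dagger}u=0\},$$ the following properties hold: (i) $\operatorname{Ker}T_a=\mathscr{K}$; (ii) $\operatorname{Ran}T_a=\{v\in H^{t^{-m}\varphi}(\mathbb{Z}^n):(v,w)=0\text{ for all }w\in\mathscr{K}^{\dagger}\}$, where $(\cdot,\cdot)$ is the sesquilinear duality between $H^{t^{-m}\varphi}(\mathbb{Z}^n)$ and $H^{\frac{t^m}{\varphi}}(\mathbb{Z}^n)$; (iii) the index of $T_a$ is $\kappa(T_a)=\dim(\mathscr{K})-\dim(\mathscr{K}^{\dagger})$. (Hence $\kappa(T_a)$ is independent of $\varphi$.)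
   Context: Notation on $\mathbb{Z}^n$: $|k|=\sqrt{k_1^2+\dots+k_n^2}$ and $\langle k\rangle=(1+|k|^2)^{1/2}$; $\mathbb{T}^n=\mathbb{R}^n/\mathbb{Z}^n$. $\ell^2(\mathbb{Z}^n)$ is the Hilbert space of square summable functions $u\colon\mathbb{Z}^n\to\mathbb{C}$ with inner product $(u,v)=\sum_{k\in\mathbb{Z}^n}u(k)\overline{v(k)}$ and norm $\|\cdot\|$. $\Delta_{k_j}u(k)=u(k+e_j)-u(k)$ and $\Delta_k^\alpha=\Delta_{k_1}^{\alpha_1}\cdots\Delta_{k_n}^{\alpha_n}$ for $\alpha\in\mathbb{N}_0^n$, where $e_j$ is the $j$-th standard unit vector; $|\alpha|=\alpha_1+\dots+\alpha_n$. $\mathcal{S}(\mathbb{Z}^n)$ is the Schwartz space of functions $u\colon\mathbb{Z}^n\to\mathbb{C}$ with $\sup_{k}|k^{\alpha}(\Delta_k^{\beta}u)(k)|<\infty$ for all $\alpha,\beta\in\mathbb{N}_0^n$. $\mathcal{S}'(\mathbb{Z}^n)$ is the space of continuous linear functionals on $\mathcal{S}(\mathbb{Z}^n)$, identified with functions $u\colon\mathbb{Z}^n\to\mathbb{C}$ of at most polynomial growth acting by $v\mapsto\sum_k u(k)v(k)$. Function spaces: $\varphi\in RO$ means that $\varphi\colon[1,\infty)\to(0,\infty)$ is Borel measurable and there exist $a>1$, $c\geq1$ with $c^{-1}\leq\varphi(\lambda t)/\varphi(t)\leq c$ for all $t\geq1$, $\lambda\in[1,a]$. For $\varphi\in RO$,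 $H^{\varphi}(\mathbb{Z}^n)=\{u\in\mathcal{S}'(\mathbb{Z}^n):\varphi(\langle k\rangle)u\in\ell^2(\mathbb{Z}^n)\}$ with inner product $(u,v)_{H^{\varphi}(\mathbb{Z}^n)}=\sum_{k\in\mathbb{Z}^n}[\varphi(\langle k\rangle)]^2u(k)\overline{v(k)}$. For $s\in\mathbb{R}$, $H^{(s)}(\mathbb{Z}^n)=\{u\in\mathcal{S}'(\mathbb{Z}^n):\langle k\rangle^su\in\ell^2(\mathbb{Z}^n)\}$ with norm $\|\langle k\rangle^su\|$, and $H^\infty(\mathbb{Z}^n)=\bigcap_{r\in\mathbb{R}}H^{(r)}(\mathbb{Z}^n)$. For $\eta\in RO$, the sesquilinear duality $(\cdot,\cdot)\colon H^{\eta}(\mathbb{Z}^n)\times H^{1/\eta}(\mathbb{Z}^n)\to\mathbb{C}$ is the extension by continuity of the form $(u,v)=\sum_{k}u(k)\overline{v(k)}$ from $\mathcal{S}(\mathbb{Z}^n)\times\mathcal{S}(\mathbb{Z}^n)$. Symbols: for $l\in\mathbb{N}_0$, $D_{x_j}^{(l)}=\prod_{r=0}^{l-1}\left(\frac{1}{2\pi i}\frac{\partial}{\partial x_j}-r\right)$, $D_{x_j}^{(0)}=1$ (identity), and $D_x^{(\beta)}=D_{x_1}^{(\beta_1)}\cdots D_{x_n}^{(\beta_n)}$. For $m\in\mathbb{R}$, $S^m(\mathbb{Z}^n\times\mathbb{T}^n)$ is the set of functions $a\colon\mathbb{Z}^n\times\mathbb{T}^n\to\mathbb{C}$ such that $a(k,\cdot)\in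 C^\infty(\mathbb{T}^n)$ for all $k\in\mathbb{Z}^n$ and for all $\alpha,\beta\in\mathbb{N}_0^n$ there is $C_{\alpha,\beta}>0$ with $|D_x^{(\beta)}\Delta_k^\alpha a(k,x)|\leq C_{\alpha,\beta}(1+|k|)^{m-|\alpha|}$ for all $(k,x)$. The elliptic class $ES^m(\mathbb{Z}^n\times\mathbb{T}^n)$ consists of those $a\in S^m(\mathbb{Z}^n\times\mathbb{T}^n)$ for which there exist $C>0$, $R>0$ with $|a(k,x)|\geq C(1+|k|)^m$ for all $x\in\mathbb{T}^n$ and all $k\in\mathbb{Z}^n$ with $|k|>R$. Pseudo-differential operators: $\widehat{u}(x)=\sum_{k\in\mathbb{Z}^n}e^{-2\pi ik\cdot x}u(k)$, $x\in\mathbb{T}^n$. For $a\in S^m(\mathbb{Z}^n\times\mathbb{T}^n)$, $(T_au)(k)=\int_{\mathbb{T}^n}e^{2\pi ik\cdot x}a(k,x)\widehat{u}(x)\,dx$ for $u\in\mathcal{S}(\mathbb{Z}^n)$; it maps $\mathcal{S}(\mathbb{Z}^n)$ into $\mathcal{S}(\mathbb{Z}^n)$. Its formal adjoint $T_a^\dagger=(T_a)^\dagger\colon\mathcal{S}(\mathbb{Z}^n)\to\mathcal{S}(\mathbb{Z}^n)$ is defined by $(T_au,v)=(u,T_a^\dagger v)$ for $u,v\in\mathcal{S}(\mathbb{Z}^n)$, and $T_a$ extends to $T_a\colon\mathcal{S}'(\mathbb{Z}^n)\to\mathcal{S}'(\mathbb{Z}^n)$ by $(T_aF)(\overline{u})=F(\overline{T_a^\dagger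 u})$, $F\in\mathcal{S}'(\mathbb{Z}^n)$, $u\in\mathcal{S}(\mathbb{Z}^n)$. In the claim, $T_a$ on $H^\varphi(\mathbb{Z}^n)$ denotes this extended operator restricted to $H^\varphi(\mathbb{Z}^n)$. Fredholm operators: a bounded linear operator $T\colon\mathscr{B}_1\to\mathscr{B}_2$ between Banach spaces is Fredholm if $\dim\operatorname{Ker}T<\infty$, $\operatorname{Ran}T$ is closed, and $\dim\operatorname{Coker}T<\infty$, where $\operatorname{Coker}T=\mathscr{B}_2/\operatorname{Ran}T$; its index is $\kappa(T)=\dim\operatorname{Ker}T-\dim\operatorname{Coker}T$. *)

theory Defs
  imports
    "HOL-Analysis.Analysis"
    "HOL-Algebra.AbelCoset"
    "Jordan_Normal_Form.Missing_VectorSpace"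
begin

text \<open>
  Points of the lattice are vectors of type \<open>int ^ 'n\<close>, and functions on the torus are
  functions on \<open>real ^ 'n\<close> that are 1-periodic in every coordinate; \<open>n\<close> is the cardinality
  of the index type \<open>'n\<close>.
\<close>


section \<open>Banach spaces on carrier sets and Fredholm operators\<close>

text \<open>
  The spaces below depend on a function parameter, so they are given by carriers.  Vector spaces
  are those of the locale \<open>vectorspace\<close>, which works with module records, and we add a norm to
  these records.  The fields \<open>mult\<close> and \<open>one\<close> of a module record have no meaning.
\<close>

definition complex_field :: "complex ring" where
  "complex_field = \<lparr>carrier = UNIV, mult = (*), one = 1, zero = 0, add = (+)\<rparr>"

record ('a, 'b) normed_module = "('a, 'b) module" +
  vnorm :: "'b \<Rightarrow> real"

text \<open>The locale \<open>Metric_space\<close> wants symmetry and nonnegativity everywhere, hence the value 0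
  outside the carrier.\<close>

definition vdist :: "(complex, 'b, 'e) normed_module_scheme \<Rightarrow> 'b \<Rightarrow> 'b \<Rightarrow> real" where
  "vdist V u v =
     (if u \<in> carrier V \<and> v \<in> carrier V then vnorm V (u \<ominus>\<^bsub>V\<^esub> v) else 0)"

definition banach_space :: "(complex, 'b, 'e) normed_module_scheme \<Rightarrow> bool" where
  "banach_space V \<longleftrightarrow>
     vectorspace complex_field V \<and>
     (\<forall>u\<in>carrier V. 0 \<le> vnorm V u \<and> (vnorm V u = 0 \<longleftrightarrow> u = \<zero>\<^bsub>V\<^esub>)) \<and>
     (\<forall>c. \<forall>u\<in>carrier V. vnorm V (c \<odot>\<^bsub>V\<^esub> u) = cmod c * vnorm V u) \<and>
     (\<forall>u\<in>carrier V. \<forall>v\<in>carrier V. vnorm V (u \<oplus>\<^bsub>V\<^esub> v) \<le> vnorm V u + vnorm V v) \<and>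
     Metric_space.mcomplete (carrier V) (vdist V)"

definition bounded_operator ::
    "(complex, 'b, 'd) normed_module_scheme \<Rightarrow> (complex, 'c, 'e) normed_module_scheme \<Rightarrow>
     ('b \<Rightarrow> 'c) \<Rightarrow> bool" where
  "bounded_operator V W T \<longleftrightarrow>
     linear_map complex_field V W T \<and>
     (\<exists>C. \<forall>u\<in>carrier V. vnorm W (T u) \<le> C * vnorm V u)"

definition op_kernel ::
    "('a, 'b, 'd) module_scheme \<Rightarrow> ('a, 'c, 'e) module_scheme \<Rightarrow> ('b \<Rightarrow> 'c) \<Rightarrow> 'b set" where
  "op_kernel V W T = {u \<in> carrier V. T u = \<zero>\<^bsub>W\<^esub>}"

definition op_range :: "('a, 'b, 'd) module_scheme \<Rightarrow> ('b \<Rightarrow> 'c) \<Rightarrow> 'c set" where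
  "op_range V T = T ` carrier V"

text \<open>The quotient of a module by a submodule, modelled on \<open>FactRing\<close>.  Adding the submodule in
  the scalar multiplication matters for the scalar 0.\<close>

definition quotient_module :: "('a, 'b, 'e) module_scheme \<Rightarrow> 'b set \<Rightarrow> ('a, 'b set) module" where
  "quotient_module V U =
     \<lparr>carrier = a_rcosets\<^bsub>V\<^esub> U, mult = undefined, one = undefined,
      zero = U, add = set_add V,
      smult = (\<lambda>c X. \<Union>x\<in>X. U +>\<^bsub>V\<^esub> (c \<odot>\<^bsub>V\<^esub> x))\<rparr>"

abbreviation fin_dim_space :: "(complex, 'b, 'e) module_scheme \<Rightarrow> bool" where
  "fin_dim_space V \<equiv> vectorspace.fin_dim complex_field V"

abbreviation dim_space :: "(complex, 'b, 'e) module_scheme \<Rightarrow> nat" where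
  "dim_space V \<equiv> vectorspace.dim complex_field V"

definition fredholm ::
    "(complex, 'b, 'd) normed_module_scheme \<Rightarrow> (complex, 'c, 'e) normed_module_scheme \<Rightarrow>
     ('b \<Rightarrow> 'c) \<Rightarrow> bool" where
  "fredholm V W T \<longleftrightarrow>
     banach_space V \<and> banach_space W \<and> bounded_operator V W T \<and>
     fin_dim_space (V\<lparr>carrier := op_kernel V W T\<rparr>) \<and>
     closedin (Metric_space.mtopology (carrier W) (vdist W)) (op_range V T) \<and>
     fin_dim_space (quotient_module W (op_range V T))"

definition fredholm_index ::
    "(complex, 'b, 'd) normed_module_scheme \<Rightarrow> (complex, 'c, 'e) normed_module_scheme \<Rightarrow>
     ('b \<Rightarrow> 'c) \<Rightarrow> int" where
  "fredholm_index V W T =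
     int (dim_space (V\<lparr>carrier := op_kernel V W T\<rparr>)) -
     int (dim_space (quotient_module W (op_range V T)))"


section \<open>Functions on the lattice\<close>

definition lattice_vec :: "int ^ 'n \<Rightarrow> real ^ 'n" where
  "lattice_vec k = (\<chi> j. of_int (k $ j))"

definition japanese :: "int ^ 'n \<Rightarrow> real" where
  "japanese k = sqrt (1 + (norm (lattice_vec k))\<^sup>2)"

text \<open>Multi-index powers of commuting operators are composed along a fixed enumeration of the
  coordinates; the factors commute on all functions to which they are applied below, so the
  choice does not matter.\<close>

definition coords :: "'n::finite list" where
  "coords = (SOME js. distinct js \<and> set js = UNIV)"

definition difference :: "'n::finite \<Rightarrow> (int ^ 'n \<Rightarrow> complex) \<Rightarrow> int ^ 'n \<Rightarrow> complex" where
  "difference j u k = u (k + axis j 1) - u k"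

definition multi_difference ::
    "('n::finite \<Rightarrow> nat) \<Rightarrow> (int ^ 'n \<Rightarrow> complex) \<Rightarrow> int ^ 'n \<Rightarrow> complex" where
  "multi_difference \<alpha> u = foldr (\<lambda>j. difference j ^^ \<alpha> j) coords u"

definition schwartz :: "(int ^ 'n::finite \<Rightarrow> complex) set" where
  "schwartz = {u. \<forall>\<alpha> \<beta>.
     bdd_above (range (\<lambda>k. cmod (of_int (\<Prod>j\<in>UNIV. (k $ j) ^ \<alpha> j) * multi_difference \<beta> u k)))}"

text \<open>Continuous linear functionals on \<open>schwartz\<close> are identified with functions of at most
  polynomial growth; such a function acts by \<open>dist_apply\<close>.\<close>

definition tempered :: "(int ^ 'n::finite \<Rightarrow> complex) set" where
  "tempered = {u. \<exists>C N. \<forall>k. cmod (u k) \<le> C * japanese k ^ N}"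

definition dist_apply ::
    "(int ^ 'n::finite \<Rightarrow> complex) \<Rightarrow> (int ^ 'n \<Rightarrow> complex) \<Rightarrow> complex" where
  "dist_apply F v = (\<Sum>\<^sub>\<infinity>k. F k * v k)"

definition ell2 :: "(int ^ 'n::finite \<Rightarrow> complex) set" where
  "ell2 = {u. (\<lambda>k. (cmod (u k))\<^sup>2) summable_on UNIV}"

definition ell2_form ::
    "(int ^ 'n::finite \<Rightarrow> complex) \<Rightarrow> (int ^ 'n \<Rightarrow> complex) \<Rightarrow> complex" where
  "ell2_form u v = (\<Sum>\<^sub>\<infinity>k. u k * cnj (v k))"

definition fun_space :: "('i \<Rightarrow> complex) set \<Rightarrow> (complex, 'i \<Rightarrow> complex) module" where
  "fun_space U =
     \<lparr>carrier = U, mult = undefined, one = undefined, zero = (\<lambda>k. 0),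
      add = (\<lambda>u v k. u k + v k), smult = (\<lambda>c u k. c * u k)\<rparr>"


section \<open>Spaces of generalized smoothness\<close>

definition RO :: "(real \<Rightarrow> real) set" where
  "RO = {\<phi>. \<phi> \<in> borel_measurable (restrict_space borel {1..}) \<and> (\<forall>t\<ge>1. 0 < \<phi> t) \<and>
     (\<exists>a>1. \<exists>c\<ge>1. \<forall>t\<ge>1. \<forall>l\<in>{1..a}.
        inverse c \<le> \<phi> (l * t) / \<phi> t \<and> \<phi> (l * t) / \<phi> t \<le> c)}"

definition H_set :: "(real \<Rightarrow> real) \<Rightarrow> (int ^ 'n::finite \<Rightarrow> complex) set" where
  "H_set \<phi> = {u \<in> tempered. (\<lambda>k. of_real (\<phi> (japanese k)) * u k) \<in> ell2}"

definition H_inner ::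
    "(real \<Rightarrow> real) \<Rightarrow> (int ^ 'n::finite \<Rightarrow> complex) \<Rightarrow> (int ^ 'n \<Rightarrow> complex) \<Rightarrow> complex" where
  "H_inner \<phi> u v = (\<Sum>\<^sub>\<infinity>k. of_real ((\<phi> (japanese k))\<^sup>2) * u k * cnj (v k))"

definition H_norm :: "(real \<Rightarrow> real) \<Rightarrow> (int ^ 'n::finite \<Rightarrow> complex) \<Rightarrow> real" where
  "H_norm \<phi> u = sqrt (Re (H_inner \<phi> u u))"

definition H_space ::
    "(real \<Rightarrow> real) \<Rightarrow> (complex, int ^ 'n::finite \<Rightarrow> complex) normed_module" where
  "H_space \<phi> = module.extend (fun_space (H_set \<phi>)) \<lparr>vnorm = H_norm \<phi>\<rparr>"

definition H_sobolev :: "real \<Rightarrow> (int ^ 'n::finite \<Rightarrow> complex) set" where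
  "H_sobolev s = {u \<in> tempered. (\<lambda>k. of_real (japanese k powr s) * u k) \<in> ell2}"

definition H_infinity :: "(int ^ 'n::finite \<Rightarrow> complex) set" where
  "H_infinity = (\<Inter>r. H_sobolev r)"

text \<open>The duality between \<open>H_set \<eta>\<close> and \<open>H_set (1 / \<eta>)\<close>: the extension by continuity of
  \<open>ell2_form\<close> from \<open>schwartz \<times> schwartz\<close>, i.e. the common limit along all pairs of approximating
  sequences.\<close>

definition duality ::
    "(real \<Rightarrow> real) \<Rightarrow> (int ^ 'n::finite \<Rightarrow> complex) \<Rightarrow> (int ^ 'n \<Rightarrow> complex) \<Rightarrow> complex" where
  "duality \<eta> u v = (THE z. \<forall>\<sigma> \<tau>.
     range \<sigma> \<subseteq> schwartz \<longrightarrow> range \<tau> \<subseteq> schwartz \<longrightarrow>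
     (\<lambda>i. H_norm \<eta> (\<lambda>k. \<sigma> i k - u k)) \<longlonglongrightarrow> 0 \<longrightarrow>
     (\<lambda>i. H_norm (\<lambda>t. 1 / \<eta> t) (\<lambda>k. \<tau> i k - v k)) \<longlonglongrightarrow> 0 \<longrightarrow>
     (\<lambda>i. ell2_form (\<sigma> i) (\<tau> i)) \<longlonglongrightarrow> z)"


section \<open>Symbols\<close>

definition partial_deriv :: "'n::finite \<Rightarrow> (real ^ 'n \<Rightarrow> complex) \<Rightarrow> real ^ 'n \<Rightarrow> complex" where
  "partial_deriv j f x = vector_derivative (\<lambda>t. f (x + t *\<^sub>R axis j 1)) (at 0)"

text \<open>All iterated partial derivatives exist and are continuous.\<close>

definition smooth_on_torus :: "(real ^ 'n::finite \<Rightarrow> complex) \<Rightarrow> bool" where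
  "smooth_on_torus f \<longleftrightarrow>
     (\<forall>j x. f (x + axis j 1) = f x) \<and>
     (\<forall>js. continuous_on UNIV (foldr partial_deriv js f) \<and>
        (\<forall>j x. (\<lambda>t. foldr partial_deriv js f (x + t *\<^sub>R axis j 1)) differentiable (at 0)))"

primrec D_coord ::
    "nat \<Rightarrow> 'n::finite \<Rightarrow> (real ^ 'n \<Rightarrow> complex) \<Rightarrow> real ^ 'n \<Rightarrow> complex" where
  "D_coord 0 j f = f"
| "D_coord (Suc l) j f =
     (\<lambda>x. partial_deriv j (D_coord l j f) x / (2 * pi * \<i>) - of_nat l * D_coord l j f x)"

definition D_multi ::
    "('n::finite \<Rightarrow> nat) \<Rightarrow> (real ^ 'n \<Rightarrow> complex) \<Rightarrow> real ^ 'n \<Rightarrow> complex" where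
  "D_multi \<beta> f = foldr (\<lambda>j. D_coord (\<beta> j) j) coords f"

definition symbols :: "real \<Rightarrow> (int ^ 'n::finite \<Rightarrow> real ^ 'n \<Rightarrow> complex) set" where
  "symbols m = {a. (\<forall>k. smooth_on_torus (a k)) \<and>
     (\<forall>\<alpha> \<beta>. \<exists>C>0. \<forall>k x.
        cmod (D_multi \<beta> (\<lambda>y. multi_difference \<alpha> (\<lambda>l. a l y) k) x)
          \<le> C * (1 + norm (lattice_vec k)) powr (m - real (\<Sum>j\<in>UNIV. \<alpha> j)))}"

definition elliptic_symbols :: "real \<Rightarrow> (int ^ 'n::finite \<Rightarrow> real ^ 'n \<Rightarrow> complex) set" where
  "elliptic_symbols m = {a \<in> symbols m. \<exists>C>0. \<exists>R>0. \<forall>k x.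
     R < norm (lattice_vec k) \<longrightarrow> C * (1 + norm (lattice_vec k)) powr m \<le> cmod (a k x)}"


section \<open>Pseudo-differential operators\<close>

definition fourier :: "(int ^ 'n::finite \<Rightarrow> complex) \<Rightarrow> real ^ 'n \<Rightarrow> complex" where
  "fourier u x = (\<Sum>\<^sub>\<infinity>k. exp (- 2 * pi * \<i> * of_real (lattice_vec k \<bullet> x)) * u k)"

text \<open>The operator on \<open>schwartz\<close>; the torus is represented by the unit cube.\<close>

definition pdo ::
    "(int ^ 'n::finite \<Rightarrow> real ^ 'n \<Rightarrow> complex) \<Rightarrow> (int ^ 'n \<Rightarrow> complex) \<Rightarrow> int ^ 'n \<Rightarrow> complex" where
  "pdo a u k =
     integral (cbox 0 1) (\<lambda>x. exp (2 * pi * \<i> * of_real (lattice_vec k \<bullet> x)) * a k x * fourier u x)"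

definition formal_adjoint ::
    "((int ^ 'n::finite \<Rightarrow> complex) \<Rightarrow> int ^ 'n \<Rightarrow> complex) \<Rightarrow> (int ^ 'n \<Rightarrow> complex) \<Rightarrow> int ^ 'n \<Rightarrow> complex" where
  "formal_adjoint A v =
     (THE w. w \<in> schwartz \<and> (\<forall>u\<in>schwartz. ell2_form (A u) v = ell2_form u w))"

definition tempered_extension ::
    "((int ^ 'n::finite \<Rightarrow> complex) \<Rightarrow> int ^ 'n \<Rightarrow> complex) \<Rightarrow> (int ^ 'n \<Rightarrow> complex) \<Rightarrow> int ^ 'n \<Rightarrow> complex" where
  "tempered_extension A F =
     (THE G. G \<in> tempered \<and>
        (\<forall>u\<in>schwartz. dist_apply G (\<lambda>k. cnj (u k)) =
           dist_apply F (\<lambda>k. cnj (formal_adjoint A u k))))"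

abbreviation T_op ::
    "(int ^ 'n::finite \<Rightarrow> real ^ 'n \<Rightarrow> complex) \<Rightarrow> (int ^ 'n \<Rightarrow> complex) \<Rightarrow> int ^ 'n \<Rightarrow> complex" where
  "T_op a \<equiv> tempered_extension (pdo a)"

definition smooth_kernel ::
    "(int ^ 'n::finite \<Rightarrow> real ^ 'n \<Rightarrow> complex) \<Rightarrow> (int ^ 'n \<Rightarrow> complex) set" where
  "smooth_kernel a = {u \<in> H_infinity. T_op a u = (\<lambda>k. 0)}"

text \<open>The formal adjoint acts on \<open>schwartz\<close>, with which \<open>H_infinity\<close> coincides.\<close>

definition smooth_adjoint_kernel ::
    "(int ^ 'n::finite \<Rightarrow> real ^ 'n \<Rightarrow> complex) \<Rightarrow> (int ^ 'n \<Rightarrow> complex) set" where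
  "smooth_adjoint_kernel a = {u \<in> H_infinity. formal_adjoint (pdo a) u = (\<lambda>k. 0)}"

end

theory Submission
  imports Defs
begin

text \<open>
  The operator \<open>T_op a\<close> is an infinite matrix: its entry at \<open>(k, l)\<close> is the Fourier coefficient of
  \<open>a k\<close> at frequency \<open>k - l\<close> (\<open>pdo_eq_mat_apply\<close>, \<open>T_op_eq_mat_apply\<close>).  Smoothness of the symbol in
  \<open>x\<close> means rapid decay of the entries away from the diagonal, and the order \<open>m\<close> means growth like
  \<open>\<langle>k\<rangle>\<close> to the power \<open>m\<close> along the diagonal, where \<open>\<langle>k\<rangle>\<close> is \<open>japanese k\<close>.
  A function in \<open>RO\<close> varies at most polynomially, so \<open>\<phi> \<langle>k\<rangle>\<close> is a moderate weight (\<open>RO_moderate\<close>), and off-diagonal decay absorbs the variation of any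
  moderate weight.  Hence such matrices act between all weighted \<open>\<ell>\<^sup>2\<close> spaces at once, by Schur's
  test (\<open>mat_apply_wl2\<close>), and the whole theorem can be proved for matrices.

  Ellipticity gives a left and a right parametrix.  Off a finite set of \<open>k\<close> the function \<open>1 / a k\<close> is
  smooth on the torus with uniform bounds (\<open>torus_symbol_reciprocal\<close>), and the product of its matrix
  with that of \<open>a\<close> would be the identity if \<open>a k\<close> did not depend on \<open>k\<close>, because Fourier
  coefficients turn products into convolutions (\<open>fourier_coef_mult\<close>).  The dependence on \<open>k\<close> is
  controlled by the first differences of the symbol, which have order \<open>m - 1\<close>; therefore the
  remainder has order \<open>-1\<close> (\<open>parametrix_remainder\<close>).  The right parametrix is the adjoint of a left
  parametrix for the adjoint matrix.

  Compactness of the remainders is used in an elementary form: if the rows in a large finite ball are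
  deleted from a matrix of order \<open>-1\<close>, then its norm on a given weighted space is at most one half
  (\<open>half_contraction_outer\<close>), and the equation \<open>f + N f = v\<close> is solved by Banach's fixed point
  theorem.  Three consequences follow in the locale \<open>elliptic_matrix\<close>.  Solutions of \<open>K u = 0\<close> are
  rapidly decreasing (\<open>kernel_rapid\<close>) and are determined by their values on a finite ball
  (\<open>kernel_determined_by_ball\<close>), so the kernel has finite dimension and is the same in every space.
  Finally, every \<open>v\<close> that is orthogonal to the kernel of the adjoint lies in the range
  (\<open>range_if_orthogonal\<close>): the problem is reduced to finitely many coordinates, where orthogonal
  projection is available.  The range is thus the annihilator of a finite set of continuous
  functionals, hence closed, and the kernel of the adjoint, which consists of rapidly decreasing
  functions and so lies in the target space, is a complement of it (\<open>cokernel_fin_dim\<close>).  This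
  gives the index; both dimensions in it are independent of the weight.
\<close>

section \<open>The bracket on the lattice\<close>

lemma lattice_vec_simps [simp]:
  "lattice_vec 0 = 0"
  "lattice_vec (- k) = - lattice_vec k"
  "lattice_vec (k + l) = lattice_vec k + lattice_vec l"
  "lattice_vec (k - l) = lattice_vec k - lattice_vec l"
  by (simp_all add: lattice_vec_def vec_eq_iff)

lemma lattice_vec_nth [simp]: "lattice_vec k $ j = of_int (k $ j)"
  by (simp add: lattice_vec_def)

lemma japanese_square: "japanese k ^ 2 = 1 + (norm (lattice_vec k))\<^sup>2"
  unfolding japanese_def by simp

lemma japanese_ge_1 [simp]: "1 \<le> japanese k"
  unfolding japanese_def by simp

lemma japanese_pos [simp]: "0 < japanese k"
  using japanese_ge_1[of k] by linarith

lemma japanese_nonneg [simp]: "0 \<le> japanese k"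
  using japanese_pos[of k] by linarith

lemma japanese_nonzero [simp]: "japanese k \<noteq> 0"
  using japanese_pos[of k] by linarith

lemma japanese_minus [simp]: "japanese (- k) = japanese k"
  unfolding japanese_def by simp

lemma japanese_zero [simp]: "japanese 0 = 1"
  unfolding japanese_def by simp

lemma japanese_diff_commute: "japanese (k - l) = japanese (l - k)"
  using japanese_minus[of "k - l"] by simp

lemma norm_le_japanese: "norm (lattice_vec k) \<le> japanese k"
  unfolding japanese_def by (rule real_le_rsqrt) simp

lemma japanese_le_norm: "japanese k \<le> 1 + norm (lattice_vec k)"
  unfolding japanese_def
  by (rule real_le_lsqrt) (auto simp: power2_eq_square algebra_simps)

lemma japanese_add: "japanese (k + l) \<le> 2 * japanese k * japanese l"
proof -
  let ?a = "norm (lattice_vec k)" and ?b = "norm (lattice_vec l)"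
  have "(norm (lattice_vec (k + l)))\<^sup>2 \<le> (?a + ?b)\<^sup>2"
    by (simp add: norm_triangle_ineq power_mono)
  also have "(?a + ?b)\<^sup>2 \<le> 2 * ?a\<^sup>2 + 2 * ?b\<^sup>2"
    using sum_squares_bound[of ?a ?b] by (simp add: power2_eq_square algebra_simps)
  finally have "1 + (norm (lattice_vec (k + l)))\<^sup>2 \<le> 4 * (1 + ?a\<^sup>2) * (1 + ?b\<^sup>2)"
    by (simp add: algebra_simps) (smt (verit) zero_le_power2 mult_nonneg_nonneg)
  also have "\<dots> = (2 * japanese k * japanese l)\<^sup>2"
    by (simp add: power_mult_distrib japanese_square)
  finally show ?thesis
    unfolding japanese_def[of "k + l"] by (intro real_le_lsqrt) auto
qed

text \<open>Peetre's inequality: a shift changes the bracket by at most a bracket of the shift.  This is the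
  source of all weight estimates below.\<close>

lemma japanese_peetre: "japanese k \<le> 2 * japanese l * japanese (k - l)"
  using japanese_add[of l "k - l"] by simp

lemma japanese_peetre_power: "japanese k ^ N \<le> 2 ^ N * japanese l ^ N * japanese (k - l) ^ N"
  using power_mono[OF japanese_peetre[of k l], of N] by (simp add: power_mult_distrib)

lemma japanese_triangle_power:
  "japanese (k - l) ^ N \<le> 2 ^ N * japanese (k - j) ^ N * japanese (j - l) ^ N"
  using japanese_peetre_power[of "k - l" N "k - j"] by (simp add: algebra_simps)

text \<open>Bounds for the powers of the single coordinates bound the power of the bracket, because the
  largest coordinate is comparable to the norm.\<close>

lemma japanese_power_le_coordinates:
  fixes k :: "int ^ 'n::finite"
  assumes "0 \<le> x" "x \<le> C" "\<And>j. \<bar>real_of_int (k $ j)\<bar> ^ N * x \<le> C"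
  shows "japanese k ^ N * x \<le> (real CARD('n) + 1) ^ N * C"
proof -
  define P where "P = Max (range (\<lambda>j. \<bar>real_of_int (k $ j)\<bar>))"
  have "P \<in> range (\<lambda>j. \<bar>real_of_int (k $ j)\<bar>)" unfolding P_def by (rule Max_in) auto
  then obtain j where j: "P = \<bar>real_of_int (k $ j)\<bar>" by auto
  have le: "\<bar>real_of_int (k $ i)\<bar> \<le> P" for i unfolding P_def by (rule Max_ge) auto
  have "japanese k \<le> 1 + norm (lattice_vec k)" by (rule japanese_le_norm)
  also have "norm (lattice_vec k) \<le> (\<Sum>i\<in>UNIV. \<bar>lattice_vec k $ i\<bar>)" by (rule norm_le_l1_cart)
  also have "\<dots> \<le> real CARD('n) * P" using sum_bounded_above[of UNIV "\<lambda>i. \<bar>lattice_vec k $ i\<bar>" P] le by simp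
  finally have jap: "japanese k \<le> 1 + real CARD('n) * P" by simp
  show ?thesis
  proof (cases "1 \<le> P")
    case True
    have "japanese k \<le> (real CARD('n) + 1) * P" using jap True by (simp add: algebra_simps)
    hence "japanese k ^ N * x \<le> ((real CARD('n) + 1) * P) ^ N * x"
      using assms(1) by (intro mult_right_mono power_mono) auto
    also have "\<dots> = (real CARD('n) + 1) ^ N * (P ^ N * x)" by (simp add: power_mult_distrib)
    also have "\<dots> \<le> (real CARD('n) + 1) ^ N * C"
      unfolding j by (intro mult_left_mono assms(3)) auto
    finally show ?thesis .
  next
    case False
    hence "P < 1" by simp
    hence "japanese k \<le> real CARD('n) + 1"
      using jap mult_left_mono[of P 1 "real CARD('n)"] by linarith
    thus ?thesis using assms(1,2) by (intro mult_mono power_mono) auto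
  qed
qed

lemma finite_box: "finite {k :: int ^ 'n::finite. \<forall>j. k $ j \<in> {-M..M}}"
proof -
  have "{k :: int ^ 'n. \<forall>j. k $ j \<in> {-M..M}} \<subseteq> vec_lambda ` (PiE UNIV (\<lambda>_. {-M..M}))"
  proof
    fix k :: "int ^ 'n" assume "k \<in> {k. \<forall>j. k $ j \<in> {-M..M}}"
    hence "(\<lambda>j. k $ j) \<in> PiE UNIV (\<lambda>_. {-M..M})" by auto
    moreover have "k = vec_lambda (\<lambda>j. k $ j)" by simp
    ultimately show "k \<in> vec_lambda ` (PiE UNIV (\<lambda>_. {-M..M}))" by blast
  qed
  moreover have "finite (PiE (UNIV :: 'n set) (\<lambda>_. {-M..M}))" by (intro finite_PiE) auto
  ultimately show ?thesis by (meson finite_imageI finite_subset)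
qed

lemma finite_japanese_ball: "finite {k :: int ^ 'n::finite. japanese k \<le> r}"
proof (rule finite_subset[OF _ finite_box])
  show "{k :: int ^ 'n. japanese k \<le> r} \<subseteq> {k. \<forall>j. k $ j \<in> {- \<lceil>r\<rceil>..\<lceil>r\<rceil>}}"
  proof safe
    fix k :: "int ^ 'n" and j assume "japanese k \<le> r"
    hence "\<bar>real_of_int (k $ j)\<bar> \<le> r"
      using component_le_norm_cart[of "lattice_vec k" j] norm_le_japanese[of k] by simp
    thus "k $ j \<in> {- \<lceil>r\<rceil>..\<lceil>r\<rceil>}" by (simp add: abs_le_iff) linarith
  qed
qed

text \<open>The summand is at most \<open>4 / ((\<bar>i\<bar> + 1) * (\<bar>i\<bar> + 2))\<close>, which telescopes; this explains the form
  of the bound.\<close>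

lemma sum_inverse_square_int: "(\<Sum>i\<in>{-int M..int M}. 1 / (1 + (real_of_int i)\<^sup>2)) \<le> 9 - 8 / (real M + 2)"
proof (induction M)
  case (Suc M)
  let ?f = "\<lambda>i. 1 / (1 + (real_of_int i)\<^sup>2)"
  have "{-int (Suc M)..int (Suc M)} = insert (- int M - 1) (insert (int M + 1) {-int M..int M})"
    by auto
  hence "sum ?f {-int (Suc M)..int (Suc M)} = 2 / (1 + (real M + 1)\<^sup>2) + sum ?f {-int M..int M}"
    by (simp add: power2_eq_square algebra_simps)
  also have "2 / (1 + (real M + 1)\<^sup>2) \<le> 8 / ((real M + 2) * (real M + 3))"
    by (simp add: divide_simps power2_eq_square) (simp add: algebra_simps)
  also have "8 / ((real M + 2) * (real M + 3)) = 8 / (real M + 2) - 8 / (real M + 3)"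
    by (simp add: field_simps)
  finally show ?case using Suc.IH by (simp add: algebra_simps)
qed simp

text \<open>Since \<open>1 + (k $ j)\<^sup>2\<close> is at most the square of the bracket for every coordinate \<open>j\<close>, the summand
  is dominated by a product of functions of one coordinate, and the sum of the product over a box is
  the product of one-dimensional sums.\<close>

lemma summable_japanese:
  "(\<lambda>k :: int ^ 'n::finite. 1 / japanese k ^ (2 * CARD('n))) summable_on UNIV"
proof (rule nonneg_bounded_partial_sums_imp_summable_on[where C = "9 ^ CARD('n)"])
  have le: "1 / japanese k ^ (2 * CARD('n)) \<le> (\<Prod>j\<in>UNIV. 1 / (1 + (real_of_int (k $ j))\<^sup>2))"
    for k :: "int ^ 'n"
  proof -
    have "1 + (real_of_int (k $ j))\<^sup>2 \<le> japanese k ^ 2" for j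
      using component_le_norm_cart[of "lattice_vec k" j]
      by (simp add: japanese_square flip: abs_le_square_iff)
    hence "1 / (japanese k)\<^sup>2 \<le> 1 / (1 + (real_of_int (k $ j))\<^sup>2)" for j
      by (intro divide_left_mono) (auto simp: add_pos_nonneg)
    hence "(\<Prod>j\<in>(UNIV::'n set). 1 / (japanese k)\<^sup>2) \<le> (\<Prod>j\<in>UNIV. 1 / (1 + (real_of_int (k $ j))\<^sup>2))"
      by (intro prod_mono) auto
    thus ?thesis by (simp add: power_mult power_divide)
  qed
  show "\<forall>\<^sub>F F in finite_subsets_at_top UNIV.
      (\<Sum>k\<in>F. 1 / japanese (k :: int ^ 'n) ^ (2 * CARD('n))) \<le> 9 ^ CARD('n)"
  proof (rule eventually_finite_subsets_at_top_weakI)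
    fix F :: "(int ^ 'n) set" assume F: "finite F"
    define M where "M = Max (insert 0 ((\<lambda>(k, j). nat \<bar>k $ j\<bar>) ` (F \<times> UNIV)))"
    let ?P = "PiE (UNIV :: 'n set) (\<lambda>_. {-int M..int M})"
    have sub: "F \<subseteq> vec_lambda ` ?P"
    proof
      fix k assume k: "k \<in> F"
      have "nat \<bar>k $ j\<bar> \<le> M" for j
        unfolding M_def using F k by (intro Max_ge) auto
      hence "\<bar>k $ j\<bar> \<le> int M" for j by (simp add: nat_le_iff)
      hence "k $ j \<in> {-int M..int M}" for j by (simp add: abs_le_iff) (smt (verit))
      hence "(\<lambda>j. k $ j) \<in> ?P" by auto
      moreover have "k = vec_lambda (\<lambda>j. k $ j)" by simp
      ultimately show "k \<in> vec_lambda ` ?P" by blast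
    qed
    have fin: "finite ?P" by (intro finite_PiE) auto
    have "(\<Sum>k\<in>F. 1 / japanese k ^ (2 * CARD('n)))
        \<le> (\<Sum>k\<in>vec_lambda ` ?P. \<Prod>j\<in>UNIV. 1 / (1 + (real_of_int (k $ j))\<^sup>2))"
      by (rule order_trans[OF sum_mono[OF le] sum_mono2])
         (use sub fin in \<open>auto intro!: prod_nonneg\<close>)
    also have "\<dots> = (\<Sum>f\<in>?P. \<Prod>j\<in>UNIV. 1 / (1 + (real_of_int (f j))\<^sup>2))"
      by (subst sum.reindex) (auto simp: inj_on_def vec_lambda_inject)
    also have "\<dots> = (\<Prod>j\<in>(UNIV::'n set). \<Sum>i\<in>{-int M..int M}. 1 / (1 + (real_of_int i)\<^sup>2))"
      by (rule prod_sum_PiE[symmetric]) auto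
    also have "\<dots> \<le> (\<Prod>j\<in>(UNIV::'n set). 9)"
    proof (rule prod_mono, intro conjI sum_nonneg)
      have "0 \<le> 8 / (real M + 2)" by simp
      thus "(\<Sum>i\<in>{-int M..int M}. 1 / (1 + (real_of_int i)\<^sup>2)) \<le> 9"
        using sum_inverse_square_int[of M] by linarith
    qed auto
    finally show "(\<Sum>k\<in>F. 1 / japanese k ^ (2 * CARD('n))) \<le> 9 ^ CARD('n)" by simp
  qed
qed auto

lemma summable_japanese_shift:
  "(\<lambda>j :: int ^ 'n::finite. 1 / japanese (k - j) ^ (2 * CARD('n))) summable_on UNIV"
  "(\<lambda>j :: int ^ 'n::finite. 1 / japanese (j - k) ^ (2 * CARD('n))) summable_on UNIV"
proof -
  have "bij_betw (\<lambda>j. j - k) (UNIV :: (int ^ 'n) set) UNIV"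
    by (rule bij_betw_byWitness[where f' = "\<lambda>j. j + k"]) auto
  from summable_on_reindex_bij_betw[OF this, of "\<lambda>k. 1 / japanese k ^ (2 * CARD('n))"]
  show "(\<lambda>j :: int ^ 'n::finite. 1 / japanese (j - k) ^ (2 * CARD('n))) summable_on UNIV"
    using summable_japanese by simp
  thus "(\<lambda>j :: int ^ 'n::finite. 1 / japanese (k - j) ^ (2 * CARD('n))) summable_on UNIV"
    by (subst japanese_diff_commute)
qed

definition japanese_sum :: "'n::finite itself \<Rightarrow> real" where
  "japanese_sum _ = (\<Sum>\<^sub>\<infinity>k :: int ^ 'n. 1 / japanese k ^ (2 * CARD('n)))"

lemma japanese_sum_nonneg: "0 \<le> japanese_sum TYPE('n::finite)"
  unfolding japanese_sum_def by (rule infsum_nonneg) simp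

lemma infsum_japanese_shift:
  "(\<Sum>\<^sub>\<infinity>j :: int ^ 'n::finite. 1 / japanese (j - k) ^ (2 * CARD('n))) = japanese_sum TYPE('n)"
  "(\<Sum>\<^sub>\<infinity>j :: int ^ 'n::finite. 1 / japanese (k - j) ^ (2 * CARD('n))) = japanese_sum TYPE('n)"
proof -
  have "bij_betw (\<lambda>j. j - k) (UNIV :: (int ^ 'n) set) UNIV"
    by (rule bij_betw_byWitness[where f' = "\<lambda>j. j + k"]) auto
  from infsum_reindex_bij_betw[OF this, of "\<lambda>k. 1 / japanese k ^ (2 * CARD('n))"]
  show *: "(\<Sum>\<^sub>\<infinity>j :: int ^ 'n::finite. 1 / japanese (j - k) ^ (2 * CARD('n))) = japanese_sum TYPE('n)"
    by (simp add: japanese_sum_def)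
  show "(\<Sum>\<^sub>\<infinity>j :: int ^ 'n::finite. 1 / japanese (k - j) ^ (2 * CARD('n))) = japanese_sum TYPE('n)"
    unfolding *[symmetric] by (intro infsum_cong) (simp add: japanese_diff_commute)
qed

text \<open>One of the brackets of \<open>k - j\<close> and \<open>j - l\<close> is large when that of \<open>k - l\<close> is, so \<open>N\<close> powers can
  be moved out of the sum; the remaining powers make it converge.\<close>

lemma infsum_convolution_le:
  fixes f :: "int ^ 'n::finite \<Rightarrow> complex"
  assumes "\<And>j. cmod (f j) \<le> C / (japanese (k - j) ^ (N + 2 * CARD('n)) * japanese (j - l) ^ (N + 2 * CARD('n)))"
  shows "cmod (\<Sum>\<^sub>\<infinity>j. f j) \<le> 2 ^ N * C * japanese_sum TYPE('n) / japanese (k - l) ^ N"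
proof -
  define D where "D = 2 ^ N * C / japanese (k - l) ^ N"
  have C: "0 \<le> C"
  proof -
    have "0 \<le> C / (japanese (k - k) ^ (N + 2 * CARD('n)) * japanese (k - l) ^ (N + 2 * CARD('n)))"
      using order_trans[OF norm_ge_zero assms[of k]] .
    thus ?thesis by (simp add: pos_le_divide_eq)
  qed
  have le: "cmod (f j) \<le> D * (1 / japanese (j - l) ^ (2 * CARD('n)))" for j
  proof -
    let ?a = "japanese (k - j)" and ?b = "japanese (j - l)" and ?n = "2 * CARD('n)"
    have "cmod (f j) \<le> C / (?a ^ (N + ?n) * ?b ^ (N + ?n))" by (rule assms)
    also have "\<dots> \<le> C / (?a ^ N * ?b ^ (N + ?n))"
      using C by (intro divide_left_mono mult_right_mono power_increasing) (auto intro!: mult_pos_pos)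
    also have "\<dots> = C / (?a ^ N * ?b ^ N) * (1 / ?b ^ ?n)" by (simp add: power_add)
    also have "\<dots> \<le> D * (1 / ?b ^ ?n)"
    proof (rule mult_right_mono)
      have "C / (?a ^ N * ?b ^ N) = 2 ^ N * C / (2 ^ N * ?a ^ N * ?b ^ N)" by simp
      also have "\<dots> \<le> D"
        unfolding D_def using C japanese_triangle_power[of k l N j]
        by (intro divide_left_mono) (auto intro!: mult_pos_pos)
      finally show "C / (?a ^ N * ?b ^ N) \<le> D" .
    qed simp
    finally show ?thesis .
  qed
  have s: "(\<lambda>j. D * (1 / japanese (j - l) ^ (2 * CARD('n)))) summable_on UNIV"
    by (intro summable_on_cmult_right summable_japanese_shift)
  have f: "f summable_on UNIV"
    by (rule abs_summable_summable[OF Infinite_Sum.abs_summable_on_comparison_test'[OF s le]])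
  have "cmod (\<Sum>\<^sub>\<infinity>j. f j) \<le> (\<Sum>\<^sub>\<infinity>j. D * (1 / japanese (j - l) ^ (2 * CARD('n))))"
    by (rule norm_infsum_le[OF has_sum_infsum[OF f] has_sum_infsum[OF s] le])
  also have "\<dots> = D * japanese_sum TYPE('n)"
    by (simp only: infsum_cmult_right' infsum_japanese_shift)
  finally show ?thesis by (simp add: D_def)
qed

text \<open>The domination along the chain \<open>k, j, l\<close> is the form in which Fubini's theorem is used for
  products of matrices and for adjoints.\<close>

lemma abs_summable_pair:
  fixes f :: "int ^ 'n::finite \<Rightarrow> int ^ 'n \<Rightarrow> complex"
  assumes "\<And>j l. cmod (f j l) \<le> C / (japanese (k - j) ^ (2 * CARD('n)) * japanese (j - l) ^ (2 * CARD('n)))"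
  shows "(\<lambda>(j, l). f j l) summable_on UNIV \<times> UNIV"
proof -
  let ?n = "2 * CARD('n)"
  have le: "cmod (f j l) \<le> C * (1 / japanese (k - j) ^ ?n) * (1 / japanese (j - l) ^ ?n)" for j l
    using assms[of j l] by simp
  have s1: "(\<lambda>l. C * (1 / japanese (k - j) ^ ?n) * (1 / japanese (j - l) ^ ?n)) summable_on UNIV" for j
    by (intro summable_on_cmult_right summable_japanese_shift)
  have s2: "(\<lambda>j. \<Sum>\<^sub>\<infinity>l. C * (1 / japanese (k - j) ^ ?n) * (1 / japanese (j - l) ^ ?n)) summable_on UNIV"
    by (subst infsum_cmult_right', subst infsum_japanese_shift)
       (intro summable_on_cmult_right summable_on_cmult_left summable_japanese_shift)
  have s3: "(\<lambda>l. cmod (f j l)) summable_on UNIV" for j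
    by (rule Infinite_Sum.abs_summable_on_comparison_test'[OF s1[of j]]) (use le in simp)
  have "(\<lambda>x. cmod (case x of (j, l) \<Rightarrow> f j l)) summable_on (Sigma UNIV (\<lambda>_. UNIV))"
  proof (rule Infinite_Sum.abs_summable_on_Sigma_iff[THEN iffD2], intro conjI ballI)
    show "(\<lambda>y. cmod (case (x, y) of (j, l) \<Rightarrow> f j l)) summable_on UNIV" for x
      using s3 by simp
    have "(\<lambda>x. \<Sum>\<^sub>\<infinity>y. cmod (f x y)) summable_on UNIV"
    proof (rule summable_on_comparison_test[OF s2])
      show "(\<Sum>\<^sub>\<infinity>y. cmod (f x y)) \<le> (\<Sum>\<^sub>\<infinity>l. C * (1 / japanese (k - x) ^ ?n) * (1 / japanese (x - l) ^ ?n))" for x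
        by (rule infsum_mono[OF s3 s1 le])
    qed (auto intro: infsum_nonneg)
    thus "(\<lambda>x. norm (\<Sum>\<^sub>\<infinity>y. norm (case (x, y) of (j, l) \<Rightarrow> f j l))) summable_on UNIV"
      by (simp add: infsum_nonneg)
  qed
  thus ?thesis by (rule abs_summable_summable)
qed

lemma infsum_swap_decay:
  fixes f :: "int ^ 'n::finite \<Rightarrow> int ^ 'n \<Rightarrow> complex"
  assumes "\<And>j l. cmod (f j l) \<le> C / (japanese (k - j) ^ (2 * CARD('n)) * japanese (j - l) ^ (2 * CARD('n)))"
  shows "(\<Sum>\<^sub>\<infinity>j. \<Sum>\<^sub>\<infinity>l. f j l) = (\<Sum>\<^sub>\<infinity>l. \<Sum>\<^sub>\<infinity>j. f j l)"
  by (rule infsum_swap_banach) (use abs_summable_pair[OF assms] in simp)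

section \<open>Weighted square summable functions\<close>

definition l2n :: "('i \<Rightarrow> real) \<Rightarrow> real" where
  "l2n F = sqrt (\<Sum>\<^sub>\<infinity>i. (F i)\<^sup>2)"

lemma l2n_nonneg [simp]: "0 \<le> l2n F"
  unfolding l2n_def by (simp add: infsum_nonneg)

lemma L2_set_le_l2n:
  assumes "(\<lambda>i. (F i)\<^sup>2) summable_on UNIV" "finite A"
  shows "L2_set F A \<le> l2n F"
  unfolding L2_set_def l2n_def using finite_sum_le_infsum[OF assms(1,2)] by simp

lemma abs_le_l2n:
  assumes "(\<lambda>i. (F i)\<^sup>2) summable_on UNIV"
  shows "\<bar>F i\<bar> \<le> l2n F"
  using L2_set_le_l2n[OF assms, of "{i}"] by (simp add: L2_set_def)

text \<open>Square summability and bounds of the norm are always checked on finite sets, where the library has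
  \<open>L2_set\<close>.\<close>

lemma l2n_leI:
  assumes "\<And>A. finite A \<Longrightarrow> L2_set F A \<le> B"
  shows "(\<lambda>i. (F i)\<^sup>2) summable_on UNIV" "l2n F \<le> B"
proof -
  have B: "0 \<le> B" using assms[of "{}"] by simp
  have *: "(\<Sum>i\<in>A. (F i)\<^sup>2) \<le> B\<^sup>2" if "finite A" for A
    using assms[OF that] by (simp add: L2_set_def sqrt_le_D)
  show s: "(\<lambda>i. (F i)\<^sup>2) summable_on UNIV"
    by (rule nonneg_bounded_partial_sums_imp_summable_on[where C = "B\<^sup>2"])
       (auto intro!: eventually_finite_subsets_at_top_weakI *)
  have "(\<Sum>\<^sub>\<infinity>i. (F i)\<^sup>2) \<le> B\<^sup>2"
    by (rule infsum_le_finite_sums[OF s]) (auto intro: *)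
  thus "l2n F \<le> B" unfolding l2n_def using B by (simp add: real_le_lsqrt)
qed

lemma l2n_eq_0_iff:
  assumes "(\<lambda>i. (F i)\<^sup>2) summable_on UNIV"
  shows "l2n F = 0 \<longleftrightarrow> (\<forall>i. F i = 0)"
proof
  assume "l2n F = 0"
  thus "\<forall>i. F i = 0" using abs_le_l2n[OF assms] by (metis abs_le_zero_iff)
qed (simp add: l2n_def)

text \<open>The Cauchy--Schwarz inequality for the measure with density \<open>g\<close>.\<close>

lemma infsum_Cauchy_Schwarz:
  fixes g F :: "'i \<Rightarrow> real"
  assumes g: "g summable_on UNIV" "\<And>i. 0 \<le> g i" and F: "\<And>i. 0 \<le> F i"
    and gF: "(\<lambda>i. g i * (F i)\<^sup>2) summable_on UNIV"
  shows "(\<lambda>i. g i * F i) summable_on UNIV"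
    and "(\<Sum>\<^sub>\<infinity>i. g i * F i)\<^sup>2 \<le> (\<Sum>\<^sub>\<infinity>i. g i) * (\<Sum>\<^sub>\<infinity>i. g i * (F i)\<^sup>2)"
proof -
  let ?R = "(\<Sum>\<^sub>\<infinity>i. g i) * (\<Sum>\<^sub>\<infinity>i. g i * (F i)\<^sup>2)"
  have R: "0 \<le> ?R" using g F by (intro mult_nonneg_nonneg infsum_nonneg) auto
  have *: "(\<Sum>i\<in>A. g i * F i) \<le> sqrt ?R" if A: "finite A" for A
  proof (rule real_le_rsqrt)
    have "(\<Sum>i\<in>A. g i * F i)\<^sup>2 = (\<Sum>i\<in>A. sqrt (g i) * (sqrt (g i) * F i))\<^sup>2"
      using g by (simp flip: mult.assoc)
    also have "\<dots> \<le> (\<Sum>i\<in>A. (sqrt (g i))\<^sup>2) * (\<Sum>i\<in>A. (sqrt (g i) * F i)\<^sup>2)"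
      by (rule Cauchy_Schwarz_ineq_sum)
    also have "\<dots> = (\<Sum>i\<in>A. g i) * (\<Sum>i\<in>A. g i * (F i)\<^sup>2)"
      using g by (simp add: power_mult_distrib)
    also have "\<dots> \<le> ?R"
      using g gF F A by (intro mult_mono finite_sum_le_infsum sum_nonneg infsum_nonneg) auto
    finally show "(\<Sum>i\<in>A. g i * F i)\<^sup>2 \<le> ?R" .
  qed
  show s: "(\<lambda>i. g i * F i) summable_on UNIV"
    by (rule nonneg_bounded_partial_sums_imp_summable_on[where C = "sqrt ?R"])
       (use g F in \<open>auto intro!: eventually_finite_subsets_at_top_weakI *\<close>)
  have "(\<Sum>\<^sub>\<infinity>i. g i * F i) \<le> sqrt ?R"
    by (rule infsum_le_finite_sums[OF s]) (auto intro: *)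
  thus "(\<Sum>\<^sub>\<infinity>i. g i * F i)\<^sup>2 \<le> ?R"
    using power_mono[of "\<Sum>\<^sub>\<infinity>i. g i * F i" "sqrt ?R" 2] R g F by (simp add: infsum_nonneg)
qed

lemma summable_convolution:
  fixes h :: "int ^ 'n::finite \<Rightarrow> real"
  assumes h: "h summable_on UNIV" "\<And>l. 0 \<le> h l"
  defines "g \<equiv> \<lambda>k :: int ^ 'n. 1 / japanese k ^ (2 * CARD('n))"
  shows "(\<lambda>(k, l). g (k - l) * h l) summable_on UNIV \<times> UNIV"
    and "(\<lambda>k. \<Sum>\<^sub>\<infinity>l. g (k - l) * h l) summable_on UNIV"
    and "(\<Sum>\<^sub>\<infinity>k. \<Sum>\<^sub>\<infinity>l. g (k - l) * h l) = japanese_sum TYPE('n) * (\<Sum>\<^sub>\<infinity>l. h l)"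
proof -
  have g: "0 \<le> g k" for k by (simp add: g_def)
  have inner: "(\<Sum>\<^sub>\<infinity>k. g (k - l) * h l) = japanese_sum TYPE('n) * h l" for l
    by (simp only: infsum_cmult_left' g_def infsum_japanese_shift)
  have "(\<lambda>x. norm (case x of (l, k) \<Rightarrow> g (k - l) * h l)) summable_on (Sigma UNIV (\<lambda>_. UNIV))"
  proof (rule Infinite_Sum.abs_summable_on_Sigma_iff[THEN iffD2], intro conjI ballI)
    show "(\<lambda>k. norm (case (l, k) of (l, k) \<Rightarrow> g (k - l) * h l)) summable_on UNIV" for l
      using summable_on_cmult_left[OF summable_japanese_shift(2)[of l], of "h l"] g h
      by (simp add: abs_mult g_def)
    have "(\<lambda>l. norm (\<Sum>\<^sub>\<infinity>k. norm (case (l, k) of (l, k) \<Rightarrow> g (k - l) * h l))) =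
        (\<lambda>l. japanese_sum TYPE('n) * h l)"
      using g h by (simp add: abs_mult inner japanese_sum_nonneg)
    thus "(\<lambda>l. norm (\<Sum>\<^sub>\<infinity>k. norm (case (l, k) of (l, k) \<Rightarrow> g (k - l) * h l))) summable_on UNIV"
      using summable_on_cmult_right[OF h(1)] by simp
  qed
  hence "(\<lambda>(l, k). g (k - l) * h l) summable_on UNIV \<times> UNIV"
    by (rule abs_summable_summable)
  thus s: "(\<lambda>(k, l). g (k - l) * h l) summable_on UNIV \<times> UNIV"
    by (subst summable_on_swap) (simp add: case_prod_unfold)
  show "(\<lambda>k. \<Sum>\<^sub>\<infinity>l. g (k - l) * h l) summable_on UNIV"
    by (rule summable_on_Sigma_banach) (use s in simp)
  have "(\<Sum>\<^sub>\<infinity>k. \<Sum>\<^sub>\<infinity>l. g (k - l) * h l) = (\<Sum>\<^sub>\<infinity>l. \<Sum>\<^sub>\<infinity>k. g (k - l) * h l)"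
    by (rule infsum_swap_banach[OF s])
  thus "(\<Sum>\<^sub>\<infinity>k. \<Sum>\<^sub>\<infinity>l. g (k - l) * h l) = japanese_sum TYPE('n) * (\<Sum>\<^sub>\<infinity>l. h l)"
    by (simp only: inner infsum_cmult_right')
qed

text \<open>Young's inequality for the convolution with an integrable kernel: the Cauchy--Schwarz inequality
  with respect to the kernel, followed by summation over \<open>k\<close>.\<close>

lemma young_l2:
  fixes F :: "int ^ 'n::finite \<Rightarrow> real"
  assumes F: "(\<lambda>l. (F l)\<^sup>2) summable_on UNIV" "\<And>l. 0 \<le> F l"
  defines "G \<equiv> \<lambda>k :: int ^ 'n. \<Sum>\<^sub>\<infinity>l. 1 / japanese (k - l) ^ (2 * CARD('n)) * F l"
  shows "(\<lambda>l. 1 / japanese (k - l) ^ (2 * CARD('n)) * F l) summable_on UNIV"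
    and "(\<lambda>k. (G k)\<^sup>2) summable_on UNIV"
    and "l2n G \<le> japanese_sum TYPE('n) * l2n F"
proof -
  let ?g = "\<lambda>k :: int ^ 'n. 1 / japanese k ^ (2 * CARD('n))" and ?S = "japanese_sum TYPE('n)"
  note conv = summable_convolution[OF F(1) zero_le_power2]
  have s: "(\<lambda>l. ?g (k - l) * (F l)\<^sup>2) summable_on UNIV" for k
    using summable_on_SigmaD1[of "\<lambda>k l. ?g (k - l) * (F l)\<^sup>2" UNIV "\<lambda>_. UNIV" k] conv(1) by simp
  show "(\<lambda>l. ?g (k - l) * F l) summable_on UNIV" for k
    by (rule infsum_Cauchy_Schwarz(1)[OF summable_japanese_shift(1) _ F(2) s]) simp
  have le: "(G k)\<^sup>2 \<le> ?S * (\<Sum>\<^sub>\<infinity>l. ?g (k - l) * (F l)\<^sup>2)" for k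
    using infsum_Cauchy_Schwarz(2)[OF summable_japanese_shift(1) _ F(2) s, of k]
    unfolding G_def infsum_japanese_shift by simp
  have s2: "(\<lambda>k. ?S * (\<Sum>\<^sub>\<infinity>l. ?g (k - l) * (F l)\<^sup>2)) summable_on UNIV"
    by (intro summable_on_cmult_right conv(2))
  show sG: "(\<lambda>k. (G k)\<^sup>2) summable_on UNIV"
    by (rule summable_on_comparison_test[OF s2 le]) auto
  have "(\<Sum>\<^sub>\<infinity>k. (G k)\<^sup>2) \<le> (\<Sum>\<^sub>\<infinity>k. ?S * (\<Sum>\<^sub>\<infinity>l. ?g (k - l) * (F l)\<^sup>2))"
    by (rule infsum_mono[OF sG s2 le])
  also have "\<dots> = ?S\<^sup>2 * (\<Sum>\<^sub>\<infinity>l. (F l)\<^sup>2)"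
    by (simp only: infsum_cmult_right' conv(3)) (simp add: power2_eq_square)
  finally have "l2n G \<le> sqrt (?S\<^sup>2 * (\<Sum>\<^sub>\<infinity>l. (F l)\<^sup>2))"
    unfolding l2n_def by (rule real_sqrt_le_mono)
  thus "l2n G \<le> ?S * l2n F"
    by (simp add: l2n_def real_sqrt_mult japanese_sum_nonneg)
qed

definition wl2 :: "(int ^ 'n::finite \<Rightarrow> real) \<Rightarrow> (int ^ 'n \<Rightarrow> complex) set" where
  "wl2 p = {u. (\<lambda>k. (p k * cmod (u k))\<^sup>2) summable_on UNIV}"

definition wnorm :: "(int ^ 'n::finite \<Rightarrow> real) \<Rightarrow> (int ^ 'n \<Rightarrow> complex) \<Rightarrow> real" where
  "wnorm p u = l2n (\<lambda>k. p k * cmod (u k))"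

lemma wnorm_nonneg [simp]: "0 \<le> wnorm p u"
  by (simp add: wnorm_def)

lemma wl2D: "u \<in> wl2 p \<Longrightarrow> (\<lambda>k. (p k * cmod (u k))\<^sup>2) summable_on UNIV"
  by (simp add: wl2_def)

lemma wl2_pointwise:
  assumes "u \<in> wl2 p"
  shows "p k * cmod (u k) \<le> wnorm p u"
  using abs_le_l2n[OF wl2D[OF assms], of k] by (simp add: wnorm_def)

lemma wl2_leI:
  assumes v: "v \<in> wl2 p" and le: "\<And>k. 0 \<le> p' k * cmod (u k)" "\<And>k. p' k * cmod (u k) \<le> C * (p k * cmod (v k))"
  shows "u \<in> wl2 p'" "0 \<le> C \<Longrightarrow> wnorm p' u \<le> C * wnorm p v"
proof -
  have le': "(p' k * cmod (u k))\<^sup>2 \<le> C\<^sup>2 * (p k * cmod (v k))\<^sup>2" for k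
    using power_mono[OF le(2)[of k] le(1)[of k], of 2] by (simp add: power_mult_distrib)
  have s: "(\<lambda>k. C\<^sup>2 * (p k * cmod (v k))\<^sup>2) summable_on UNIV"
    by (intro summable_on_cmult_right wl2D v)
  show u: "u \<in> wl2 p'"
    unfolding wl2_def by (simp, rule summable_on_comparison_test[OF s le']) auto
  assume C: "0 \<le> C"
  have "(\<Sum>\<^sub>\<infinity>k. (p' k * cmod (u k))\<^sup>2) \<le> (\<Sum>\<^sub>\<infinity>k. C\<^sup>2 * (p k * cmod (v k))\<^sup>2)"
    by (rule infsum_mono[OF wl2D[OF u] s le'])
  also have "\<dots> = C\<^sup>2 * (\<Sum>\<^sub>\<infinity>k. (p k * cmod (v k))\<^sup>2)" by (rule infsum_cmult_right')
  finally have "wnorm p' u \<le> sqrt (C\<^sup>2 * (\<Sum>\<^sub>\<infinity>k. (p k * cmod (v k))\<^sup>2))"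
    unfolding wnorm_def l2n_def by (rule real_sqrt_le_mono)
  thus "wnorm p' u \<le> C * wnorm p v"
    using C by (simp add: wnorm_def l2n_def real_sqrt_mult)
qed

context
  fixes p :: "int ^ 'n::finite \<Rightarrow> real"
  assumes pos: "\<And>k. 0 < p k"
begin

lemma wl2_add:
  assumes "u \<in> wl2 p" "v \<in> wl2 p"
  shows "(\<lambda>k. u k + v k) \<in> wl2 p" "wnorm p (\<lambda>k. u k + v k) \<le> wnorm p u + wnorm p v"
proof -
  have "L2_set (\<lambda>k. p k * cmod (u k + v k)) A \<le> wnorm p u + wnorm p v" if A: "finite A" for A
  proof -
    have "L2_set (\<lambda>k. p k * cmod (u k + v k)) A \<le> L2_set (\<lambda>k. p k * cmod (u k) + p k * cmod (v k)) A"
      using pos by (intro L2_set_mono) (auto simp: norm_triangle_ineq less_imp_le simp flip: distrib_left)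
    also have "\<dots> \<le> L2_set (\<lambda>k. p k * cmod (u k)) A + L2_set (\<lambda>k. p k * cmod (v k)) A"
      by (rule L2_set_triangle_ineq)
    also have "\<dots> \<le> wnorm p u + wnorm p v"
      unfolding wnorm_def by (intro add_mono L2_set_le_l2n wl2D assms A)
    finally show ?thesis .
  qed
  from l2n_leI[OF this] show "(\<lambda>k. u k + v k) \<in> wl2 p" "wnorm p (\<lambda>k. u k + v k) \<le> wnorm p u + wnorm p v"
    by (auto simp: wl2_def wnorm_def)
qed

lemma wl2_smult:
  assumes "u \<in> wl2 p"
  shows "(\<lambda>k. c * u k) \<in> wl2 p" "wnorm p (\<lambda>k. c * u k) = cmod c * wnorm p u"
proof -
  have eq: "(p k * cmod (c * u k))\<^sup>2 = (cmod c)\<^sup>2 * (p k * cmod (u k))\<^sup>2" for k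
    by (simp add: norm_mult power_mult_distrib)
  show "(\<lambda>k. c * u k) \<in> wl2 p"
    unfolding wl2_def mem_Collect_eq eq by (rule summable_on_cmult_right[OF wl2D[OF assms]])
  show "wnorm p (\<lambda>k. c * u k) = cmod c * wnorm p u"
    unfolding wnorm_def l2n_def eq infsum_cmult_right' by (simp add: real_sqrt_mult)
qed

lemma wl2_zero [simp]: "(\<lambda>k. 0) \<in> wl2 p" "wnorm p (\<lambda>k. 0) = 0"
  by (simp_all add: wl2_def wnorm_def l2n_def)

lemma wl2_uminus:
  assumes "u \<in> wl2 p"
  shows "(\<lambda>k. - u k) \<in> wl2 p" "wnorm p (\<lambda>k. - u k) = wnorm p u"
  using wl2_smult[OF assms, of "-1"] by simp_all

lemma wl2_diff:
  assumes "u \<in> wl2 p" "v \<in> wl2 p"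
  shows "(\<lambda>k. u k - v k) \<in> wl2 p" "wnorm p (\<lambda>k. u k - v k) \<le> wnorm p u + wnorm p v"
  using wl2_add[OF assms(1) wl2_uminus(1)[OF assms(2)]] wl2_uminus[OF assms(2)] by simp_all

lemma wnorm_eq_0_iff:
  assumes "u \<in> wl2 p"
  shows "wnorm p u = 0 \<longleftrightarrow> u = (\<lambda>k. 0)"
proof -
  have "p k \<noteq> 0" for k using pos[of k] by simp
  thus ?thesis unfolding wnorm_def l2n_eq_0_iff[OF wl2D[OF assms]] by (simp add: fun_eq_iff)
qed

lemma wnorm_diff_commute: "wnorm p (\<lambda>k. u k - v k) = wnorm p (\<lambda>k. v k - u k)"
  by (simp add: wnorm_def norm_minus_commute)

lemma wl2_Metric_space:
  "Metric_space (wl2 p) (\<lambda>u v. if u \<in> wl2 p \<and> v \<in> wl2 p then wnorm p (\<lambda>k. u k - v k) else 0)"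
proof
  fix u v w assume uvw: "u \<in> wl2 p" "v \<in> wl2 p" "w \<in> wl2 p"
  show "(if u \<in> wl2 p \<and> v \<in> wl2 p then wnorm p (\<lambda>k. u k - v k) else 0) = 0 \<longleftrightarrow> u = v"
    using uvw wnorm_eq_0_iff[OF wl2_diff(1)[OF uvw(1,2)]] by (auto simp: fun_eq_iff)
  show "(if u \<in> wl2 p \<and> w \<in> wl2 p then wnorm p (\<lambda>k. u k - w k) else 0) \<le>
      (if u \<in> wl2 p \<and> v \<in> wl2 p then wnorm p (\<lambda>k. u k - v k) else 0) +
      (if v \<in> wl2 p \<and> w \<in> wl2 p then wnorm p (\<lambda>k. v k - w k) else 0)"
    using wl2_add(2)[OF wl2_diff(1)[OF uvw(1,2)] wl2_diff(1)[OF uvw(2,3)]] uvw by simp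
qed (auto intro: wnorm_diff_commute)

text \<open>A Cauchy sequence converges at every point because the weight is positive, and the estimates on
  finite sets pass to the limit in one index.\<close>

lemma wl2_complete:
  "Metric_space.mcomplete (wl2 p) (\<lambda>u v. if u \<in> wl2 p \<and> v \<in> wl2 p then wnorm p (\<lambda>k. u k - v k) else 0)"
proof -
  interpret Metric_space "wl2 p" "\<lambda>u v. if u \<in> wl2 p \<and> v \<in> wl2 p then wnorm p (\<lambda>k. u k - v k) else 0"
    by (rule wl2_Metric_space)
  show mcomplete
    unfolding mcomplete_def
  proof (intro allI impI)
    fix s :: "nat \<Rightarrow> int ^ 'n \<Rightarrow> complex"
    assume s: "MCauchy s"
    hence mem: "s i \<in> wl2 p" for i by (auto simp: MCauchy_def)
    have cau: "\<exists>N. \<forall>i\<ge>N. \<forall>j\<ge>N. wnorm p (\<lambda>k. s i k - s j k) < e" if "e > 0" for e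
      using s that mem unfolding MCauchy_def by auto
    have "Cauchy (\<lambda>i. s i k)" for k
    proof (rule metric_CauchyI)
      fix e :: real assume e: "e > 0"
      obtain N where N: "\<forall>i\<ge>N. \<forall>j\<ge>N. wnorm p (\<lambda>k. s i k - s j k) < p k * e"
        using cau[of "p k * e"] pos[of k] e by auto
      have "dist (s i k) (s j k) < e" if "i \<ge> N" "j \<ge> N" for i j
      proof -
        have "p k * cmod (s i k - s j k) < p k * e"
          using wl2_pointwise[OF wl2_diff(1)[OF mem[of i] mem[of j]], of k] N that
          by (meson order_le_less_trans)
        thus ?thesis using pos[of k] by (simp add: dist_norm)
      qed
      thus "\<exists>M. \<forall>i\<ge>M. \<forall>j\<ge>M. dist (s i k) (s j k) < e" by blast
    qed
    hence "\<forall>k. \<exists>l. (\<lambda>i. s i k) \<longlonglongrightarrow> l" by (simp add: Cauchy_convergent convergentD)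
    then obtain u where u: "\<And>k. (\<lambda>i. s i k) \<longlonglongrightarrow> u k" by metis
    have tail: "(\<lambda>k. s i k - u k) \<in> wl2 p \<and> wnorm p (\<lambda>k. s i k - u k) \<le> e"
      if N: "\<forall>i\<ge>N. \<forall>j\<ge>N. wnorm p (\<lambda>k. s i k - s j k) < e" and i: "i \<ge> N" for i N e
    proof -
      have "L2_set (\<lambda>k. p k * cmod (s i k - u k)) A \<le> e" if A: "finite A" for A
      proof (rule tendsto_upperbound)
        show "(\<lambda>j. L2_set (\<lambda>k. p k * cmod (s i k - s j k)) A) \<longlonglongrightarrow> L2_set (\<lambda>k. p k * cmod (s i k - u k)) A"
          unfolding L2_set_def by (intro tendsto_intros u)
        show "\<forall>\<^sub>F j in sequentially. L2_set (\<lambda>k. p k * cmod (s i k - s j k)) A \<le> e"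
          using eventually_ge_at_top[of N]
        proof eventually_elim
          case (elim j)
          have "L2_set (\<lambda>k. p k * cmod (s i k - s j k)) A \<le> wnorm p (\<lambda>k. s i k - s j k)"
            unfolding wnorm_def by (rule L2_set_le_l2n[OF wl2D[OF wl2_diff(1)[OF mem mem]] A])
          thus ?case using N i elim by (meson less_imp_le order_trans)
        qed
      qed simp
      from l2n_leI[OF this] show ?thesis by (auto simp: wl2_def wnorm_def)
    qed
    obtain N1 where "\<forall>i\<ge>N1. \<forall>j\<ge>N1. wnorm p (\<lambda>k. s i k - s j k) < 1" using cau[of 1] by auto
    from tail[OF this order_refl] have "(\<lambda>k. s N1 k - u k) \<in> wl2 p" by simp
    from wl2_diff(1)[OF mem[of N1] this] have umem: "u \<in> wl2 p" by simp
    have "limitin mtopology s u sequentially"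
      unfolding limitin_metric
    proof (intro conjI allI impI umem)
      fix e :: real assume "e > 0"
      then obtain N where N: "\<forall>i\<ge>N. \<forall>j\<ge>N. wnorm p (\<lambda>k. s i k - s j k) < e / 2" using cau[of "e / 2"] by auto
      have "wnorm p (\<lambda>k. s i k - u k) < e" if "i \<ge> N" for i
      proof -
        have "wnorm p (\<lambda>k. s i k - u k) \<le> e / 2" using tail[OF N that] by simp
        thus ?thesis using \<open>e > 0\<close> by linarith
      qed
      thus "\<forall>\<^sub>F i in sequentially. s i \<in> wl2 p \<and>
          (if s i \<in> wl2 p \<and> u \<in> wl2 p then wnorm p (\<lambda>k. s i k - u k) else 0) < e"
        using mem umem by (auto simp: eventually_sequentially)
    qed
    thus "\<exists>x. limitin mtopology s x sequentially" by blast
  qed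
qed

end

section \<open>Moderate weights\<close>

text \<open>The weights for which rapid off-diagonal decay implies boundedness: replacing \<open>p k\<close> by \<open>p l\<close> costs
  only a power of the bracket of \<open>k - l\<close>.\<close>

definition moderate :: "(int ^ 'n::finite \<Rightarrow> real) \<Rightarrow> bool" where
  "moderate p \<longleftrightarrow> (\<forall>k. 0 < p k) \<and> (\<exists>C M. \<forall>k l. p k \<le> C * japanese (k - l) ^ M * p l)"

lemma moderate_pos: "moderate p \<Longrightarrow> 0 < p k"
  by (simp add: moderate_def)

lemma moderateE:
  assumes "moderate p"
  obtains C M where "0 < C" "\<And>k l. p k \<le> C * japanese (k - l) ^ M * p l"
proof -
  from assms obtain C M where *: "\<And>k l. p k \<le> C * japanese (k - l) ^ M * p l"
    by (auto simp: moderate_def)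
  have "p 0 \<le> C * p 0" using *[of 0 0] by simp
  hence "0 < C" using moderate_pos[OF assms, of 0] by (smt (verit) mult_nonpos_nonneg)
  with * that show thesis by blast
qed

lemma moderateI:
  assumes "\<And>k. 0 < p k" "\<And>k l. p k \<le> C * japanese (k - l) ^ M * p l"
  shows "moderate p"
  using assms unfolding moderate_def by blast

lemma moderate_const: "0 < c \<Longrightarrow> moderate (\<lambda>k. c)"
  by (rule moderateI[where C = 1 and M = 0]) auto

lemma moderate_inverse:
  assumes "moderate p"
  shows "moderate (\<lambda>k. 1 / p k)"
proof -
  obtain C M where C: "0 < C" "\<And>k l. p k \<le> C * japanese (k - l) ^ M * p l"
    using moderateE[OF assms] by blast
  have "1 / p k \<le> C * japanese (k - l) ^ M * (1 / p l)" for k l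
    using C(2)[of l k] moderate_pos[OF assms, of k] moderate_pos[OF assms, of l]
    by (simp add: field_simps japanese_diff_commute)
  thus ?thesis using moderate_pos[OF assms] by (intro moderateI[where C = C and M = M]) auto
qed

lemma moderate_mult:
  assumes "moderate p" "moderate q"
  shows "moderate (\<lambda>k. p k * q k)"
proof -
  obtain C M where C: "0 < C" "\<And>k l. p k \<le> C * japanese (k - l) ^ M * p l"
    using moderateE[OF assms(1)] by blast
  obtain D N where D: "0 < D" "\<And>k l. q k \<le> D * japanese (k - l) ^ N * q l"
    using moderateE[OF assms(2)] by blast
  have "p k * q k \<le> (C * D) * japanese (k - l) ^ (M + N) * (p l * q l)" for k l
    using mult_mono[OF C(2)[of k l] D(2)[of k l]] moderate_pos[OF assms(1), of l] C(1) moderate_pos[OF assms(2), of k]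
    by (simp add: power_add mult_ac less_imp_le)
  thus ?thesis using moderate_pos[OF assms(1)] moderate_pos[OF assms(2)]
    by (intro moderateI[where C = "C * D" and M = "M + N"]) auto
qed

lemma moderate_divide:
  assumes "moderate p" "moderate q"
  shows "moderate (\<lambda>k. p k / q k)"
  using moderate_mult[OF assms(1) moderate_inverse[OF assms(2)]] by simp

lemma moderate_japanese: "moderate (\<lambda>k. japanese k)"
  by (rule moderateI[where C = 2 and M = 1]) (use japanese_peetre in \<open>simp_all add: mult_ac\<close>)

lemma moderate_japanese_power: "moderate (\<lambda>k. japanese k ^ j)"
  by (induction j) (auto intro: moderate_const moderate_mult moderate_japanese)

lemma moderate_powr: "moderate (\<lambda>k. japanese k powr s)"
proof -
  have nonneg: "moderate (\<lambda>k :: int ^ 'a. japanese k powr s)" if s: "0 \<le> s" for s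
  proof (rule moderateI[where C = "2 powr s" and M = "nat \<lceil>s\<rceil>"])
    fix k l :: "int ^ 'a"
    have "japanese k powr s \<le> (2 * japanese l * japanese (k - l)) powr s"
      by (intro powr_mono2 s japanese_peetre) simp
    also have "\<dots> = 2 powr s * japanese (k - l) powr s * japanese l powr s"
      by (simp add: powr_mult mult_ac)
    also have "japanese (k - l) powr s \<le> japanese (k - l) powr (real (nat \<lceil>s\<rceil>))"
      by (intro powr_mono) (auto simp: real_nat_ceiling_ge)
    also have "\<dots> = japanese (k - l) ^ nat \<lceil>s\<rceil>" by (simp add: powr_realpow)
    finally show "japanese k powr s \<le> 2 powr s * japanese (k - l) ^ nat \<lceil>s\<rceil> * japanese l powr s"
      by (simp add: mult_left_mono mult_right_mono)
  qed (simp add: powr_gt_zero)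
  show ?thesis
  proof (cases "0 \<le> s")
    case False
    hence "moderate (\<lambda>k :: int ^ 'a. 1 / japanese k powr (- s))" by (intro moderate_inverse nonneg) simp
    thus ?thesis by (simp add: powr_minus divide_simps)
  qed (rule nonneg)
qed

lemma moderate_growth:
  assumes "moderate p"
  obtains C M where "0 < C" "\<And>k. p k \<le> C * japanese k ^ M"
proof -
  obtain C M where C: "0 < C" "\<And>k l. p k \<le> C * japanese (k - l) ^ M * p l"
    using moderateE[OF assms] by blast
  show thesis
  proof (rule that)
    show "0 < C * p 0" using C moderate_pos[OF assms] by simp
    show "p k \<le> (C * p 0) * japanese k ^ M" for k using C(2)[of k 0] by (simp add: mult_ac)
  qed
qed

section \<open>Rapidly decreasing and tempered functions\<close>

text \<open>This is the space \<open>schwartz\<close>, see \<open>schwartz_eq_rapid\<close>: a bound on the function alone controls its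
  differences, which are linear combinations of translates.\<close>

definition rapid :: "(int ^ 'n::finite \<Rightarrow> complex) set" where
  "rapid = {u. \<forall>N. \<exists>C. \<forall>k. cmod (u k) \<le> C / japanese k ^ N}"

lemma rapidE:
  assumes "u \<in> rapid"
  obtains C where "0 \<le> C" "\<And>k. cmod (u k) \<le> C / japanese k ^ N"
proof -
  from assms obtain C where C: "\<And>k. cmod (u k) \<le> C / japanese k ^ N" unfolding rapid_def by blast
  moreover have "0 \<le> C" using order_trans[OF norm_ge_zero C[of 0]] by simp
  ultimately show thesis using that by blast
qed

lemma temperedE:
  assumes "u \<in> tempered"
  obtains C M where "0 \<le> C" "\<And>k. cmod (u k) \<le> C * japanese k ^ M"
proof -
  from assms obtain C M where C: "\<And>k. cmod (u k) \<le> C * japanese k ^ M" unfolding tempered_def by blast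
  moreover have "0 \<le> C" using order_trans[OF norm_ge_zero C[of 0]] by simp
  ultimately show thesis using that by blast
qed

lemma rapid_subset_tempered: "rapid \<subseteq> tempered"
proof
  fix u :: "int ^ 'n \<Rightarrow> complex" assume "u \<in> rapid"
  then obtain C where "\<And>k. cmod (u k) \<le> C / japanese k ^ 0" using rapidE by blast
  thus "u \<in> tempered" unfolding tempered_def mem_Collect_eq by (intro exI[of _ C] exI[of _ 0]) simp
qed

lemma finite_support_rapid:
  assumes "finite A" "\<And>k. k \<notin> A \<Longrightarrow> u k = 0"
  shows "u \<in> rapid"
  unfolding rapid_def mem_Collect_eq
proof (intro allI exI)
  fix N k
  show "cmod (u k) \<le> (\<Sum>l\<in>A. cmod (u l) * japanese l ^ N) / japanese k ^ N"
  proof (cases "k \<in> A")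
    case True
    hence "cmod (u k) * japanese k ^ N \<le> (\<Sum>l\<in>A. cmod (u l) * japanese l ^ N)"
      using assms(1) by (intro member_le_sum) auto
    thus ?thesis by (simp add: pos_le_divide_eq)
  qed (use assms(2) in \<open>auto intro!: divide_nonneg_nonneg sum_nonneg\<close>)
qed

lemma tempered_add:
  assumes "u \<in> tempered" "v \<in> tempered" shows "(\<lambda>k. u k + v k) \<in> tempered"
proof -
  obtain C M where C: "0 \<le> C" "\<And>k. cmod (u k) \<le> C * japanese k ^ M" using temperedE[OF assms(1)] by blast
  obtain D N where D: "0 \<le> D" "\<And>k. cmod (v k) \<le> D * japanese k ^ N" using temperedE[OF assms(2)] by blast
  have "cmod (u k + v k) \<le> (C + D) * japanese k ^ (M + N)" for k
  proof -
    have "cmod (u k + v k) \<le> C * japanese k ^ M + D * japanese k ^ N"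
      using norm_triangle_ineq[of "u k" "v k"] C(2)[of k] D(2)[of k] by linarith
    also have "\<dots> \<le> C * japanese k ^ (M + N) + D * japanese k ^ (M + N)"
      using C(1) D(1) by (intro add_mono mult_left_mono power_increasing) auto
    finally show ?thesis by (simp add: algebra_simps)
  qed
  thus ?thesis unfolding tempered_def by blast
qed

lemma tempered_smult:
  assumes "u \<in> tempered" shows "(\<lambda>k. c * u k) \<in> tempered"
proof -
  obtain C M where C: "0 \<le> C" "\<And>k. cmod (u k) \<le> C * japanese k ^ M" using temperedE[OF assms(1)] by blast
  have "cmod (c * u k) \<le> (cmod c * C) * japanese k ^ M" for k
    using mult_left_mono[OF C(2)[of k] norm_ge_zero[of c]] by (simp add: norm_mult mult_ac)
  thus ?thesis unfolding tempered_def by blast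
qed

lemma rapid_bound:
  assumes "v \<in> rapid" "moderate p" "\<And>k. cmod (u k) \<le> p k * cmod (v k)"
  shows "u \<in> rapid"
  unfolding rapid_def mem_Collect_eq
proof
  fix N
  obtain C M where C: "0 < C" "\<And>k. p k \<le> C * japanese k ^ M" using moderate_growth[OF assms(2)] by blast
  obtain D where D: "0 \<le> D" "\<And>k. cmod (v k) \<le> D / japanese k ^ (N + M)" using rapidE[OF assms(1)] by blast
  have "cmod (u k) \<le> (C * D) / japanese k ^ N" for k
  proof -
    have "cmod (u k) \<le> (C * japanese k ^ M) * (D / japanese k ^ (N + M))"
      using assms(3)[of k] mult_mono[OF C(2)[of k] D(2)[of k]] C(1) by (simp add: order_trans)
    thus ?thesis by (simp add: power_add)
  qed
  thus "\<exists>C. \<forall>k. cmod (u k) \<le> C / japanese k ^ N" by blast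
qed

lemma rapid_add:
  assumes "u \<in> rapid" "v \<in> rapid" shows "(\<lambda>k. u k + v k) \<in> rapid"
  unfolding rapid_def mem_Collect_eq
proof
  fix N
  obtain C where C: "0 \<le> C" "\<And>k. cmod (u k) \<le> C / japanese k ^ N" using rapidE[OF assms(1)] by blast
  obtain D where D: "0 \<le> D" "\<And>k. cmod (v k) \<le> D / japanese k ^ N" using rapidE[OF assms(2)] by blast
  have "cmod (u k + v k) \<le> (C + D) / japanese k ^ N" for k
    using norm_triangle_ineq[of "u k" "v k"] C(2)[of k] D(2)[of k] by (simp add: add_divide_distrib)
  thus "\<exists>C. \<forall>k. cmod (u k + v k) \<le> C / japanese k ^ N" by blast
qed

lemma rapid_smult: "u \<in> rapid \<Longrightarrow> (\<lambda>k. c * u k) \<in> rapid"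
  by (rule rapid_bound[OF _ moderate_const[of "cmod c + 1"]]) (auto simp: norm_mult mult_right_mono add_nonneg_pos)

lemma rapid_subset_wl2:
  assumes "moderate p" shows "rapid \<subseteq> wl2 (p :: int ^ 'n::finite \<Rightarrow> real)"
proof
  fix u :: "int ^ 'n \<Rightarrow> complex" assume u: "u \<in> rapid"
  have "(\<lambda>k. of_real (p k) * u k) \<in> rapid"
    by (rule rapid_bound[OF u assms]) (use moderate_pos[OF assms] in \<open>simp add: norm_mult less_imp_le\<close>)
  then obtain C where C: "0 \<le> C" "\<And>k. cmod (of_real (p k) * u k) \<le> C / japanese k ^ (2 * CARD('n))"
    using rapidE by blast
  have le: "(p k * cmod (u k))\<^sup>2 \<le> C\<^sup>2 * (1 / japanese k ^ (2 * CARD('n)))" for k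
  proof -
    have "p k * cmod (u k) \<le> C / japanese k ^ (2 * CARD('n))"
      using C(2)[of k] moderate_pos[OF assms, of k] by (simp add: norm_mult)
    hence "(p k * cmod (u k))\<^sup>2 \<le> (C / japanese k ^ (2 * CARD('n)))\<^sup>2"
      using moderate_pos[OF assms, of k] by (intro power_mono) auto
    also have "\<dots> = C\<^sup>2 * (1 / (japanese k ^ (2 * CARD('n)))\<^sup>2)" by (simp add: power_divide)
    also have "\<dots> \<le> C\<^sup>2 * (1 / japanese k ^ (2 * CARD('n)))"
      by (intro mult_left_mono divide_left_mono self_le_power) auto
    finally show ?thesis .
  qed
  show "u \<in> wl2 p"
    unfolding wl2_def mem_Collect_eq
    by (rule summable_on_comparison_test[OF summable_on_cmult_right[OF summable_japanese] le]) auto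
qed

lemma wl2_subset_tempered:
  assumes "moderate p" shows "wl2 p \<subseteq> tempered"
proof
  fix u assume u: "u \<in> wl2 p"
  obtain C M where C: "0 < C" "\<And>k. 1 / p k \<le> C * japanese k ^ M"
    using moderate_growth[OF moderate_inverse[OF assms]] by blast
  have "cmod (u k) \<le> (C * wnorm p u) * japanese k ^ M" for k
  proof -
    have "cmod (u k) = (1 / p k) * (p k * cmod (u k))" using moderate_pos[OF assms, of k] by simp
    also have "\<dots> \<le> (C * japanese k ^ M) * wnorm p u"
      using C moderate_pos[OF assms, of k] wl2_pointwise[OF u, of k] by (intro mult_mono) auto
    finally show ?thesis by (simp add: mult_ac)
  qed
  thus "u \<in> tempered" unfolding tempered_def by blast
qed

text \<open>Membership in a weighted space bounds the function pointwise by the inverse of the weight, up to a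
  constant.\<close>

lemma rapid_if_wl2_all:
  assumes p: "moderate p" and u: "\<And>j. u \<in> wl2 (\<lambda>k. p k * japanese k ^ j)"
  shows "u \<in> rapid"
  unfolding rapid_def mem_Collect_eq
proof
  fix N
  obtain C M where C: "0 < C" "\<And>k. 1 / p k \<le> C * japanese k ^ M"
    using moderate_growth[OF moderate_inverse[OF p]] by blast
  let ?w = "wnorm (\<lambda>k. p k * japanese k ^ (M + N)) u"
  have "cmod (u k) \<le> (C * ?w) / japanese k ^ N" for k
  proof -
    have "cmod (u k) * japanese k ^ (M + N) = (1 / p k) * (p k * japanese k ^ (M + N) * cmod (u k))"
      using moderate_pos[OF p, of k] by simp
    also have "\<dots> \<le> (C * japanese k ^ M) * ?w"
      using C moderate_pos[OF p, of k] wl2_pointwise[OF u, of k] by (intro mult_mono) auto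
    finally show ?thesis by (simp add: power_add field_simps)
  qed
  thus "\<exists>C. \<forall>k. cmod (u k) \<le> C / japanese k ^ N" by blast
qed

section \<open>Matrices with rapid off-diagonal decay\<close>

text \<open>The matrices of pseudo-differential operators of order \<open>m\<close> form this class for \<open>q k = \<langle>k\<rangle>\<close> to the
  power \<open>m\<close>.  Whether the weight is evaluated at the row or at the column makes no difference when it
  is moderate.\<close>

definition decay :: "(int ^ 'n::finite \<Rightarrow> real) \<Rightarrow> (int ^ 'n \<Rightarrow> int ^ 'n \<Rightarrow> complex) set" where
  "decay q = {K. \<forall>N. \<exists>C. \<forall>k l. cmod (K k l) \<le> C * q k / japanese (k - l) ^ N}"

definition mat_apply :: "(int ^ 'n::finite \<Rightarrow> int ^ 'n \<Rightarrow> complex) \<Rightarrow> (int ^ 'n \<Rightarrow> complex) \<Rightarrow> int ^ 'n \<Rightarrow> complex" where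
  "mat_apply K u k = (\<Sum>\<^sub>\<infinity>l. K k l * u l)"

definition mat_mult :: "(int ^ 'n::finite \<Rightarrow> int ^ 'n \<Rightarrow> complex) \<Rightarrow> (int ^ 'n \<Rightarrow> int ^ 'n \<Rightarrow> complex) \<Rightarrow>
    int ^ 'n \<Rightarrow> int ^ 'n \<Rightarrow> complex" where
  "mat_mult K L k l = (\<Sum>\<^sub>\<infinity>j. K k j * L j l)"

definition adj :: "(int ^ 'n::finite \<Rightarrow> int ^ 'n \<Rightarrow> complex) \<Rightarrow> int ^ 'n \<Rightarrow> int ^ 'n \<Rightarrow> complex" where
  "adj K k l = cnj (K l k)"

lemma adj_adj [simp]: "adj (adj K) = K"
  by (simp add: adj_def fun_eq_iff)

lemma decayE:
  assumes "K \<in> decay q" "moderate q"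
  obtains C where "0 \<le> C" "\<And>k l. cmod (K k l) \<le> C * q k / japanese (k - l) ^ N"
proof -
  from assms obtain C where C: "\<And>k l. cmod (K k l) \<le> C * q k / japanese (k - l) ^ N" unfolding decay_def by blast
  have "0 \<le> C * q 0" using order_trans[OF norm_ge_zero C[of 0 0]] by simp
  hence "0 \<le> C" using moderate_pos[OF assms(2), of 0] by (simp add: zero_le_mult_iff)
  with C that show thesis by blast
qed

text \<open>Conjugation with a moderate weight preserves off-diagonal decay.  All mapping properties on weighted
  spaces come from this estimate.\<close>

lemma decay_weightE:
  assumes "K \<in> decay q" "moderate q" "moderate p"
  obtains C where "0 \<le> C" "\<And>k l. p k * cmod (K k l) \<le> C * q k * p l / japanese (k - l) ^ N"
proof -
  obtain C M where C: "0 < C" "\<And>k l. p k \<le> C * japanese (k - l) ^ M * p l"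
    using moderateE[OF assms(3)] by blast
  obtain D where D: "0 \<le> D" "\<And>k l. cmod (K k l) \<le> D * q k / japanese (k - l) ^ (N + M)"
    using decayE[OF assms(1,2)] by blast
  have "p k * cmod (K k l) \<le> (C * D) * q k * p l / japanese (k - l) ^ N" for k l
  proof -
    have "p k * cmod (K k l) \<le> (C * japanese (k - l) ^ M * p l) * (D * q k / japanese (k - l) ^ (N + M))"
      using C D moderate_pos[OF assms(2), of k] moderate_pos[OF assms(3), of l] by (intro mult_mono) auto
    thus ?thesis by (simp add: power_add mult_ac)
  qed
  with C(1) D(1) that show thesis by (metis less_imp_le mult_nonneg_nonneg)
qed

lemma decay_columnI:
  assumes q: "moderate q" and K: "\<And>N. \<exists>C. \<forall>k l. cmod (K k l) \<le> C * q l / japanese (k - l) ^ N"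
  shows "K \<in> decay q"
  unfolding decay_def mem_Collect_eq
proof
  fix N
  obtain C M where C: "0 < C" "\<And>k l. q k \<le> C * japanese (k - l) ^ M * q l"
    using moderateE[OF q] by blast
  obtain D where D: "\<And>k l. cmod (K k l) \<le> D * q l / japanese (k - l) ^ (N + M)" using K by blast
  have "0 \<le> D * q 0" using order_trans[OF norm_ge_zero D[of 0 0]] by simp
  hence D0: "0 \<le> D" using moderate_pos[OF q, of 0] by (simp add: zero_le_mult_iff)
  have "cmod (K k l) \<le> (C * D) * q k / japanese (k - l) ^ N" for k l
  proof -
    have "cmod (K k l) \<le> D * (C * japanese (k - l) ^ M * q k) / japanese (k - l) ^ (N + M)"
      using D[of k l] C(2)[of l k] D0 japanese_diff_commute[of l k]
      by (elim order_trans) (intro divide_right_mono mult_left_mono, auto)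
    thus ?thesis by (simp add: power_add mult_ac)
  qed
  thus "\<exists>C. \<forall>k l. cmod (K k l) \<le> C * q k / japanese (k - l) ^ N" by blast
qed

lemma decay_adj:
  assumes "K \<in> decay q" "moderate q"
  shows "adj K \<in> decay q"
proof (rule decay_columnI[OF assms(2)])
  fix N
  obtain C where C: "0 \<le> C" "\<And>k l. cmod (K k l) \<le> C * q k / japanese (k - l) ^ N"
    using decayE[OF assms] by blast
  have "cmod (adj K k l) \<le> C * q l / japanese (k - l) ^ N" for k l
    using C(2)[of l k] by (simp add: adj_def japanese_diff_commute)
  thus "\<exists>C. \<forall>k l. cmod (adj K k l) \<le> C * q l / japanese (k - l) ^ N" by blast
qed

lemma decay_mono:
  assumes "K \<in> decay q" "moderate q" "\<And>k l. cmod (L k l) \<le> cmod (K k l)"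
  shows "L \<in> decay q"
  using assms(1,3) unfolding decay_def by (auto intro: order_trans) (meson order_trans)

lemma mat_apply_term_bound:
  assumes "K \<in> decay q" "moderate q" "u \<in> tempered"
  obtains C M where "0 \<le> C" "\<And>k l. cmod (K k l * u l) \<le> C * japanese k ^ M / japanese (k - l) ^ N"
proof -
  obtain D M where D: "0 \<le> D" "\<And>k. cmod (u k) \<le> D * japanese k ^ M" using temperedE[OF assms(3)] by blast
  obtain C L where C: "0 < C" "\<And>k. q k \<le> C * japanese k ^ L" using moderate_growth[OF assms(2)] by blast
  obtain B where B: "0 \<le> B" "\<And>k l. cmod (K k l) \<le> B * q k / japanese (k - l) ^ (N + M)"
    using decayE[OF assms(1,2)] by blast
  have "cmod (K k l * u l) \<le> (B * C * D * 2 ^ M) * japanese k ^ (L + M) / japanese (k - l) ^ N" for k l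
  proof -
    have "cmod (K k l * u l) \<le> (B * (C * japanese k ^ L) / japanese (k - l) ^ (N + M)) * (D * (2 ^ M * japanese k ^ M * japanese (k - l) ^ M))"
      unfolding norm_mult
    proof (rule mult_mono)
      show "cmod (K k l) \<le> B * (C * japanese k ^ L) / japanese (k - l) ^ (N + M)"
        using B C(2)[of k] by (intro order_trans[OF B(2)] divide_right_mono mult_left_mono) auto
      show "cmod (u l) \<le> D * (2 ^ M * japanese k ^ M * japanese (k - l) ^ M)"
        using D japanese_peetre_power[of l M k]
        by (intro order_trans[OF D(2)] mult_left_mono) (auto simp: japanese_diff_commute)
    qed (use B C in auto)
    thus ?thesis by (simp add: power_add mult_ac)
  qed
  thus thesis using B(1) C(1) D(1) by (intro that[of "B * C * D * 2 ^ M" "L + M"]) auto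
qed

lemma mat_apply_summable:
  fixes K :: "int ^ 'n::finite \<Rightarrow> int ^ 'n \<Rightarrow> complex"
  assumes "K \<in> decay q" "moderate q" "u \<in> tempered"
  shows "(\<lambda>l. K k l * u l) summable_on UNIV"
proof -
  obtain C M where C: "0 \<le> C" "\<And>k l. cmod (K k l * u l) \<le> C * japanese k ^ M / japanese (k - l) ^ (2 * CARD('n))"
    using mat_apply_term_bound[OF assms] by blast
  show ?thesis
    by (rule abs_summable_summable, rule Infinite_Sum.abs_summable_on_comparison_test'[OF
          summable_on_cmult_right[OF summable_japanese_shift(1)[of k], of "C * japanese k ^ M"]])
       (use C(2) in simp)
qed

lemma mat_apply_tempered:
  fixes K :: "int ^ 'n::finite \<Rightarrow> int ^ 'n \<Rightarrow> complex"
  assumes "K \<in> decay q" "moderate q" "u \<in> tempered"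
  shows "mat_apply K u \<in> tempered"
proof -
  obtain C M where C: "0 \<le> C" "\<And>k l. cmod (K k l * u l) \<le> C * japanese k ^ M / japanese (k - l) ^ (2 * CARD('n))"
    using mat_apply_term_bound[OF assms] by blast
  have "cmod (mat_apply K u k) \<le> (C * japanese_sum TYPE('n)) * japanese k ^ M" for k
  proof -
    have "cmod (mat_apply K u k) \<le> (\<Sum>\<^sub>\<infinity>l. (C * japanese k ^ M) * (1 / japanese (k - l) ^ (2 * CARD('n))))"
      unfolding mat_apply_def
      by (rule norm_infsum_le[OF has_sum_infsum[OF mat_apply_summable[OF assms]] has_sum_infsum[OF
            summable_on_cmult_right[OF summable_japanese_shift(1)]]]) (use C(2) in simp)
    also have "\<dots> = (C * japanese k ^ M) * japanese_sum TYPE('n)"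
      by (simp only: infsum_cmult_right' infsum_japanese_shift)
    finally show ?thesis by (simp add: mult_ac)
  qed
  thus ?thesis unfolding tempered_def by blast
qed

lemma mat_apply_rapid:
  fixes K :: "int ^ 'n::finite \<Rightarrow> int ^ 'n \<Rightarrow> complex"
  assumes "K \<in> decay q" "moderate q" "u \<in> rapid"
  shows "mat_apply K u \<in> rapid"
  unfolding rapid_def mem_Collect_eq
proof
  fix N
  obtain C M where C: "0 < C" "\<And>k. q k \<le> C * japanese k ^ M" using moderate_growth[OF assms(2)] by blast
  let ?N = "N + M + 2 * CARD('n)"
  obtain B where B: "0 \<le> B" "\<And>k l. cmod (K k l) \<le> B * q k / japanese (k - l) ^ ?N"
    using decayE[OF assms(1,2)] by blast
  obtain D where D: "0 \<le> D" "\<And>k. cmod (u k) \<le> D / japanese k ^ ?N" using rapidE[OF assms(3)] by blast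
  have "cmod (mat_apply K u k) \<le> (2 ^ (N + M) * (B * C * D) * japanese_sum TYPE('n)) / japanese k ^ N" for k
  proof -
    have "cmod (mat_apply K u k) \<le> 2 ^ (N + M) * (B * (C * japanese k ^ M) * D) * japanese_sum TYPE('n) / japanese (k - 0) ^ (N + M)"
      unfolding mat_apply_def
    proof (rule infsum_convolution_le)
      fix j
      have "cmod (K k j) \<le> B * (C * japanese k ^ M) / japanese (k - j) ^ ?N"
        using B C(2)[of k] by (intro order_trans[OF B(2)] divide_right_mono mult_left_mono) auto
      from mult_mono[OF this D(2)[of j]]
      show "cmod (K k j * u j) \<le> B * (C * japanese k ^ M) * D / (japanese (k - j) ^ ?N * japanese (j - 0) ^ ?N)"
        using B C by (simp add: norm_mult)
    qed
    thus ?thesis by (simp add: power_add mult_ac)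
  qed
  thus "\<exists>C. \<forall>k. cmod (mat_apply K u k) \<le> C / japanese k ^ N" by blast
qed

lemma mat_apply_add:
  assumes "K \<in> decay q" "moderate q" "u \<in> tempered" "v \<in> tempered"
  shows "mat_apply K (\<lambda>k. u k + v k) = (\<lambda>k. mat_apply K u k + mat_apply K v k)"
  unfolding mat_apply_def by (simp add: distrib_left infsum_add mat_apply_summable[OF assms(1,2)] assms(3,4))

lemma mat_apply_smult: "mat_apply K (\<lambda>k. c * u k) = (\<lambda>k. c * mat_apply K u k)"
  unfolding mat_apply_def by (simp add: infsum_cmult_right'[symmetric] mult.left_commute)

lemma mat_apply_diff:
  assumes "K \<in> decay q" "moderate q" "u \<in> tempered" "v \<in> tempered"
  shows "mat_apply K (\<lambda>k. u k - v k) = (\<lambda>k. mat_apply K u k - mat_apply K v k)"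
  using mat_apply_add[OF assms(1-3) tempered_smult[OF assms(4), of "-1"]] mat_apply_smult[of K "-1" v] by simp

lemma mat_apply_zero [simp]: "mat_apply K (\<lambda>k. 0) = (\<lambda>k. 0)"
  by (simp add: mat_apply_def fun_eq_iff)

lemma mat_apply_mat_mult:
  fixes K L :: "int ^ 'n::finite \<Rightarrow> int ^ 'n \<Rightarrow> complex"
  assumes K: "K \<in> decay q" "moderate q" and L: "L \<in> decay q'" "moderate q'" and u: "u \<in> tempered"
  shows "mat_apply K (mat_apply L u) = mat_apply (mat_mult K L) u"
proof
  fix k
  let ?n = "2 * CARD('n)"
  obtain C M where C: "0 \<le> C" "\<And>j l. cmod (L j l * u l) \<le> C * japanese j ^ M / japanese (j - l) ^ ?n"
    using mat_apply_term_bound[OF L u] by blast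
  have t: "(\<lambda>j. of_real (japanese j ^ M)) \<in> tempered"
    unfolding tempered_def by (auto simp: norm_power intro!: exI[of _ 1] exI[of _ M])
  obtain D M' where D: "0 \<le> D" "\<And>k j. cmod (K k j * of_real (japanese j ^ M)) \<le> D * japanese k ^ M' / japanese (k - j) ^ ?n"
    using mat_apply_term_bound[OF K t] by blast
  have bound: "cmod (K k j * (L j l * u l)) \<le> (D * japanese k ^ M' * C) / (japanese (k - j) ^ ?n * japanese (j - l) ^ ?n)" for j l
  proof -
    have "cmod (K k j * (L j l * u l)) \<le> cmod (K k j) * (C * japanese j ^ M / japanese (j - l) ^ ?n)"
      unfolding norm_mult[of "K k j"] by (rule mult_left_mono[OF C(2)]) simp
    also have "\<dots> = cmod (K k j * of_real (japanese j ^ M)) * (C / japanese (j - l) ^ ?n)"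
      by (simp add: norm_mult norm_power)
    also have "\<dots> \<le> (D * japanese k ^ M' / japanese (k - j) ^ ?n) * (C / japanese (j - l) ^ ?n)"
      by (rule mult_right_mono[OF D(2)]) (use C in simp)
    finally show ?thesis by simp
  qed
  have "mat_apply K (mat_apply L u) k = (\<Sum>\<^sub>\<infinity>j. \<Sum>\<^sub>\<infinity>l. K k j * (L j l * u l))"
    unfolding mat_apply_def by (simp add: infsum_cmult_right')
  also have "\<dots> = (\<Sum>\<^sub>\<infinity>l. \<Sum>\<^sub>\<infinity>j. K k j * (L j l * u l))"
    by (rule infsum_swap_decay[OF bound])
  also have "\<dots> = mat_apply (mat_mult K L) u k"
    unfolding mat_apply_def mat_mult_def by (simp add: infsum_cmult_left'[symmetric] mult.assoc)
  finally show "mat_apply K (mat_apply L u) k = mat_apply (mat_mult K L) u k" .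
qed

lemma ell2_form_mat_apply:
  fixes K :: "int ^ 'n::finite \<Rightarrow> int ^ 'n \<Rightarrow> complex"
  assumes K: "K \<in> decay q" "moderate q" and u: "u \<in> tempered" and v: "v \<in> rapid"
  shows "ell2_form (mat_apply K u) v = ell2_form u (mat_apply (adj K) v)"
proof -
  let ?n = "2 * CARD('n)"
  obtain C M where C: "0 \<le> C" "\<And>j l. cmod (K j l * u l) \<le> C * japanese j ^ M / japanese (j - l) ^ ?n"
    using mat_apply_term_bound[OF K u] by blast
  obtain D where D: "0 \<le> D" "\<And>j. cmod (v j) \<le> D / japanese j ^ (?n + M)" using rapidE[OF v] by blast
  have bound: "cmod (K j l * u l * cnj (v j)) \<le> C * D / (japanese (0 - j) ^ ?n * japanese (j - l) ^ ?n)" for j l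
  proof -
    have "cmod (K j l * u l * cnj (v j)) \<le> (C * japanese j ^ M / japanese (j - l) ^ ?n) * (D / japanese j ^ (?n + M))"
      using mult_mono[OF C(2)[of j l] D(2)[of j]] C D by (simp add: norm_mult)
    thus ?thesis by (simp add: power_add mult_ac)
  qed
  have "ell2_form (mat_apply K u) v = (\<Sum>\<^sub>\<infinity>j. \<Sum>\<^sub>\<infinity>l. K j l * u l * cnj (v j))"
    unfolding ell2_form_def mat_apply_def by (simp add: infsum_cmult_left')
  also have "\<dots> = (\<Sum>\<^sub>\<infinity>l. \<Sum>\<^sub>\<infinity>j. K j l * u l * cnj (v j))"
    by (rule infsum_swap_decay[OF bound])
  also have "\<dots> = (\<Sum>\<^sub>\<infinity>l. u l * (\<Sum>\<^sub>\<infinity>j. K j l * cnj (v j)))"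
    by (simp add: infsum_cmult_right'[symmetric] mult_ac)
  also have "\<dots> = ell2_form u (mat_apply (adj K) v)"
    unfolding ell2_form_def mat_apply_def adj_def infsum_cnj[symmetric] by simp
  finally show ?thesis .
qed

section \<open>Boundedness on weighted spaces\<close>

text \<open>After conjugation with the weights the matrix is dominated by a convolution kernel, so Young's
  inequality applies.\<close>

lemma wl2_schur:
  fixes p p' :: "int ^ 'n::finite \<Rightarrow> real"
  assumes pos: "\<And>k. 0 < p k" "\<And>k. 0 < p' k" and A: "0 \<le> A"
    and K: "\<And>k l. p' k * cmod (K k l) \<le> A * p l / japanese (k - l) ^ (2 * CARD('n))"
    and u: "u \<in> wl2 p"
  shows "mat_apply K u \<in> wl2 p'" "wnorm p' (mat_apply K u) \<le> A * japanese_sum TYPE('n) * wnorm p u"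
proof -
  let ?g = "\<lambda>k :: int ^ 'n. 1 / japanese k ^ (2 * CARD('n))"
  define F where "F = (\<lambda>l. p l * cmod (u l))"
  define G where "G = (\<lambda>k. \<Sum>\<^sub>\<infinity>l. ?g (k - l) * F l)"
  have F: "(\<lambda>l. (F l)\<^sup>2) summable_on UNIV" "\<And>l. 0 \<le> F l"
    using wl2D[OF u] pos by (auto simp: F_def less_imp_le)
  note young = young_l2[OF F, folded G_def]
  have G: "0 \<le> G k" for k unfolding G_def using F(2) by (intro infsum_nonneg) auto
  have le: "cmod (K k l * u l) \<le> (A / p' k) * (?g (k - l) * F l)" for k l
  proof -
    have "p' k * cmod (K k l) * cmod (u l) \<le> A * p l / japanese (k - l) ^ (2 * CARD('n)) * cmod (u l)"
      by (rule mult_right_mono[OF K]) simp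
    thus ?thesis using pos(2)[of k] by (simp add: norm_mult F_def field_simps)
  qed
  have s: "(\<lambda>l. (A / p' k) * (?g (k - l) * F l)) summable_on UNIV" for k
    by (intro summable_on_cmult_right young(1))
  have sK: "(\<lambda>l. K k l * u l) summable_on UNIV" for k
    by (rule abs_summable_summable[OF Infinite_Sum.abs_summable_on_comparison_test'[OF s le]])
  have "cmod (mat_apply K u k) \<le> (A / p' k) * G k" for k
    unfolding mat_apply_def G_def infsum_cmult_right'[symmetric]
    by (rule norm_infsum_le[OF has_sum_infsum[OF sK] has_sum_infsum[OF s] le])
  hence *: "p' k * cmod (mat_apply K u k) \<le> A * (1 * cmod (complex_of_real (G k)))" for k
    using mult_left_mono[of "cmod (mat_apply K u k)" "(A / p' k) * G k" "p' k"] pos(2)[of k] G[of k] by simp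
  have Gw: "(\<lambda>k. complex_of_real (G k)) \<in> wl2 (\<lambda>_. 1)"
    using young(2) by (simp add: wl2_def G_def)
  have Gn: "wnorm (\<lambda>_. 1) (\<lambda>k. complex_of_real (G k)) = l2n G"
    by (simp add: wnorm_def l2n_def)
  have nn: "0 \<le> p' k * cmod (mat_apply K u k)" for k using pos(2)[of k] by simp
  show "mat_apply K u \<in> wl2 p'" by (rule wl2_leI(1)[OF Gw nn *])
  have "wnorm p' (mat_apply K u) \<le> A * l2n G" using wl2_leI(2)[OF Gw nn * A] Gn by simp
  also have "\<dots> \<le> A * (japanese_sum TYPE('n) * l2n F)" by (rule mult_left_mono[OF young(3) A])
  finally show "wnorm p' (mat_apply K u) \<le> A * japanese_sum TYPE('n) * wnorm p u"
    by (simp add: wnorm_def F_def mult_ac)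
qed

lemma mat_apply_wl2:
  fixes p q :: "int ^ 'n::finite \<Rightarrow> real"
  assumes K: "K \<in> decay q" "moderate q" and p: "moderate p"
  obtains C where "\<And>u. u \<in> wl2 p \<Longrightarrow> mat_apply K u \<in> wl2 (\<lambda>k. p k / q k)"
    "\<And>u. u \<in> wl2 p \<Longrightarrow> wnorm (\<lambda>k. p k / q k) (mat_apply K u) \<le> C * wnorm p u"
proof -
  obtain C where C: "0 \<le> C" "\<And>k l. p k * cmod (K k l) \<le> C * q k * p l / japanese (k - l) ^ (2 * CARD('n))"
    using decay_weightE[OF K p] by blast
  have *: "p k / q k * cmod (K k l) \<le> C * p l / japanese (k - l) ^ (2 * CARD('n))" for k l
    using C(2)[of k l] moderate_pos[OF K(2), of k] by (simp add: field_simps)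
  have pos: "0 < p k / q k" for k using moderate_pos[OF K(2)] moderate_pos[OF p] by simp
  from wl2_schur[OF moderate_pos[OF p] pos C(1) *] show thesis by (rule that)
qed

lemma mat_apply_wl2_mem:
  assumes "K \<in> decay q" "moderate q" "moderate p" "u \<in> wl2 p"
  shows "mat_apply K u \<in> wl2 (\<lambda>k. p k / q k)"
  using mat_apply_wl2[OF assms(1-3)] assms(4) by metis

section \<open>Matrices of order minus one\<close>

text \<open>Deletes the rows in the ball of radius \<open>r\<close>.  Columns are deleted by passing to the adjoint.\<close>

definition outer :: "real \<Rightarrow> (int ^ 'n::finite \<Rightarrow> int ^ 'n \<Rightarrow> complex) \<Rightarrow> int ^ 'n \<Rightarrow> int ^ 'n \<Rightarrow> complex" where
  "outer r R k l = (if japanese k \<le> r then 0 else R k l)"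

definition half_contraction :: "(int ^ 'n::finite \<Rightarrow> real) \<Rightarrow> (int ^ 'n \<Rightarrow> int ^ 'n \<Rightarrow> complex) \<Rightarrow> bool" where
  "half_contraction p N \<longleftrightarrow> (\<forall>u\<in>wl2 p. mat_apply N u \<in> wl2 p \<and> wnorm p (mat_apply N u) \<le> 1 / 2 * wnorm p u)"

abbreviation inv_japanese :: "int ^ 'n::finite \<Rightarrow> real" where
  "inv_japanese k \<equiv> 1 / japanese k"

lemma moderate_inv_japanese: "moderate inv_japanese"
  by (rule moderate_inverse[OF moderate_japanese])

lemma outer_decay: "R \<in> decay q \<Longrightarrow> moderate q \<Longrightarrow> outer r R \<in> decay q"
  by (rule decay_mono) (auto simp: outer_def)

lemma mat_apply_outer: "mat_apply (outer r R) u k = (if japanese k \<le> r then 0 else mat_apply R u k)"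
  by (simp add: mat_apply_def outer_def)

text \<open>A matrix of order \<open>-1\<close> gains a factor \<open>1 / \<langle>k\<rangle>\<close>, which is at most \<open>1 / r\<close> on the rows that are
  left.  On the columns that are left the same gain is obtained from Peetre's inequality.  This
  replaces compactness: up to finitely many coordinates the matrix is a small perturbation.\<close>

lemma half_contraction_outer:
  fixes p :: "int ^ 'n::finite \<Rightarrow> real"
  assumes R: "R \<in> decay inv_japanese" and p: "moderate p"
  obtains r0 where "\<And>r. r0 \<le> r \<Longrightarrow> half_contraction p (outer r R)"
    "\<And>r. r0 \<le> r \<Longrightarrow> half_contraction p (adj (outer r (adj R)))"
proof -
  let ?S = "japanese_sum TYPE('n)"
  obtain C where C: "0 \<le> C"
    "\<And>k l. p k * cmod (R k l) \<le> C * inv_japanese k * p l / japanese (k - l) ^ (2 * CARD('n) + 1)"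
    using decay_weightE[OF R moderate_inv_japanese p] by blast
  have bound: "p k * cmod (R k l) \<le> (2 * C / r) * p l / japanese (k - l) ^ (2 * CARD('n))"
    if "r < japanese k \<or> r < japanese l" "0 < r" for k l r
  proof -
    have "r \<le> 2 * japanese k * japanese (k - l)"
    proof (cases "r < japanese k")
      case True
      have "japanese k * 1 \<le> japanese k * (2 * japanese (k - l))"
        using japanese_ge_1[of "k - l"] by (intro mult_left_mono) (linarith | simp)+
      also have "\<dots> = 2 * japanese k * japanese (k - l)" by simp
      finally show ?thesis using True by linarith
    next
      case False
      thus ?thesis using that(1) japanese_peetre[of l k] japanese_diff_commute[of l k] by simp
    qed
    hence "inv_japanese k \<le> 2 * japanese (k - l) / r"
      using that(2) by (simp add: field_simps)
    hence "C * inv_japanese k * p l / japanese (k - l) ^ (2 * CARD('n) + 1)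
        \<le> C * (2 * japanese (k - l) / r) * p l / japanese (k - l) ^ (2 * CARD('n) + 1)"
      using C(1) moderate_pos[OF p, of l] by (intro divide_right_mono mult_right_mono mult_left_mono) auto
    also have "\<dots> = (2 * C / r) * p l / japanese (k - l) ^ (2 * CARD('n))" by simp
    finally show ?thesis using C(2)[of k l] by linarith
  qed
  have half: "half_contraction p N"
    if r: "4 * C * ?S + 1 \<le> r" and N: "\<And>k l. N k l = 0 \<or> N k l = R k l \<and> (r < japanese k \<or> r < japanese l)"
    for N r
    unfolding half_contraction_def
  proof (intro ballI conjI)
    fix u assume u: "u \<in> wl2 p"
    have r0: "0 < r" using r C(1) japanese_sum_nonneg[where 'n = 'n] by (smt (verit) mult_nonneg_nonneg)
    have b: "p k * cmod (N k l) \<le> (2 * C / r) * p l / japanese (k - l) ^ (2 * CARD('n))" for k l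
      using N[of k l] bound[of r k l] r0 C(1) moderate_pos[OF p, of l] by auto
    have A: "0 \<le> 2 * C / r" using C(1) r0 by simp
    show "mat_apply N u \<in> wl2 p" by (rule wl2_schur(1)[OF moderate_pos[OF p] moderate_pos[OF p] A b u])
    have "2 * C / r * ?S \<le> 1 / 2" using r r0 by (simp add: field_simps)
    from mult_right_mono[OF this wnorm_nonneg[of p u]]
    show "wnorm p (mat_apply N u) \<le> 1 / 2 * wnorm p u"
      using wl2_schur(2)[OF moderate_pos[OF p] moderate_pos[OF p] A b u] by linarith
  qed
  show thesis
    by (rule that[of "4 * C * ?S + 1"]; rule half) (auto simp: outer_def adj_def)
qed

text \<open>The map \<open>f \<mapsto> v - N f\<close> is a contraction of a complete space.\<close>

lemma half_contraction_solve:
  assumes N: "N \<in> decay q" "moderate q" and p: "moderate p" and half: "half_contraction p N" and v: "v \<in> wl2 p"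
  obtains f where "f \<in> wl2 p" "\<And>k. f k + mat_apply N f k = v k"
proof -
  have pos: "\<And>k. 0 < p k" by (rule moderate_pos[OF p])
  define d where "d = (\<lambda>u v. if u \<in> wl2 p \<and> v \<in> wl2 p then wnorm p (\<lambda>k. u k - v k) else 0)"
  interpret Metric_space "wl2 p" d unfolding d_def by (rule wl2_Metric_space[OF pos])
  have closed: "mat_apply N u \<in> wl2 p" if "u \<in> wl2 p" for u using half that by (simp add: half_contraction_def)
  have closed': "(\<lambda>k. v k - mat_apply N u k) \<in> wl2 p" if "u \<in> wl2 p" for u
    by (rule wl2_diff(1)[OF pos v closed[OF that]])
  obtain f where f: "f \<in> wl2 p" "(\<lambda>k. v k - mat_apply N f k) = f"
  proof (rule Banach_fixedpoint_thm[where f = "\<lambda>f k. v k - mat_apply N f k" and k = "1 / 2"])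
    show mcomplete unfolding d_def by (rule wl2_complete[OF pos])
    fix x y assume xy: "x \<in> wl2 p" "y \<in> wl2 p"
    have t: "x \<in> tempered" "y \<in> tempered" using xy wl2_subset_tempered[OF p] by auto
    have "d (\<lambda>k. v k - mat_apply N x k) (\<lambda>k. v k - mat_apply N y k) = wnorm p (\<lambda>k. mat_apply N y k - mat_apply N x k)"
      using xy closed' by (simp add: d_def)
    also have "\<dots> = wnorm p (mat_apply N (\<lambda>k. y k - x k))"
      by (simp add: mat_apply_diff[OF N t(2,1)])
    also have "\<dots> \<le> 1 / 2 * wnorm p (\<lambda>k. y k - x k)"
      using half wl2_diff(1)[OF pos xy(2,1)] unfolding half_contraction_def by blast
    finally show "d (\<lambda>k. v k - mat_apply N x k) (\<lambda>k. v k - mat_apply N y k) \<le> 1 / 2 * d x y"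
      using xy by (simp add: d_def wnorm_diff_commute[OF pos, where u = y and v = x])
  qed (use v closed' in auto)
  show thesis
    using f(1) fun_cong[OF f(2)] by (intro that[of f]) (auto simp: algebra_simps diff_eq_eq)
qed

section \<open>The pairing between dual weighted spaces\<close>

text \<open>The weights cancel in the Cauchy--Schwarz inequality.\<close>

lemma wl2_pair:
  assumes pos: "\<And>k. 0 < p k" and u: "u \<in> wl2 p" and v: "v \<in> wl2 (\<lambda>k. 1 / p k)"
  shows "(\<lambda>k. u k * cnj (v k)) summable_on UNIV"
    "cmod (ell2_form u v) \<le> wnorm p u * wnorm (\<lambda>k. 1 / p k) v"
proof -
  let ?B = "wnorm p u * wnorm (\<lambda>k. 1 / p k) v"
  have *: "(\<Sum>k\<in>A. cmod (u k * cnj (v k))) \<le> ?B" if A: "finite A" for A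
  proof -
    have "(\<Sum>k\<in>A. cmod (u k * cnj (v k))) = (\<Sum>k\<in>A. \<bar>p k * cmod (u k)\<bar> * \<bar>1 / p k * cmod (v k)\<bar>)"
      using pos by (intro sum.cong) (auto simp: norm_mult abs_mult less_imp_neq[symmetric])
    also have "\<dots> \<le> L2_set (\<lambda>k. p k * cmod (u k)) A * L2_set (\<lambda>k. 1 / p k * cmod (v k)) A"
      by (rule L2_set_mult_ineq)
    also have "\<dots> \<le> ?B"
      unfolding wnorm_def by (intro mult_mono L2_set_le_l2n wl2D u v A) auto
    finally show ?thesis .
  qed
  have s: "(\<lambda>k. cmod (u k * cnj (v k))) summable_on UNIV"
    by (rule nonneg_bounded_partial_sums_imp_summable_on[where C = ?B])
       (auto intro!: eventually_finite_subsets_at_top_weakI *)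
  thus "(\<lambda>k. u k * cnj (v k)) summable_on UNIV" by (rule abs_summable_summable)
  have "(\<Sum>\<^sub>\<infinity>k. cmod (u k * cnj (v k))) \<le> ?B"
    by (rule infsum_le_finite_sums[OF s]) (auto intro: *)
  thus "cmod (ell2_form u v) \<le> ?B"
    unfolding ell2_form_def using norm_infsum_bound[OF s] by linarith
qed

lemma ell2_form_linear_left:
  assumes "\<And>k. 0 < p k" "u \<in> wl2 p" "v \<in> wl2 p" "w \<in> wl2 (\<lambda>k. 1 / p k)"
  shows "ell2_form (\<lambda>k. u k + c * v k) w = ell2_form u w + c * ell2_form v w"
proof -
  have "ell2_form (\<lambda>k. u k + c * v k) w = (\<Sum>\<^sub>\<infinity>k. u k * cnj (w k) + c * (v k * cnj (w k)))"
    unfolding ell2_form_def by (simp add: algebra_simps)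
  also have "\<dots> = ell2_form u w + (\<Sum>\<^sub>\<infinity>k. c * (v k * cnj (w k)))"
    unfolding ell2_form_def by (rule infsum_add)
      (use wl2_pair(1)[OF assms(1,2,4)] summable_on_cmult_right[OF wl2_pair(1)[OF assms(1,3,4)]] in auto)
  finally show ?thesis unfolding ell2_form_def infsum_cmult_right' .
qed

lemma ell2_form_cnj: "ell2_form u v = cnj (ell2_form v u)"
  unfolding ell2_form_def infsum_cnj[symmetric] by (simp add: mult.commute)

lemma ell2_form_linear_right:
  assumes "\<And>k. 0 < p k" "u \<in> wl2 p" "v \<in> wl2 (\<lambda>k. 1 / p k)" "w \<in> wl2 (\<lambda>k. 1 / p k)"
  shows "ell2_form u (\<lambda>k. v k + c * w k) = ell2_form u v + cnj c * ell2_form u w"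
  using ell2_form_linear_left[of "\<lambda>k. 1 / p k" v w u c] assms
  by (subst (1 2 3) ell2_form_cnj) (simp add: less_imp_neq[symmetric])

lemma ell2_form_diff_left:
  assumes "\<And>k. 0 < p k" "u \<in> wl2 p" "v \<in> wl2 p" "w \<in> wl2 (\<lambda>k. 1 / p k)"
  shows "ell2_form (\<lambda>k. u k - v k) w = ell2_form u w - ell2_form v w"
  using ell2_form_linear_left[OF assms, of "-1"] by simp

lemma ell2_form_self_eq_0:
  assumes "u \<in> rapid" "ell2_form u u = 0"
  shows "u = (\<lambda>k. 0)"
proof -
  have u: "u \<in> wl2 (\<lambda>k. 1)" using assms(1) rapid_subset_wl2[OF moderate_const[of 1]] by auto
  have "ell2_form u u = (\<Sum>\<^sub>\<infinity>k. complex_of_real ((1 * cmod (u k))\<^sup>2))"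
    unfolding ell2_form_def by (simp only: complex_norm_square mult_1)
  also have "\<dots> = complex_of_real (\<Sum>\<^sub>\<infinity>k. (1 * cmod (u k))\<^sup>2)"
    by (rule infsumI[OF has_sum_of_real[OF has_sum_infsum[OF wl2D[OF u]]]])
  finally have "wnorm (\<lambda>k. 1) u = 0" using assms(2) by (simp add: wnorm_def l2n_def)
  thus ?thesis using wnorm_eq_0_iff[OF _ u] by simp
qed

text \<open>For two elements of dual weighted spaces neither factor decays rapidly, so the double sum is
  dominated by means of \<open>x * y \<le> x\<^sup>2 + y\<^sup>2\<close> and summability of convolutions instead.\<close>

lemma ell2_form_mat_apply_wl2:
  fixes p :: "int ^ 'n::finite \<Rightarrow> real"
  assumes K: "K \<in> decay (\<lambda>k. 1)" and p: "moderate p" and u: "u \<in> wl2 p" and v: "v \<in> wl2 (\<lambda>k. 1 / p k)"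
  shows "ell2_form (mat_apply K u) v = ell2_form u (mat_apply (adj K) v)"
proof -
  let ?g = "\<lambda>k :: int ^ 'n. 1 / japanese k ^ (2 * CARD('n))"
  let ?F = "\<lambda>l. (p l * cmod (u l))\<^sup>2" and ?G = "\<lambda>k. (1 / p k * cmod (v k))\<^sup>2"
  obtain C where C: "0 \<le> C" "\<And>k l. p k * cmod (K k l) \<le> C * p l / japanese (k - l) ^ (2 * CARD('n))"
    using decay_weightE[OF K moderate_const p] by auto
  have F: "(\<lambda>(k, l). ?g (k - l) * ?F l) summable_on UNIV \<times> UNIV"
    by (rule summable_convolution(1)[OF wl2D[OF u]]) simp
  have "(\<lambda>(k, l). ?g (k - l) * ?G l) summable_on UNIV \<times> UNIV"
    by (rule summable_convolution(1)[OF wl2D[OF v]]) simp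
  hence "(\<lambda>(l, k). ?g (k - l) * ?G l) summable_on UNIV \<times> UNIV"
    by (subst (asm) summable_on_swap) (simp add: case_prod_unfold)
  hence G: "(\<lambda>(k, l). ?g (k - l) * ?G k) summable_on UNIV \<times> UNIV"
    by (simp add: japanese_diff_commute)
  have "(\<lambda>x. C * ((case x of (k, l) \<Rightarrow> ?g (k - l) * ?F l) + (case x of (k, l) \<Rightarrow> ?g (k - l) * ?G k))) summable_on UNIV \<times> UNIV"
    by (intro summable_on_cmult_right summable_on_add F G)
  hence s: "(\<lambda>(k, l). K k l * u l * cnj (v k)) summable_on UNIV \<times> UNIV"
  proof (rule abs_summable_summable[OF Infinite_Sum.abs_summable_on_comparison_test'])
    fix x :: "(int ^ 'n) \<times> (int ^ 'n)"
    obtain k l where x: "x = (k, l)" by (cases x)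
    let ?a = "p l * cmod (u l)" and ?b = "1 / p k * cmod (v k)"
    have pos: "0 < p k" "0 < p l" using moderate_pos[OF p] by auto
    have "cmod (K k l * u l * cnj (v k)) = (p k * cmod (K k l)) * cmod (u l) * ?b"
      using pos by (simp add: norm_mult)
    also have "\<dots> \<le> (C * p l / japanese (k - l) ^ (2 * CARD('n))) * cmod (u l) * ?b"
      using pos by (intro mult_right_mono C(2)) auto
    also have "\<dots> = C * (?g (k - l) * (?a * ?b))" by simp
    also have "\<dots> \<le> C * (?g (k - l) * (?a\<^sup>2 + ?b\<^sup>2))"
    proof (intro mult_left_mono C(1))
      have am_gm: "x * y \<le> x\<^sup>2 + y\<^sup>2" if "0 \<le> x" "0 \<le> y" for x y :: real
        using sum_squares_bound[of x y] mult_nonneg_nonneg[OF that] by linarith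
      show "?a * ?b \<le> ?a\<^sup>2 + ?b\<^sup>2" using pos by (intro am_gm) auto
    qed simp
    finally have "cmod (K k l * u l * cnj (v k)) \<le> C * (?g (k - l) * (?a\<^sup>2 + ?b\<^sup>2))" .
    thus "cmod (case x of (k, l) \<Rightarrow> K k l * u l * cnj (v k)) \<le>
        C * ((case x of (k, l) \<Rightarrow> ?g (k - l) * ?F l) + (case x of (k, l) \<Rightarrow> ?g (k - l) * ?G k))"
      by (simp only: x prod.case) (simp add: distrib_left add_divide_distrib)
  qed
  have "ell2_form (mat_apply K u) v = (\<Sum>\<^sub>\<infinity>k. \<Sum>\<^sub>\<infinity>l. K k l * u l * cnj (v k))"
    unfolding ell2_form_def mat_apply_def by (simp add: infsum_cmult_left')
  also have "\<dots> = (\<Sum>\<^sub>\<infinity>l. \<Sum>\<^sub>\<infinity>k. K k l * u l * cnj (v k))"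
    by (rule infsum_swap_banach[OF s])
  also have "\<dots> = (\<Sum>\<^sub>\<infinity>l. u l * (\<Sum>\<^sub>\<infinity>k. K k l * cnj (v k)))"
    unfolding infsum_cmult_right'[symmetric] by (simp add: mult_ac)
  also have "\<dots> = ell2_form u (mat_apply (adj K) v)"
    unfolding ell2_form_def mat_apply_def adj_def infsum_cnj[symmetric] by simp
  finally show ?thesis .
qed

section \<open>Orthogonal projection onto a finite-dimensional space\<close>

text \<open>A space of functions that are determined by their values on a finite set has finite dimension, and
  Gram--Schmidt runs over the points of this set: the functions that vanish at a point \<open>s\<close> form a
  subspace \<open>V'\<close> to which the induction applies, and if \<open>V'\<close> is not everything, then it has codimension
  one and a vector \<open>w1\<close> orthogonal to \<open>V'\<close> spans the rest.\<close>

lemma projection_exists: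
  assumes "finite S" and p: "moderate p"
    and "V \<subseteq> rapid" "(\<lambda>k. 0) \<in> V" "\<And>u v c. u \<in> V \<Longrightarrow> v \<in> V \<Longrightarrow> (\<lambda>k. u k + c * v k) \<in> V"
    and "\<And>u. u \<in> V \<Longrightarrow> (\<And>k. k \<in> S \<Longrightarrow> u k = 0) \<Longrightarrow> u = (\<lambda>k. 0)"
    and "v \<in> wl2 p"
  shows "\<exists>w\<in>V. \<forall>u\<in>V. ell2_form (\<lambda>k. v k - w k) u = 0"
  using assms(1,3-)
proof (induction S arbitrary: V v rule: finite_induct)
  case empty
  have "ell2_form (\<lambda>k. v k - 0) u = 0" if "u \<in> V" for u
  proof -
    have "u = (\<lambda>k. 0)" by (rule empty.prems(4)[OF that]) simp
    thus ?thesis by (simp add: ell2_form_def)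
  qed
  thus ?case using empty.prems(2) by (intro bexI[of _ "\<lambda>k. 0"]) auto
next
  case (insert s S)
  note V = insert.prems(1-3)
  have pos: "\<And>k. 0 < p k" by (rule moderate_pos[OF p])
  have Vp: "u \<in> wl2 p" "u \<in> wl2 (\<lambda>k. 1 / p k)" if "u \<in> V" for u
    using that V(1) rapid_subset_wl2[OF p] rapid_subset_wl2[OF moderate_inverse[OF p]] by auto
  define V' where "V' = {u \<in> V. u s = 0}"
  have proj: "\<exists>w\<in>V'. \<forall>u\<in>V'. ell2_form (\<lambda>k. v k - w k) u = 0" if v: "v \<in> wl2 p" for v
  proof (rule insert.IH)
    show "u = (\<lambda>k. 0)" if "u \<in> V'" "\<And>k. k \<in> S \<Longrightarrow> u k = 0" for u
      using that insert.prems(4)[of u] by (auto simp: V'_def)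
  qed (use V v in \<open>auto simp: V'_def\<close>)
  show ?case
  proof (cases "V' = V")
    case False
    then obtain w0 where w0: "w0 \<in> V" "w0 s \<noteq> 0" by (auto simp: V'_def)
    obtain w' where w': "w' \<in> V'" "\<And>u. u \<in> V' \<Longrightarrow> ell2_form (\<lambda>k. w0 k - w' k) u = 0"
      using proj[OF Vp(1)[OF w0(1)]] by blast
    define w1 where "w1 = (\<lambda>k. w0 k - w' k)"
    have w1: "w1 \<in> V" "w1 s \<noteq> 0" "\<And>u. u \<in> V' \<Longrightarrow> ell2_form w1 u = 0"
      using w0 w' V(3)[of w0 w' "-1"] by (auto simp: w1_def V'_def)
    have nz: "ell2_form w1 w1 \<noteq> 0"
      using ell2_form_self_eq_0[of w1] w1(1,2) V(1) by auto
    obtain w2 where w2: "w2 \<in> V'" "\<And>u. u \<in> V' \<Longrightarrow> ell2_form (\<lambda>k. v k - w2 k) u = 0"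
      using proj[OF insert.prems(5)] by blast
    define c where "c = ell2_form (\<lambda>k. v k - w2 k) w1 / ell2_form w1 w1"
    have w2V: "w2 \<in> V" using w2(1) by (simp add: V'_def)
    have vw2: "(\<lambda>k. v k - w2 k) \<in> wl2 p" by (rule wl2_diff(1)[OF pos insert.prems(5) Vp(1)[OF w2V]])
    have w1c: "(\<lambda>k. v k - (w2 k + c * w1 k)) = (\<lambda>k. (v k - w2 k) + (- c) * w1 k)" by (simp add: algebra_simps)
    have wV: "(\<lambda>k. v k - (w2 k + c * w1 k)) \<in> wl2 p"
      by (rule wl2_diff(1)[OF pos insert.prems(5) Vp(1)[OF V(3)[OF w2V w1(1)]]])
    show ?thesis
    proof (intro bexI[of _ "\<lambda>k. w2 k + c * w1 k"] ballI V(3) w2V w1(1))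
      fix u assume u: "u \<in> V"
      define d where "d = u s / w1 s"
      define u' where "u' = (\<lambda>k. u k + (- d) * w1 k)"
      have u': "u' \<in> V'" using V(3)[OF u w1(1), of "- d"] w1(2) by (simp add: V'_def u'_def d_def)
      hence u'V: "u' \<in> V" by (simp add: V'_def)
      have ueq: "u = (\<lambda>k. u' k + d * w1 k)" by (simp add: u'_def)
      have "ell2_form (\<lambda>k. v k - (w2 k + c * w1 k)) u' = 0"
        unfolding w1c using ell2_form_linear_left[OF pos vw2 Vp(1)[OF w1(1)] Vp(2)[OF u'V], of "- c"] w2(2)[OF u'] w1(3)[OF u'] by simp
      moreover have "ell2_form (\<lambda>k. v k - (w2 k + c * w1 k)) w1 = 0"
        unfolding w1c using ell2_form_linear_left[OF pos vw2 Vp(1)[OF w1(1)] Vp(2)[OF w1(1)], of "- c"] nz by (simp add: c_def)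
      ultimately show "ell2_form (\<lambda>k. v k - (w2 k + c * w1 k)) u = 0"
        by (subst ueq) (simp add: ell2_form_linear_right[OF pos wV Vp(2)[OF u'V] Vp(2)[OF w1(1)]])
    qed
  next
    case True
    thus ?thesis using proj[OF insert.prems(5)] by simp
  qed
qed

section \<open>Matrices that are invertible modulo order \<open>-1\<close>\<close>

definition id_mat :: "int ^ 'n::finite \<Rightarrow> int ^ 'n \<Rightarrow> complex" where
  "id_mat k l = (if k = l then 1 else 0)"

lemma id_mat_decay: "id_mat \<in> decay (\<lambda>k. 1)"
  unfolding decay_def id_mat_def by (auto intro!: exI[of _ 1])

lemma mat_apply_id_mat [simp]: "mat_apply id_mat u = u"
proof
  fix k
  have "mat_apply id_mat u k = (\<Sum>\<^sub>\<infinity>l\<in>{k}. u l)"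
    unfolding mat_apply_def by (rule infsum_cong_neutral) (auto simp: id_mat_def)
  thus "mat_apply id_mat u k = u k" by simp
qed

lemma mat_apply_add_matrix:
  assumes "K \<in> decay q" "moderate q" "L \<in> decay q'" "moderate q'" "u \<in> tempered"
  shows "mat_apply (\<lambda>k l. K k l + L k l) u = (\<lambda>k. mat_apply K u k + mat_apply L u k)"
  unfolding mat_apply_def by (simp add: distrib_right infsum_add mat_apply_summable[OF assms(1,2,5)] mat_apply_summable[OF assms(3,4,5)])

lemma decay_weaken:
  assumes "K \<in> decay q" "moderate q" "\<And>k. q k \<le> q' k"
  shows "K \<in> decay q'"
  unfolding decay_def mem_Collect_eq
proof
  fix N
  obtain C where C: "0 \<le> C" "\<And>k l. cmod (K k l) \<le> C * q k / japanese (k - l) ^ N"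
    using decayE[OF assms(1,2)] by blast
  have "cmod (K k l) \<le> C * q' k / japanese (k - l) ^ N" for k l
    by (rule order_trans[OF C(2)]) (intro divide_right_mono mult_left_mono assms(3) C(1), simp)
  thus "\<exists>C. \<forall>k l. cmod (K k l) \<le> C * q' k / japanese (k - l) ^ N" by blast
qed

lemma adj_mat_mult: "adj (mat_mult K L) = mat_mult (adj L) (adj K)"
  by (simp add: fun_eq_iff adj_def mat_mult_def infsum_cnj[symmetric] mult.commute)

text \<open>A matrix of order \<open>q\<close> with a left parametrix \<open>B\<close> and a right parametrix \<open>B'\<close>.  The two are
  constructed separately and need not be related.  The hypotheses are invariant under passage to the
  adjoint, which exchanges the two parametrices; so every statement about the kernel also holds for the
  kernel of the adjoint.\<close>

locale elliptic_matrix =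
  fixes q :: "int ^ 'n::finite \<Rightarrow> real" and K B B' R R' :: "int ^ 'n \<Rightarrow> int ^ 'n \<Rightarrow> complex"
  assumes q: "moderate q" and K: "K \<in> decay q"
    and B: "B \<in> decay (\<lambda>k. 1 / q k)" "B' \<in> decay (\<lambda>k. 1 / q k)"
    and R: "R \<in> decay inv_japanese" "R' \<in> decay inv_japanese"
    and BK: "mat_mult B K = (\<lambda>k l. id_mat k l + R k l)"
    and KB': "mat_mult K B' = (\<lambda>k l. id_mat k l + R' k l)"
begin

lemma q_inv: "moderate (\<lambda>k. 1 / q k)"
  by (rule moderate_inverse[OF q])

lemma elliptic_matrix_adj: "elliptic_matrix q (adj K) (adj B') (adj B) (adj R') (adj R)"
proof
  show "mat_mult (adj B') (adj K) = (\<lambda>k l. id_mat k l + adj R' k l)"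
    unfolding adj_mat_mult[symmetric] KB' by (auto simp: adj_def id_mat_def fun_eq_iff)
  show "mat_mult (adj K) (adj B) = (\<lambda>k l. id_mat k l + adj R k l)"
    unfolding adj_mat_mult[symmetric] BK by (auto simp: adj_def id_mat_def fun_eq_iff)
qed (intro q decay_adj K B R q_inv moderate_inv_japanese)+

lemma left_parametrix:
  assumes "u \<in> tempered"
  shows "mat_apply B (mat_apply K u) = (\<lambda>k. u k + mat_apply R u k)"
  unfolding mat_apply_mat_mult[OF B(1) q_inv K q assms] BK
  using mat_apply_add_matrix[OF id_mat_decay moderate_const R(1) moderate_inv_japanese assms] by simp

lemma right_parametrix:
  assumes "u \<in> tempered"
  shows "mat_apply K (mat_apply B' u) = (\<lambda>k. u k + mat_apply R' u k)"
  unfolding mat_apply_mat_mult[OF K q B(2) q_inv assms] KB'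
  using mat_apply_add_matrix[OF id_mat_decay moderate_const R(2) moderate_inv_japanese assms] by simp

text \<open>From \<open>u = B (K u) - R u\<close>, and since \<open>R\<close> gains one order, membership in a weighted space improves by
  one power of the bracket at a time.\<close>

lemma elliptic_regularity:
  assumes p: "moderate p" and u: "u \<in> wl2 p" and Ku: "mat_apply K u \<in> rapid"
  shows "u \<in> rapid"
proof -
  have ut: "u \<in> tempered" using u wl2_subset_tempered[OF p] by auto
  have s: "mat_apply B (mat_apply K u) \<in> rapid" by (rule mat_apply_rapid[OF B(1) q_inv Ku])
  have mod: "moderate (\<lambda>k. p k * japanese k ^ j)" for j
    by (rule moderate_mult[OF p moderate_japanese_power])
  have "u \<in> wl2 (\<lambda>k. p k * japanese k ^ j)" for j
  proof (induction j)
    case (Suc j)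
    have "mat_apply R u \<in> wl2 (\<lambda>k. p k * japanese k ^ j / inv_japanese k)"
      by (rule mat_apply_wl2_mem[OF R(1) moderate_inv_japanese mod Suc])
    hence Ru: "mat_apply R u \<in> wl2 (\<lambda>k. p k * japanese k ^ Suc j)" by (simp add: mult_ac)
    have "mat_apply B (mat_apply K u) \<in> wl2 (\<lambda>k. p k * japanese k ^ Suc j)"
      using s rapid_subset_wl2[OF mod] by blast
    from wl2_diff(1)[OF moderate_pos[OF mod] this Ru]
    show ?case by (simp add: left_parametrix[OF ut])
  qed (use u in simp)
  thus ?thesis by (rule rapid_if_wl2_all[OF p])
qed

lemma kernel_rapid:
  assumes "moderate p" "u \<in> wl2 p" "mat_apply K u = (\<lambda>k. 0)"
  shows "u \<in> rapid"
  by (rule elliptic_regularity[OF assms(1,2)])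
     (use assms(3) finite_support_rapid[of "{}" "\<lambda>k. 0"] in simp)

text \<open>If \<open>K u = 0\<close>, then \<open>u = - R u\<close>.  If \<open>u\<close> moreover vanishes on a large ball, then the columns of \<open>R\<close>
  in the ball do not matter, and what is left of \<open>R\<close> has norm at most one half.\<close>

lemma kernel_determined_by_ball:
  obtains r where "\<And>u. u \<in> rapid \<Longrightarrow> mat_apply K u = (\<lambda>k. 0) \<Longrightarrow> (\<And>k. japanese k \<le> r \<Longrightarrow> u k = 0) \<Longrightarrow> u = (\<lambda>k. 0)"
proof -
  have p: "moderate (\<lambda>k :: int ^ 'n. 1)" by (rule moderate_const) simp
  obtain r where r: "half_contraction (\<lambda>k. 1) (adj (outer r (adj R)))"
    using half_contraction_outer[OF R(1) p] by (metis order_refl)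
  show thesis
  proof (rule that)
    fix u assume u: "u \<in> rapid" "mat_apply K u = (\<lambda>k. 0)" "\<And>k. japanese k \<le> r \<Longrightarrow> u k = 0"
    have uw: "u \<in> wl2 (\<lambda>k. 1)" using u(1) rapid_subset_wl2[OF p] by blast
    have ut: "u \<in> tempered" using u(1) rapid_subset_tempered by blast
    have "mat_apply (adj (outer r (adj R))) u = mat_apply R u"
      unfolding mat_apply_def fun_eq_iff using u(3) by (intro allI infsum_cong) (simp add: adj_def outer_def)
    also have "\<dots> = (\<lambda>k. - u k)"
      using left_parametrix[OF ut] u(2) by (simp add: fun_eq_iff eq_neg_iff_add_eq_0 add.commute)
    finally have "wnorm (\<lambda>k. 1) (\<lambda>k. - u k) \<le> 1 / 2 * wnorm (\<lambda>k. 1) u"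
      using r uw unfolding half_contraction_def by metis
    hence "wnorm (\<lambda>k. 1) u = 0"
      using wl2_uminus(2)[OF _ uw] wnorm_nonneg[of "\<lambda>k. 1" u] by simp
    thus "u = (\<lambda>k. 0)" using wnorm_eq_0_iff[OF _ uw] by simp
  qed
qed

lemma kernel_projection:
  assumes p: "moderate p" and v: "v \<in> wl2 p"
  obtains w where "w \<in> rapid" "mat_apply K w = (\<lambda>k. 0)"
    "\<And>u. u \<in> rapid \<Longrightarrow> mat_apply K u = (\<lambda>k. 0) \<Longrightarrow> ell2_form (\<lambda>k. v k - w k) u = 0"
proof -
  obtain r where r: "\<And>u. u \<in> rapid \<Longrightarrow> mat_apply K u = (\<lambda>k. 0) \<Longrightarrow> (\<And>k. japanese k \<le> r \<Longrightarrow> u k = 0) \<Longrightarrow> u = (\<lambda>k. 0)"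
    using kernel_determined_by_ball by blast
  let ?V = "{u \<in> rapid. mat_apply K u = (\<lambda>k. 0)}"
  have "\<exists>w\<in>?V. \<forall>u\<in>?V. ell2_form (\<lambda>k. v k - w k) u = 0"
  proof (rule projection_exists[OF finite_japanese_ball[of r] p])
    show "(\<lambda>k. u k + c * v k) \<in> ?V" if "u \<in> ?V" "v \<in> ?V" for u v c
    proof -
      have "u \<in> tempered" "v \<in> tempered" using that rapid_subset_tempered by auto
      thus ?thesis
        using that mat_apply_add[OF K q _ tempered_smult] by (simp add: rapid_add rapid_smult mat_apply_smult)
    qed
  qed (use v r finite_support_rapid[of "{}" "\<lambda>k. 0"] in auto)
  thus thesis using that by blast
qed

text \<open>The Fredholm alternative.  Let \<open>N\<close> be \<open>R'\<close> without the rows in a large ball \<open>F\<close>, and solve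
  \<open>f + N f = v\<close>.  Then \<open>K (B' f) = f + R' f = v + e\<close>, where \<open>e\<close> consists of the rows of \<open>R' f\<close> in \<open>F\<close>,
  and it must be shown that \<open>e\<close> is in the range.  Let \<open>y\<close> be the projection of \<open>e\<close> onto the part \<open>W\<close>
  of the range that is supported in \<open>F\<close>, and let \<open>c = e - y\<close>.

  The functional that maps \<open>v\<close> to the pairing of \<open>- e\<close> with \<open>c\<close> is represented by the solution \<open>w\<close> of the transposed
  equation, in which \<open>N\<close> is replaced by its adjoint and \<open>v\<close> by minus the adjoint of \<open>R'\<close> applied to
  \<open>c\<close>.  It vanishes on the range, because for \<open>v\<close> in the range the corresponding \<open>e\<close> is in \<open>W\<close>, to
  which \<open>c\<close> is orthogonal.  So \<open>w\<close> is in the kernel of the adjoint and, by regularity, rapidly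
  decreasing.  If \<open>v\<close> is orthogonal to this kernel, then \<open>e\<close>, and with it \<open>c\<close>, is orthogonal to \<open>c\<close>;
  hence \<open>c = 0\<close> and \<open>e = y\<close> is in the range.\<close>

lemma range_if_orthogonal:
  assumes p: "moderate p" and v: "v \<in> wl2 (\<lambda>k. p k / q k)"
    and orth: "\<And>w. w \<in> rapid \<Longrightarrow> mat_apply (adj K) w = (\<lambda>k. 0) \<Longrightarrow> ell2_form v w = 0"
  obtains u where "u \<in> wl2 p" "mat_apply K u = v"
proof -
  \<comment> \<open>the weight of the target space and that of its dual\<close>
  define s where "s = (\<lambda>k. p k / q k)"
  define s' where "s' = (\<lambda>k. 1 / s k)"
  have s: "moderate s" unfolding s_def by (rule moderate_divide[OF p q])
  have s': "moderate s'" unfolding s'_def by (rule moderate_inverse[OF s])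
  note pos = moderate_pos[OF s] and pos' = moderate_pos[OF s']
  have vs: "v \<in> wl2 s" using v by (simp add: s_def)
  obtain r1 where r1: "\<And>r. r1 \<le> r \<Longrightarrow> half_contraction s (outer r R')"
    using half_contraction_outer[OF R(2) s] by metis
  obtain r2 where r2: "\<And>r. r2 \<le> r \<Longrightarrow> half_contraction s' (adj (outer r (adj (adj R'))))"
    using half_contraction_outer[OF decay_adj[OF R(2) moderate_inv_japanese] s'] by metis
  define r where "r = max r1 r2"
  define N where "N = outer r R'"
  have N: "N \<in> decay inv_japanese" unfolding N_def by (rule outer_decay[OF R(2) moderate_inv_japanese])
  have N1: "N \<in> decay (\<lambda>k. 1)" by (rule decay_weaken[OF N moderate_inv_japanese]) simp
  have half: "half_contraction s N" "half_contraction s' (adj N)"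
    using r1[of r] r2[of r] by (simp_all add: N_def r_def)
  define F where "F = {k :: int ^ 'n. japanese k \<le> r}"
  have finF: "finite F" unfolding F_def by (rule finite_japanese_ball)
  note temp = subsetD[OF wl2_subset_tempered[OF s]] and temp' = subsetD[OF wl2_subset_tempered[OF s']]
  \<comment> \<open>the part of the range that lives on the ball\<close>
  define W where "W = {y. (\<forall>k. k \<notin> F \<longrightarrow> y k = 0) \<and> (\<exists>u\<in>wl2 p. mat_apply K u = y)}"
  have Wrapid: "W \<subseteq> rapid" unfolding W_def using finite_support_rapid[OF finF] by auto
  have Wlin: "(\<lambda>k. u k + c * v k) \<in> W" if uv: "u \<in> W" "v \<in> W" for u v c
  proof -
    obtain a b where ab: "a \<in> wl2 p" "b \<in> wl2 p" "mat_apply K a = u" "mat_apply K b = v" using uv by (auto simp: W_def)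
    have "a \<in> tempered" "b \<in> tempered" using ab wl2_subset_tempered[OF p] by auto
    hence "mat_apply K (\<lambda>k. a k + c * b k) = (\<lambda>k. u k + c * v k)"
      using ab mat_apply_add[OF K q _ tempered_smult] by (simp add: mat_apply_smult)
    moreover have "(\<lambda>k. a k + c * b k) \<in> wl2 p"
      using ab wl2_add(1)[OF moderate_pos[OF p] ab(1) wl2_smult(1)[OF moderate_pos[OF p] ab(2)]] by simp
    ultimately show ?thesis using uv unfolding W_def by auto
  qed
  have W0: "(\<lambda>k. 0) \<in> W"
    unfolding W_def using wl2_zero(1)[OF moderate_pos[OF p]] by (auto intro!: bexI[of _ "\<lambda>k. 0"])
  \<comment> \<open>modulo the range, every element is supported in the ball\<close>
  have reduce: "(\<lambda>k. mat_apply K (mat_apply B' f) k - g k) = (\<lambda>k. if k \<in> F then mat_apply R' f k else 0)"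
    "mat_apply B' f \<in> wl2 p"
    if f: "f \<in> wl2 s" "\<And>k. f k + mat_apply N f k = g k" for f g
  proof -
    show "(\<lambda>k. mat_apply K (mat_apply B' f) k - g k) = (\<lambda>k. if k \<in> F then mat_apply R' f k else 0)"
      unfolding right_parametrix[OF temp[OF f(1)]] f(2)[symmetric]
      by (simp add: fun_eq_iff N_def mat_apply_outer F_def)
    have "mat_apply B' f \<in> wl2 (\<lambda>k. s k / (1 / q k))" by (rule mat_apply_wl2_mem[OF B(2) q_inv s f(1)])
    thus "mat_apply B' f \<in> wl2 p"
      using moderate_pos[OF q] by (simp add: s_def less_imp_neq[symmetric])
  qed
  obtain f where f: "f \<in> wl2 s" "\<And>k. f k + mat_apply N f k = v k"
    using half_contraction_solve[OF N moderate_inv_japanese s half(1) vs] by blast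
  define e where "e = (\<lambda>k. if k \<in> F then mat_apply R' f k else 0)"
  have e: "e \<in> rapid" unfolding e_def by (rule finite_support_rapid[OF finF]) simp
  note rs = subsetD[OF rapid_subset_wl2[OF s]] and rs' = subsetD[OF rapid_subset_wl2[OF s']]
  obtain y where y: "y \<in> W" "\<And>u. u \<in> W \<Longrightarrow> ell2_form (\<lambda>k. e k - y k) u = 0"
  proof -
    have "\<exists>w\<in>W. \<forall>u\<in>W. ell2_form (\<lambda>k. e k - w k) u = 0"
      by (rule projection_exists[OF finF s Wrapid W0 Wlin _ rs[OF e]]) (auto simp: W_def)
    thus thesis using that by blast
  qed
  define c where "c = (\<lambda>k. e k - y k)"
  have csupp: "k \<notin> F \<Longrightarrow> c k = 0" for k using y(1) by (auto simp: c_def e_def W_def)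
  have c: "c \<in> rapid" by (rule finite_support_rapid[OF finF csupp])
  have cW: "ell2_form u c = 0" if "u \<in> W" for u
    using y(2)[OF that] unfolding c_def[symmetric] by (subst ell2_form_cnj) simp
  define h where "h = mat_apply (adj R') c"
  have h: "h \<in> wl2 s'"
    unfolding h_def by (rule rs', rule mat_apply_rapid[OF decay_adj[OF R(2) moderate_inv_japanese] moderate_inv_japanese c])
  obtain w where w: "w \<in> wl2 s'" "\<And>k. w k + mat_apply (adj N) w k = - h k"
    using half_contraction_solve[OF decay_adj[OF N moderate_inv_japanese] moderate_inv_japanese s' half(2) wl2_uminus(1)[OF pos' h]]
    by blast
  have w': "w \<in> wl2 (\<lambda>k. 1 / s k)" and h': "h \<in> wl2 (\<lambda>k. 1 / s k)" and c': "c \<in> wl2 (\<lambda>k. 1 / s k)"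
    using w(1) h rs'[OF c] by (simp_all add: s'_def)
  \<comment> \<open>the functional represented by \<open>w\<close>\<close>
  have functional: "ell2_form g w = - ell2_form (\<lambda>k. if k \<in> F then mat_apply R' f k else 0) c"
    if f: "f \<in> wl2 s" "\<And>k. f k + mat_apply N f k = g k" for f g
  proof -
    have Nf: "mat_apply N f \<in> wl2 s" using half(1) f(1) by (simp add: half_contraction_def)
    have Nw: "mat_apply (adj N) w \<in> wl2 (\<lambda>k. 1 / s k)" using half(2) w(1) by (simp add: half_contraction_def s'_def)
    have "ell2_form g w = ell2_form (\<lambda>k. f k + 1 * mat_apply N f k) w" using f(2) by simp
    also have "\<dots> = ell2_form f w + ell2_form (mat_apply N f) w"
      by (subst ell2_form_linear_left[OF pos f(1) Nf w']) simp
    also have "ell2_form (mat_apply N f) w = ell2_form f (mat_apply (adj N) w)"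
      by (rule ell2_form_mat_apply_wl2[OF N1 s f(1) w'])
    also have "ell2_form f w + ell2_form f (mat_apply (adj N) w) = ell2_form f (\<lambda>k. w k + 1 * mat_apply (adj N) w k)"
      by (subst ell2_form_linear_right[OF pos f(1) w' Nw]) simp
    also have "\<dots> = ell2_form f (\<lambda>k. 0 + (- 1) * h k)" using w(2) by simp
    also have "\<dots> = - ell2_form f h"
      using ell2_form_linear_right[OF pos f(1) wl2_zero(1) h', of "-1"] pos by (simp add: ell2_form_def)
    also have "ell2_form f h = ell2_form (mat_apply R' f) c"
      unfolding h_def by (rule ell2_form_mat_apply[OF R(2) moderate_inv_japanese temp[OF f(1)] c, symmetric])
    also have "\<dots> = ell2_form (\<lambda>k. if k \<in> F then mat_apply R' f k else 0) c"
      unfolding ell2_form_def by (rule infsum_cong) (use csupp in auto)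
    finally show ?thesis .
  qed
  have KW: "ell2_form (mat_apply K u) w = 0" if u: "u \<in> wl2 p" for u
  proof -
    have Ku: "mat_apply K u \<in> wl2 s" unfolding s_def by (rule mat_apply_wl2_mem[OF K q p u])
    obtain f where f: "f \<in> wl2 s" "\<And>k. f k + mat_apply N f k = mat_apply K u k"
      using half_contraction_solve[OF N moderate_inv_japanese s half(1) Ku] by blast
    have "(\<lambda>k. if k \<in> F then mat_apply R' f k else 0) \<in> W"
    proof -
      have "mat_apply B' f \<in> tempered" "u \<in> tempered"
        using reduce(2)[OF f] u wl2_subset_tempered[OF p] by auto
      hence "mat_apply K (\<lambda>k. mat_apply B' f k - u k) = (\<lambda>k. if k \<in> F then mat_apply R' f k else 0)"
        unfolding reduce(1)[OF f, symmetric] by (rule mat_apply_diff[OF K q])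
      moreover have "(\<lambda>k. mat_apply B' f k - u k) \<in> wl2 p" by (rule wl2_diff(1)[OF moderate_pos[OF p] reduce(2)[OF f] u])
      ultimately show ?thesis unfolding W_def by auto
    qed
    thus ?thesis using functional[OF f] cW by simp
  qed
  have Kw: "mat_apply (adj K) w = (\<lambda>k. 0)"
  proof
    fix l
    define d :: "int ^ 'n \<Rightarrow> complex" where "d = (\<lambda>k. if k = l then 1 else 0)"
    have "d \<in> wl2 p" unfolding d_def
      using finite_support_rapid[of "{l}"] rapid_subset_wl2[OF p] by auto
    from KW[OF this] have *: "ell2_form (mat_apply K d) w = 0" .
    have "mat_apply K d k = K k l" for k
    proof -
      have "mat_apply K d k = (\<Sum>\<^sub>\<infinity>j\<in>{l}. K k j * d j)"
        unfolding mat_apply_def by (rule infsum_cong_neutral) (auto simp: d_def)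
      thus ?thesis by (simp add: d_def)
    qed
    hence "mat_apply (adj K) w l = cnj (ell2_form (mat_apply K d) w)"
      unfolding mat_apply_def ell2_form_def adj_def infsum_cnj[symmetric] by (simp add: mult.commute)
    thus "mat_apply (adj K) w l = 0" using * by simp
  qed
  have "w \<in> rapid" by (rule elliptic_matrix.kernel_rapid[OF elliptic_matrix_adj s' w(1) Kw])
  from orth[OF this Kw] have "ell2_form e c = 0" using functional[OF f] by (simp add: e_def)
  moreover have yp: "y \<in> rapid" using y(1) Wrapid by auto
  ultimately have "ell2_form c c = 0"
    using ell2_form_diff_left[OF pos rs[OF e] rs[OF yp] c'] cW[OF y(1)] by (simp add: c_def[symmetric])
  hence "c = (\<lambda>k. 0)" by (rule ell2_form_self_eq_0[OF c])
  hence "e = y" by (simp add: c_def fun_eq_iff)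
  then obtain u where u: "u \<in> wl2 p" "mat_apply K u = e" using y(1) by (auto simp: W_def)
  have "mat_apply B' f \<in> tempered" "u \<in> tempered"
    using reduce(2)[OF f] u wl2_subset_tempered[OF p] by auto
  hence "mat_apply K (\<lambda>k. mat_apply B' f k - u k) = (\<lambda>k. mat_apply K (mat_apply B' f) k - e k)"
    using mat_apply_diff[OF K q] u(2) by simp
  also have "\<dots> = v" using reduce(1)[OF f] by (auto simp: e_def[symmetric] fun_eq_iff diff_eq_eq)
  finally show thesis using that wl2_diff(1)[OF moderate_pos[OF p] reduce(2)[OF f] u(1)] by blast
qed

end

section \<open>Fourier coefficients on the torus\<close>

text \<open>Functions on the torus are periodic functions of all of space, as in \<open>smooth_on_torus\<close>.\<close>

definition torus_continuous :: "(real ^ 'n::finite \<Rightarrow> complex) \<Rightarrow> bool" where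
  "torus_continuous f \<longleftrightarrow> continuous_on UNIV f \<and> (\<forall>j x. f (x + axis j 1) = f x)"

definition echar :: "int ^ 'n::finite \<Rightarrow> real ^ 'n \<Rightarrow> complex" where
  "echar p x = exp (2 * pi * \<i> * of_real (lattice_vec p \<bullet> x))"

definition fourier_coef :: "(real ^ 'n::finite \<Rightarrow> complex) \<Rightarrow> int ^ 'n \<Rightarrow> complex" where
  "fourier_coef f p = integral (cbox 0 1) (\<lambda>x. echar p x * f x)"

lemma echar_add: "echar (p + q) x = echar p x * echar q x"
  by (simp add: echar_def inner_add_left algebra_simps exp_add)

lemma echar_shift: "echar p (x + y) = echar p x * echar p y"
  by (simp add: echar_def inner_add_right algebra_simps exp_add)

lemma echar_zero [simp]: "echar 0 x = 1" "echar p 0 = 1"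
  by (simp_all add: echar_def)

lemma norm_echar [simp]: "cmod (echar p x) = 1"
proof -
  have "echar p x = exp (\<i> * of_real (2 * pi * (lattice_vec p \<bullet> x)))"
    by (simp add: echar_def mult_ac)
  thus ?thesis by (simp only: norm_exp_i_times)
qed

lemma echar_axis: "echar p (h *\<^sub>R axis j 1) = exp (2 * pi * \<i> * of_real (h * real_of_int (p $ j)))"
  by (simp add: echar_def inner_axis)

lemma echar_axis_1 [simp]: "echar p (axis j 1) = 1"
proof -
  have "echar p (axis j 1) = exp ((2 * of_int (p $ j) * complex_of_real pi) * \<i>)"
    by (simp add: echar_def inner_axis mult_ac)
  also have "\<dots> = 1" using exp_integer_2pi[of "of_int (p $ j)"] by (simp add: mult_ac)
  finally show ?thesis .
qed

lemma continuous_on_echar [continuous_intros]: "continuous_on A (echar p)"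
  unfolding echar_def by (intro continuous_intros)

lemma torus_continuous_echar: "torus_continuous (echar p)"
  unfolding torus_continuous_def by (auto simp: echar_shift intro: continuous_intros)

lemma torus_continuous_mult: "torus_continuous f \<Longrightarrow> torus_continuous g \<Longrightarrow> torus_continuous (\<lambda>x. f x * g x)"
  unfolding torus_continuous_def by (auto intro: continuous_intros)

lemma torus_continuous_diff: "torus_continuous f \<Longrightarrow> torus_continuous g \<Longrightarrow> torus_continuous (\<lambda>x. f x - g x)"
  unfolding torus_continuous_def by (auto intro: continuous_intros)

lemma torus_continuous_const: "torus_continuous (\<lambda>x. c)"
  by (simp add: torus_continuous_def)

lemma torus_continuous_continuous: "torus_continuous f \<Longrightarrow> continuous_on A f"
  unfolding torus_continuous_def using continuous_on_subset by blast

lemma torus_continuous_integrable: "torus_continuous f \<Longrightarrow> f integrable_on cbox a b"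
  by (intro integrable_continuous torus_continuous_continuous)

lemma torus_continuous_coef_integrable: "torus_continuous f \<Longrightarrow> (\<lambda>x. echar p x * f x) integrable_on cbox a b"
  by (intro torus_continuous_integrable torus_continuous_mult torus_continuous_echar)

lemma cube_integral_split:
  fixes f :: "real ^ 'n::finite \<Rightarrow> complex"
  assumes f: "f integrable_on cbox 0 1" and c: "0 \<le> c" "c \<le> 1"
  shows "integral (cbox 0 1) f = integral (cbox 0 (1 + (c - 1) *\<^sub>R axis j 1)) f + integral (cbox (c *\<^sub>R axis j 1) 1) f"
proof -
  have "x \<in> cbox 0 1 \<and> x \<bullet> axis j 1 \<le> c \<longleftrightarrow> x \<in> cbox 0 (1 + (c - 1) *\<^sub>R axis j 1)" for x :: "real ^ 'n"
  proof
    assume "x \<in> cbox 0 (1 + (c - 1) *\<^sub>R axis j 1)"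
    hence *: "0 \<le> x $ i" "x $ i \<le> 1 + (c - 1) * (if i = j then 1 else 0)" for i
      by (simp_all add: mem_box_cart axis_def)
    have "x $ i \<le> 1" for i using *(2)[of i] c by (cases "i = j") auto
    thus "x \<in> cbox 0 1 \<and> x \<bullet> axis j 1 \<le> c" using * *(2)[of j] by (simp add: mem_box_cart inner_axis)
  next
    assume "x \<in> cbox 0 1 \<and> x \<bullet> axis j 1 \<le> c"
    thus "x \<in> cbox 0 (1 + (c - 1) *\<^sub>R axis j 1)" by (simp add: mem_box_cart inner_axis) (simp add: axis_def)
  qed
  hence "cbox 0 1 \<inter> {x :: real ^ 'n. x \<bullet> axis j 1 \<le> c} = cbox 0 (1 + (c - 1) *\<^sub>R axis j 1)" by blast
  moreover have "x \<in> cbox 0 1 \<and> x \<bullet> axis j 1 \<ge> c \<longleftrightarrow> x \<in> cbox (c *\<^sub>R axis j 1) 1" for x :: "real ^ 'n"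
  proof
    assume "x \<in> cbox (c *\<^sub>R axis j 1) 1"
    hence *: "x $ i \<le> 1" "c * (if i = j then 1 else 0) \<le> x $ i" for i
      by (simp_all add: mem_box_cart axis_def)
    have "0 \<le> x $ i" for i using *(2)[of i] c by (cases "i = j") auto
    thus "x \<in> cbox 0 1 \<and> x \<bullet> axis j 1 \<ge> c" using * *(2)[of j] by (simp add: mem_box_cart inner_axis)
  next
    assume "x \<in> cbox 0 1 \<and> x \<bullet> axis j 1 \<ge> c"
    thus "x \<in> cbox (c *\<^sub>R axis j 1) 1" by (simp add: mem_box_cart inner_axis) (simp add: axis_def)
  qed
  hence "cbox 0 1 \<inter> {x :: real ^ 'n. x \<bullet> axis j 1 \<ge> c} = cbox (c *\<^sub>R axis j 1) 1" by blast
  moreover have "axis j 1 \<in> (Basis :: (real ^ 'n) set)" by (simp add: axis_in_Basis_iff)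
  ultimately show ?thesis using integral_split[OF f, of "axis j 1" c] by simp
qed

text \<open>The hyperplane \<open>x $ j = 1 - h\<close> cuts the cube into two slabs.  One is moved inside the cube, the other
  is moved back by a period, and together they fill the cube again.\<close>

lemma cube_integral_translate:
  fixes f :: "real ^ 'n::finite \<Rightarrow> complex"
  assumes f: "torus_continuous f" and h: "0 \<le> h" "h \<le> 1"
  shows "integral (cbox 0 1) (\<lambda>x. f (x + h *\<^sub>R axis j 1)) = integral (cbox 0 1) f"
proof -
  let ?e = "axis j 1 :: real ^ 'n"
  let ?G = "\<lambda>x. f (x + h *\<^sub>R ?e)"
  have cont: "continuous_on UNIV f" and per: "f (x + ?e) = f x" for x using f by (auto simp: torus_continuous_def)
  have "?G integrable_on cbox 0 1"
    by (intro integrable_continuous continuous_on_compose2[OF cont] continuous_intros) auto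
  hence "integral (cbox 0 1) ?G =
      integral (cbox 0 (1 + ((1 - h) - 1) *\<^sub>R ?e)) ?G + integral (cbox ((1 - h) *\<^sub>R ?e) 1) ?G"
    by (rule cube_integral_split) (use h in auto)
  also have "integral (cbox 0 (1 + ((1 - h) - 1) *\<^sub>R ?e)) ?G = integral (cbox (h *\<^sub>R ?e) 1) f"
    using integral_shift_cbox[of "h *\<^sub>R ?e" "h *\<^sub>R ?e" 1 f] by simp
  also have "integral (cbox ((1 - h) *\<^sub>R ?e) 1) ?G = integral (cbox 0 (1 + (h - 1) *\<^sub>R ?e)) f"
  proof -
    have "?G = (\<lambda>x. f (x + (h - 1) *\<^sub>R ?e))"
    proof
      fix x show "?G x = f (x + (h - 1) *\<^sub>R ?e)"
        using per[of "x + (h - 1) *\<^sub>R ?e"] by (simp add: algebra_simps)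
    qed
    thus ?thesis
      using integral_shift_cbox[of 0 "(h - 1) *\<^sub>R ?e" "1 + (h - 1) *\<^sub>R ?e" f]
      by (simp add: algebra_simps)
  qed
  also have "integral (cbox (h *\<^sub>R ?e) 1) f + integral (cbox 0 (1 + (h - 1) *\<^sub>R ?e)) f = integral (cbox 0 1) f"
    using cube_integral_split[OF torus_continuous_integrable[OF f] h, of j] by simp
  finally show ?thesis .
qed

lemma torus_continuous_shift:
  assumes "torus_continuous f" shows "torus_continuous (\<lambda>x. f (x + y))"
proof -
  have "continuous_on UNIV (\<lambda>x. f (x + y))"
    by (rule continuous_on_compose2[OF torus_continuous_continuous[OF assms, of UNIV]]) (auto intro: continuous_intros)
  moreover have "f (x + axis j 1 + y) = f (x + y)" for j x
  proof -
    have "f (x + axis j 1 + y) = f ((x + y) + axis j 1)" by (simp add: add_ac)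
    thus ?thesis using assms by (simp add: torus_continuous_def)
  qed
  ultimately show ?thesis by (simp add: torus_continuous_def)
qed

lemma fourier_coef_shift:
  fixes f :: "real ^ 'n::finite \<Rightarrow> complex"
  assumes f: "torus_continuous f" and h: "0 \<le> h" "h \<le> 1"
  shows "exp (2 * pi * \<i> * of_real (h * real_of_int (p $ j))) * fourier_coef (\<lambda>x. f (x + h *\<^sub>R axis j 1)) p = fourier_coef f p"
proof -
  have "fourier_coef f p = integral (cbox 0 1) (\<lambda>x. echar p (x + h *\<^sub>R axis j 1) * f (x + h *\<^sub>R axis j 1))"
    unfolding fourier_coef_def using cube_integral_translate[OF torus_continuous_mult[OF torus_continuous_echar f] h, of p j] by simp
  also have "\<dots> = integral (cbox 0 1) (\<lambda>x. echar p (h *\<^sub>R axis j 1) * (echar p x * f (x + h *\<^sub>R axis j 1)))"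
    by (simp add: echar_shift mult_ac)
  also have "\<dots> = echar p (h *\<^sub>R axis j 1) * fourier_coef (\<lambda>x. f (x + h *\<^sub>R axis j 1)) p"
    unfolding fourier_coef_def by (rule integral_mult_right)
  finally show ?thesis by (simp add: echar_axis)
qed

text \<open>A shift by half a wave length changes the sign of the character.  A Fourier coefficient is therefore
  minus one half of the coefficient of a difference, which is how smoothness leads to decay without
  integration by parts.\<close>

lemma fourier_coef_half_shift:
  fixes f :: "real ^ 'n::finite \<Rightarrow> complex"
  assumes f: "torus_continuous f" and p: "p $ j \<noteq> 0"
  defines "h \<equiv> 1 / (2 * \<bar>real_of_int (p $ j)\<bar>)"
  shows "fourier_coef (\<lambda>x. f (x + h *\<^sub>R axis j 1)) p = - fourier_coef f p"
proof -
  have p1: "1 \<le> \<bar>real_of_int (p $ j)\<bar>" using p by linarith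
  hence h: "0 \<le> h" "h \<le> 1" by (auto simp: h_def field_simps)
  have "h * real_of_int (p $ j) = 1 / 2 \<or> h * real_of_int (p $ j) = - (1 / 2)"
    using p1 by (cases "p $ j > 0") (auto simp: h_def)
  hence "exp (2 * pi * \<i> * of_real (h * real_of_int (p $ j))) = -1"
  proof
    assume *: "h * real_of_int (p $ j) = 1 / 2"
    show ?thesis unfolding * by simp
  next
    assume *: "h * real_of_int (p $ j) = - (1 / 2)"
    show ?thesis unfolding * by (simp add: exp_minus)
  qed
  with fourier_coef_shift[OF f h, of p j] have "(- 1) * fourier_coef (\<lambda>x. f (x + h *\<^sub>R axis j 1)) p = fourier_coef f p"
    by metis
  thus ?thesis by (simp add: minus_equation_iff eq_commute)
qed

lemma fourier_coef_diff:
  assumes "torus_continuous f" "torus_continuous g"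
  shows "fourier_coef (\<lambda>x. f x - g x) p = fourier_coef f p - fourier_coef g p"
  unfolding fourier_coef_def by (simp add: right_diff_distrib integral_diff torus_continuous_coef_integrable assms)

lemma fourier_coef_cmult: "fourier_coef (\<lambda>x. c * f x) p = c * fourier_coef f p"
  unfolding fourier_coef_def by (simp add: mult.left_commute)

lemma content_unit_cube [simp]: "measure lborel (cbox 0 (1 :: real ^ 'n::finite)) = 1"
proof -
  have "0 \<in> cbox 0 (1 :: real ^ 'n)" by (simp add: mem_box_cart)
  hence "cbox 0 (1 :: real ^ 'n) \<noteq> {}" by blast
  thus ?thesis by (simp add: content_cbox_if_cart)
qed

lemma unit_cube_integral_bound:
  fixes f :: "real ^ 'n::finite \<Rightarrow> complex"
  assumes "f integrable_on cbox 0 1" "\<And>x. cmod (f x) \<le> C"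
  shows "cmod (integral (cbox 0 1) f) \<le> C"
  using has_integral_bound[OF _ integrable_integral[OF assms(1)], of C] assms(2) order_trans[OF norm_ge_zero assms(2)[of 0]]
  by simp

lemma fourier_coef_bound:
  assumes "torus_continuous f" "\<And>x. cmod (f x) \<le> C"
  shows "cmod (fourier_coef f p) \<le> C"
  unfolding fourier_coef_def
  by (rule unit_cube_integral_bound) (auto simp: norm_mult assms torus_continuous_coef_integrable)

lemma fourier_coef_one: "fourier_coef (\<lambda>x. 1) p = (if p = 0 then 1 else 0)"
proof (cases "p = 0")
  case False
  then obtain j where "p $ j \<noteq> 0" by (auto simp: vec_eq_iff)
  from fourier_coef_half_shift[OF torus_continuous_const[of 1] this] show ?thesis using False by (simp add: eq_neg_iff_add_eq_0)
qed (simp add: fourier_coef_def)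

lemma fourier_coef_echar: "fourier_coef (echar q) p = (if p = - q then 1 else 0)"
proof -
  have "fourier_coef (echar q) p = fourier_coef (\<lambda>x. 1) (p + q)" by (simp add: fourier_coef_def echar_add)
  thus ?thesis by (simp add: fourier_coef_one eq_neg_iff_add_eq_0)
qed

section \<open>Smooth functions and the decay of their Fourier coefficients\<close>

text \<open>One constant bounds all derivatives up to order \<open>N\<close>.  It is explicit so that estimates are
  uniform over families of functions, and the derivatives are not named so that closure properties
  follow by induction.\<close>

primrec bdd_derivs :: "nat \<Rightarrow> real \<Rightarrow> (real \<Rightarrow> complex) \<Rightarrow> bool" where
  "bdd_derivs 0 C f \<longleftrightarrow> (\<forall>t. cmod (f t) \<le> C)"
| "bdd_derivs (Suc N) C f \<longleftrightarrow> (\<forall>t. cmod (f t) \<le> C) \<and>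
     (\<exists>f'. (\<forall>t. (f has_vector_derivative f' t) (at t)) \<and> bdd_derivs N C f')"

lemma bdd_derivs_SucI:
  "(\<And>t. cmod (f t) \<le> C) \<Longrightarrow> (\<And>t. (f has_vector_derivative f' t) (at t)) \<Longrightarrow> bdd_derivs N C f' \<Longrightarrow>
    bdd_derivs (Suc N) C f"
  by auto

lemma bdd_derivs_bound: "bdd_derivs N C f \<Longrightarrow> cmod (f t) \<le> C"
  by (cases N) auto

lemma bdd_derivs_nonneg: "bdd_derivs N C f \<Longrightarrow> 0 \<le> C"
  using bdd_derivs_bound[of N C f 0] norm_ge_zero order_trans by blast

lemma bdd_derivs_mono: "bdd_derivs N C f \<Longrightarrow> C \<le> D \<Longrightarrow> bdd_derivs N D f"
  by (induction N arbitrary: f) (auto intro: order_trans)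

lemma bdd_derivs_Suc: "bdd_derivs (Suc N) C f \<Longrightarrow> bdd_derivs N C f"
  by (induction N arbitrary: f) auto

lemma bdd_derivs_add:
  "bdd_derivs N C f \<Longrightarrow> bdd_derivs N D g \<Longrightarrow> bdd_derivs N (C + D) (\<lambda>t. f t + g t)"
proof (induction N arbitrary: f g)
  case (Suc N)
  obtain f' where f': "\<And>t. (f has_vector_derivative f' t) (at t)" "bdd_derivs N C f'" using Suc.prems(1) by auto
  obtain g' where g': "\<And>t. (g has_vector_derivative g' t) (at t)" "bdd_derivs N D g'" using Suc.prems(2) by auto
  have "cmod (f t + g t) \<le> C + D" for t
    using Suc.prems norm_triangle_mono by (meson bdd_derivs_bound)
  moreover have "((\<lambda>t. f t + g t) has_vector_derivative f' t + g' t) (at t)" for t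
    by (intro derivative_intros f' g')
  ultimately show ?case using Suc.IH[OF f'(2) g'(2)] by (rule bdd_derivs_SucI)
qed (auto intro: norm_triangle_mono)

lemma bdd_derivs_cmult: "bdd_derivs N C f \<Longrightarrow> bdd_derivs N (cmod c * C) (\<lambda>t. c * f t)"
proof (induction N arbitrary: f)
  case (Suc N)
  obtain f' where f': "\<And>t. (f has_vector_derivative f' t) (at t)" "bdd_derivs N C f'" using Suc.prems by auto
  have "((\<lambda>t. c * f t) has_vector_derivative c * f' t) (at t)" for t
    by (intro derivative_intros f')
  moreover have "cmod (c * f t) \<le> cmod c * C" for t
    using Suc.prems by (simp add: norm_mult mult_left_mono)
  ultimately show ?case using Suc.IH[OF f'(2)] by (intro bdd_derivs_SucI)
qed (simp add: norm_mult mult_left_mono)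

lemma bdd_derivs_cnj: "bdd_derivs N C f \<Longrightarrow> bdd_derivs N C (\<lambda>t. cnj (f t))"
proof (induction N arbitrary: f)
  case (Suc N)
  obtain f' where f': "\<And>t. (f has_vector_derivative f' t) (at t)" "bdd_derivs N C f'" using Suc.prems by auto
  have "((\<lambda>t. cnj (f t)) has_vector_derivative cnj (f' t)) (at t)" for t
    by (intro has_vector_derivative_cnj f')
  thus ?case using Suc.IH[OF f'(2)] Suc.prems by (intro bdd_derivs_SucI) auto
qed simp

lemma bdd_derivs_mult:
  "bdd_derivs N C f \<Longrightarrow> bdd_derivs N D g \<Longrightarrow> bdd_derivs N (2 ^ N * C * D) (\<lambda>t. f t * g t)"
proof (induction N arbitrary: f g)
  case 0
  thus ?case by (auto simp: norm_mult intro!: mult_mono order_trans[OF norm_ge_zero])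
next
  case (Suc N)
  obtain f' where f': "\<And>t. (f has_vector_derivative f' t) (at t)" "bdd_derivs N C f'" using Suc.prems(1) by auto
  obtain g' where g': "\<And>t. (g has_vector_derivative g' t) (at t)" "bdd_derivs N D g'" using Suc.prems(2) by auto
  have CD: "0 \<le> C" "0 \<le> D" using Suc.prems bdd_derivs_nonneg by blast+
  have "cmod (f t * g t) \<le> 2 ^ Suc N * C * D" for t
  proof -
    have "cmod (f t * g t) \<le> C * D"
      using bdd_derivs_bound[OF Suc.prems(1)] bdd_derivs_bound[OF Suc.prems(2)] CD
      by (simp add: norm_mult mult_mono)
    also have "\<dots> \<le> 2 ^ Suc N * (C * D)"
      using mult_right_mono[OF one_le_power[of "2 :: real" "Suc N"], of "C * D"] CD by simp
    finally show ?thesis by (simp add: mult.assoc)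
  qed
  moreover have "((\<lambda>t. f t * g t) has_vector_derivative f t * g' t + f' t * g t) (at t)" for t
    by (intro derivative_intros f' g')
  moreover have "bdd_derivs N (2 ^ Suc N * C * D) (\<lambda>t. f t * g' t + f' t * g t)"
  proof -
    have eq: "2 ^ Suc N * C * D = 2 ^ N * C * D + 2 ^ N * C * D" by simp
    show ?thesis unfolding eq
      by (rule bdd_derivs_add[OF Suc.IH[OF bdd_derivs_Suc[OF Suc.prems(1)] g'(2)] Suc.IH[OF f'(2) bdd_derivs_Suc[OF Suc.prems(2)]]])
  qed
  ultimately show ?case by (rule bdd_derivs_SucI[where f' = "\<lambda>t. f t * g' t + f' t * g t"])
qed

lemma norm_inverse_le: "0 < c \<Longrightarrow> c \<le> cmod z \<Longrightarrow> cmod (inverse z) \<le> 1 / c"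
  using le_imp_inverse_le[of c "cmod z"] by (simp add: norm_inverse inverse_eq_divide[of c])

text \<open>The derivative of \<open>1 / f\<close> is \<open>- f' * (1 / f)\<^sup>2\<close>, so bounds on the first \<open>N\<close> derivatives of \<open>1 / f\<close>
  give bounds on one more.  The constant depends on \<open>f\<close> only through \<open>C\<close> and the lower bound \<open>c\<close>.\<close>

lemma bdd_derivs_inverse:
  assumes "0 < c"
  shows "\<exists>E. \<forall>f. bdd_derivs N C f \<longrightarrow> (\<forall>t. c \<le> cmod (f t)) \<longrightarrow> bdd_derivs N E (\<lambda>t. inverse (f t))"
proof (induction N)
  case 0
  have "cmod (inverse (f t)) \<le> 1 / c" if "\<forall>t. c \<le> cmod (f t)" for f :: "real \<Rightarrow> complex" and t
    using assms that by (auto intro: norm_inverse_le)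
  thus ?case by (intro exI[of _ "1 / c"]) simp
next
  case (Suc N)
  then obtain E where E: "\<And>f. bdd_derivs N C f \<Longrightarrow> (\<forall>t. c \<le> cmod (f t)) \<Longrightarrow> bdd_derivs N E (\<lambda>t. inverse (f t))"
    by blast
  let ?D = "2 ^ N * C * (2 ^ N * E * E)"
  have "bdd_derivs (Suc N) (1 / c + \<bar>?D\<bar>) (\<lambda>t. inverse (f t))"
    if f: "bdd_derivs (Suc N) C f" and fc: "\<forall>t. c \<le> cmod (f t)" for f
  proof -
    obtain f' where f': "\<And>t. (f has_vector_derivative f' t) (at t)" "bdd_derivs N C f'" using f by auto
    have inv: "bdd_derivs N E (\<lambda>t. inverse (f t))" by (rule E[OF bdd_derivs_Suc[OF f] fc])
    have nz: "f t \<noteq> 0" for t using fc[rule_format, of t] assms by auto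
    have "((\<lambda>t. inverse (f t)) has_vector_derivative (- 1) * (f' t * (inverse (f t) * inverse (f t)))) (at t)" for t
      using field_vector_diff_chain_at[OF f'(1) DERIV_inverse[OF nz]] by (simp add: o_def power2_eq_square numeral_2_eq_2)
    moreover have "bdd_derivs N (1 / c + \<bar>?D\<bar>) (\<lambda>t. (- 1) * (f' t * (inverse (f t) * inverse (f t))))"
      by (rule bdd_derivs_mono[OF bdd_derivs_cmult[OF bdd_derivs_mult[OF f'(2) bdd_derivs_mult[OF inv inv]]]])
         (use assms in \<open>simp add: add_increasing\<close>)
    moreover have "cmod (inverse (f t)) \<le> 1 / c + \<bar>?D\<bar>" for t
    proof -
      have "cmod (inverse (f t)) \<le> 1 / c"
        using assms fc by (auto intro: norm_inverse_le)
      thus ?thesis by linarith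
    qed
    ultimately show ?thesis by (intro bdd_derivs_SucI)
  qed
  thus ?case by blast
qed

text \<open>The mean value inequality, which costs one derivative and is uniform in \<open>h\<close>.\<close>

lemma bdd_derivs_difference_quotient:
  "bdd_derivs (Suc N) C f \<Longrightarrow> 0 < h \<Longrightarrow> bdd_derivs N C (\<lambda>t. (f (t + h) - f t) / of_real h)"
proof (induction N arbitrary: f)
  case base: 0
  have "cmod (f (t + h) - f t) \<le> C * norm (t + h - t)" for t
  proof -
    obtain f' where f': "\<And>t. (f has_vector_derivative f' t) (at t)" "\<And>t. cmod (f' t) \<le> C" using base.prems(1) by auto
    show ?thesis
    proof (rule differentiable_bound[of UNIV])
      show "(f has_derivative (\<lambda>s. s *\<^sub>R f' t)) (at t within UNIV)" for t
        using f'(1)[of t] by (simp add: has_vector_derivative_def)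
      show "onorm (\<lambda>s. s *\<^sub>R f' t) \<le> C" for t
        using f'(2)[of t] by (intro onorm_le) (simp add: mult.commute[of C] mult_left_mono)
    qed auto
  qed
  thus ?case using base.prems(2) by (simp add: norm_divide divide_le_eq)
next
  case (Suc N)
  obtain f' where f': "\<And>t. (f has_vector_derivative f' t) (at t)" "bdd_derivs (Suc N) C f'" using Suc.prems by auto
  have "((\<lambda>t. (f (t + h) - f t) / of_real h) has_vector_derivative (f' (t + h) - f' t) / of_real h) (at t)" for t
  proof -
    have "((\<lambda>t. t + h) has_vector_derivative 1) (at t)" by (auto intro!: derivative_eq_intros)
    from vector_diff_chain_at[OF this f'(1)] have "((\<lambda>t. f (t + h)) has_vector_derivative f' (t + h)) (at t)"
      by (simp add: o_def)
    thus ?thesis by (intro derivative_intros f'(1))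
  qed
  moreover have "cmod ((f (t + h) - f t) / of_real h) \<le> C" for t
    by (rule bdd_derivs_bound[OF Suc.IH[OF bdd_derivs_Suc[OF Suc.prems(1)] Suc.prems(2)]])
  ultimately show ?case using Suc.IH[OF f'(2) Suc.prems(2)] by (intro bdd_derivs_SucI)
qed

text \<open>Each step replaces \<open>f\<close> by its difference quotient along half a wave length.  This costs one
  derivative and multiplies the coefficient by \<open>- 4 * \<bar>p $ j\<bar>\<close>.\<close>

lemma fourier_coef_decay_coordinate:
  fixes f :: "real ^ 'n::finite \<Rightarrow> complex"
  assumes "torus_continuous f" "\<And>x. bdd_derivs N C (\<lambda>t. f (x + t *\<^sub>R axis j 1))"
  shows "\<bar>real_of_int (p $ j)\<bar> ^ N * cmod (fourier_coef f p) \<le> C"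
  using assms
proof (induction N arbitrary: f)
  case 0
  have "cmod (f x) \<le> C" for x using 0(2)[of x, THEN bdd_derivs_bound, of 0] by simp
  thus ?case using fourier_coef_bound[OF 0(1)] by simp
next
  case (Suc N)
  have C: "0 \<le> C" using Suc.prems(2) bdd_derivs_nonneg by blast
  show ?case
  proof (cases "p $ j = 0")
    case False
    let ?P = "\<bar>real_of_int (p $ j)\<bar>"
    define h where "h = 1 / (2 * ?P)"
    have h: "0 < h" using False by (simp add: h_def)
    define D where "D = (\<lambda>x. (1 / of_real h) * (f (x + h *\<^sub>R axis j 1) - f x))"
    have shift: "torus_continuous (\<lambda>x. f (x + h *\<^sub>R axis j 1))" by (rule torus_continuous_shift[OF Suc.prems(1)])
    have "torus_continuous D" unfolding D_def
      by (intro torus_continuous_mult torus_continuous_const torus_continuous_diff shift Suc.prems(1))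
    moreover have "bdd_derivs N C (\<lambda>t. D (x + t *\<^sub>R axis j 1))" for x
      using bdd_derivs_difference_quotient[OF Suc.prems(2)[of x] h] by (simp add: D_def scaleR_add_left add.assoc)
    ultimately have "?P ^ N * cmod (fourier_coef D p) \<le> C" by (rule Suc.IH)
    moreover have "fourier_coef D p = - (4 * of_real ?P) * fourier_coef f p"
    proof -
      have "fourier_coef D p = (1 / of_real h) * (fourier_coef (\<lambda>x. f (x + h *\<^sub>R axis j 1)) p - fourier_coef f p)"
        unfolding D_def fourier_coef_cmult fourier_coef_diff[OF shift Suc.prems(1)] ..
      also have "\<dots> = (1 / of_real h) * (- 2 * fourier_coef f p)"
        unfolding h_def fourier_coef_half_shift[OF Suc.prems(1) False] by simp
      also have "\<dots> = - (4 * of_real ?P) * fourier_coef f p" by (simp add: h_def)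
      finally show ?thesis .
    qed
    ultimately have "4 * (?P ^ Suc N * cmod (fourier_coef f p)) \<le> C" by (simp add: norm_mult mult_ac)
    moreover have "0 \<le> ?P ^ Suc N * cmod (fourier_coef f p)" by simp
    ultimately show ?thesis by linarith
  qed (use C in simp)
qed

lemma fourier_coef_decay:
  fixes f :: "real ^ 'n::finite \<Rightarrow> complex"
  assumes "torus_continuous f" "\<And>j x. bdd_derivs N C (\<lambda>t. f (x + t *\<^sub>R axis j 1))"
  shows "cmod (fourier_coef f p) \<le> (real CARD('n) + 1) ^ N * C / japanese p ^ N"
proof -
  have bound: "cmod (fourier_coef f p) \<le> C"
    by (rule fourier_coef_bound[OF assms(1)]) (use bdd_derivs_bound[OF assms(2), where t = 0] in simp)
  have "japanese p ^ N * cmod (fourier_coef f p) \<le> (real CARD('n) + 1) ^ N * C"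
    by (rule japanese_power_le_coordinates) (auto intro: bound fourier_coef_decay_coordinate[OF assms])
  thus ?thesis by (simp add: field_simps)
qed

section \<open>Fourier series\<close>

lemma integral_infsum_cube:
  fixes F :: "'i \<Rightarrow> real ^ 'n::finite \<Rightarrow> complex"
  assumes cont: "\<And>i. continuous_on (cbox 0 1) (F i)" and le: "\<And>i x. x \<in> cbox 0 1 \<Longrightarrow> cmod (F i x) \<le> M i"
    and M: "M summable_on UNIV"
  shows "((\<lambda>i. integral (cbox 0 1) (F i)) has_sum integral (cbox 0 1) (\<lambda>x. \<Sum>\<^sub>\<infinity>i. F i x)) UNIV"
proof -
  have u: "uniform_limit (cbox 0 1) (\<lambda>X x. \<Sum>i\<in>X. F i x) (\<lambda>x. \<Sum>\<^sub>\<infinity>i. F i x) (finite_subsets_at_top UNIV)"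
    by (rule Weierstrass_m_test_general[OF le M])
  have c: "continuous_on (cbox 0 1) (\<lambda>x. \<Sum>i\<in>X. F i x)" for X
    by (intro continuous_on_sum cont)
  obtain I J where IJ: "\<And>X. ((\<lambda>x. \<Sum>i\<in>X. F i x) has_integral I X) (cbox 0 1)"
    "((\<lambda>x. \<Sum>\<^sub>\<infinity>i. F i x) has_integral J) (cbox 0 1)" "(I \<longlongrightarrow> J) (finite_subsets_at_top UNIV)"
    using uniform_limit_integral_cbox[OF u c finite_subsets_at_top_neq_bot] by blast
  have I: "I X = (\<Sum>i\<in>X. integral (cbox 0 1) (F i))" if "finite X" for X
  proof -
    have "((\<lambda>x. \<Sum>i\<in>X. F i x) has_integral (\<Sum>i\<in>X. integral (cbox 0 1) (F i))) (cbox 0 1)"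
      by (intro has_integral_sum that integrable_integral integrable_continuous cont)
    with IJ(1)[of X] show ?thesis by (rule has_integral_unique)
  qed
  have "((\<lambda>X. \<Sum>i\<in>X. integral (cbox 0 1) (F i)) \<longlongrightarrow> J) (finite_subsets_at_top UNIV)"
    by (rule Lim_transform_eventually[OF IJ(3)])
       (auto intro!: eventually_finite_subsets_at_top_weakI I)
  thus ?thesis using IJ(2) by (simp add: has_sum_def integral_unique)
qed

lemma continuous_on_infsum:
  fixes F :: "'i \<Rightarrow> real ^ 'n::finite \<Rightarrow> complex"
  assumes cont: "\<And>i. continuous_on UNIV (F i)" and le: "\<And>i x. cmod (F i x) \<le> M i"
    and M: "M summable_on UNIV"
  shows "continuous_on UNIV (\<lambda>x. \<Sum>\<^sub>\<infinity>i. F i x)"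
proof (rule uniform_limit_theorem)
  show "uniform_limit UNIV (\<lambda>X x. \<Sum>i\<in>X. F i x) (\<lambda>x. \<Sum>\<^sub>\<infinity>i. F i x) (finite_subsets_at_top UNIV)"
    by (rule Weierstrass_m_test_general[OF le M])
qed (auto intro!: always_eventually continuous_on_sum cont)

lemma echar_cos:
  fixes x0 :: "real ^ 'n::finite"
  shows "complex_of_real (cos (2 * pi * (x $ j - x0 $ j))) =
    (cnj (echar (axis j 1) x0) / 2) * echar (axis j 1) x + (echar (axis j 1) x0 / 2) * echar (- axis j 1) x"
proof -
  have lv: "lattice_vec (axis j 1) \<bullet> y = y $ j" for y :: "real ^ 'n"
  proof -
    have "lattice_vec (axis j 1 :: int ^ 'n) = axis j 1" by (simp add: vec_eq_iff axis_def)
    thus ?thesis by (simp add: inner_commute[of "axis j 1"] inner_axis)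
  qed
  have e: "echar (axis j 1) y = cis (2 * pi * y $ j)" "echar (- axis j 1) y = cis (- (2 * pi * y $ j))" for y :: "real ^ 'n"
    by (simp_all add: echar_def lv cis_conv_exp mult_ac)
  show ?thesis
    unfolding e cis_cnj
    by (simp add: complex_eq_iff right_diff_distrib cos_diff mult.commute add_divide_distrib diff_divide_distrib)
qed

text \<open>Uniqueness of Fourier coefficients.  The trigonometric polynomial \<open>Q\<close> takes values between 0 and 1
  and equals 1 only at \<open>x0\<close>, so its powers concentrate there.  A function with vanishing coefficients
  is orthogonal to all of them, although the integral against a high power is dominated by the values
  near \<open>x0\<close> if the function does not vanish at \<open>x0\<close>.\<close>

lemma fourier_coef_eq_0_imp_interior:
  fixes f :: "real ^ 'n::finite \<Rightarrow> complex"
  assumes f: "torus_continuous f" and fourier_coef: "\<And>p. fourier_coef f p = 0" and x0: "x0 \<in> box 0 1"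
  shows "f x0 = 0"
proof (rule ccontr)
  assume nz: "f x0 \<noteq> 0"
  let ?n = "real CARD('n)"
  define Q where "Q = (\<lambda>x. ((\<Sum>j\<in>UNIV. cos (2 * pi * (x $ j - x0 $ j))) + ?n) / (2 * ?n))"
  \<comment> \<open>rotated so that its value at \<open>x0\<close> is positive\<close>
  define g where "g = (\<lambda>x. Re (cnj (f x0) * f x))"
  have cf: "continuous_on A f" for A by (rule torus_continuous_continuous[OF f])
  have cQ: "continuous_on A Q" for A unfolding Q_def by (intro continuous_intros) auto
  have cg: "continuous_on A g" for A unfolding g_def by (intro continuous_intros cf)
  have n0: "0 < ?n" by simp
  have sum_le: "(\<Sum>j\<in>UNIV. cos (2 * pi * (x $ j - x0 $ j))) \<le> ?n" for x
    using sum_mono[of UNIV "\<lambda>j. cos (2 * pi * (x $ j - x0 $ j))" "\<lambda>_. 1"] by simp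
  have sum_ge: "- ?n \<le> (\<Sum>j\<in>UNIV. cos (2 * pi * (x $ j - x0 $ j)))" for x
    using sum_mono[of UNIV "\<lambda>_. - 1" "\<lambda>j. cos (2 * pi * (x $ j - x0 $ j))"] by simp
  have Q01: "0 \<le> Q x" "Q x \<le> 1" for x
    using sum_le[of x] sum_ge[of x] n0 by (simp_all add: Q_def field_simps)
  have Qx0: "Q x0 = 1" by (simp add: Q_def)
  have Q_less: "Q x < 1" if x: "x \<in> cbox 0 1" "x \<noteq> x0" for x
  proof -
    obtain j where j: "x $ j \<noteq> x0 $ j" using x(2) by (auto simp: vec_eq_iff)
    have "\<bar>x $ j - x0 $ j\<bar> < 1"
      using x(1) x0 by (auto simp: mem_box_cart dest!: spec[of _ j])
    have "cos (2 * pi * (x $ j - x0 $ j)) \<noteq> 1"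
    proof
      assume "cos (2 * pi * (x $ j - x0 $ j)) = 1"
      then obtain n :: int where "2 * pi * (x $ j - x0 $ j) = of_int n * 2 * pi"
        unfolding cos_one_2pi_int by blast
      hence "x $ j - x0 $ j = of_int n" by simp
      thus False using j \<open>\<bar>x $ j - x0 $ j\<bar> < 1\<close> by (cases "n = 0") auto
    qed
    hence "cos (2 * pi * (x $ j - x0 $ j)) < 1" using cos_le_one[of "2 * pi * (x $ j - x0 $ j)"] by linarith
    hence "(\<Sum>j\<in>UNIV. cos (2 * pi * (x $ j - x0 $ j))) < (\<Sum>j\<in>(UNIV :: 'n set). 1)"
      by (intro sum_strict_mono_ex1) auto
    thus ?thesis using n0 by (simp add: Q_def field_simps)
  qed
  have zero: "integral (cbox 0 1) (\<lambda>x. echar p x * (f x * of_real (Q x) ^ N)) = 0" for N p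
  proof (induction N arbitrary: p)
    case 0
    thus ?case using fourier_coef[of p] by (simp add: fourier_coef_def)
  next
    case (Suc N)
    \<comment> \<open>a factor \<open>Q\<close> only shifts frequencies, since the cosines in it are combinations of characters\<close>
    let ?h = "\<lambda>p x. echar p x * (f x * of_real (Q x) ^ N)"
    have int: "?h p integrable_on cbox 0 1" for p
      by (intro integrable_continuous continuous_intros cf cQ)
    have "echar p x * (f x * of_real (Q x) ^ Suc N) = (1 / 2) * ?h p x +
        (\<Sum>j\<in>UNIV. (cnj (echar (axis j 1) x0) / (4 * ?n)) * ?h (p + axis j 1) x
          + (echar (axis j 1) x0 / (4 * ?n)) * ?h (p + - axis j 1) x)" for x
    proof -
      have "complex_of_real (Q x) = 1 / 2 + (\<Sum>j\<in>UNIV. complex_of_real (cos (2 * pi * (x $ j - x0 $ j)))) / (2 * ?n)"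
        using n0 by (simp add: Q_def field_simps)
      thus ?thesis
        unfolding echar_cos echar_add
        by (simp add: sum_distrib_left sum_distrib_right sum_divide_distrib algebra_simps add_divide_distrib)
    qed
    hence "integral (cbox 0 1) (\<lambda>x. echar p x * (f x * of_real (Q x) ^ Suc N)) =
       integral (cbox 0 1) (\<lambda>x. (1 / 2) * ?h p x +
        (\<Sum>j\<in>UNIV. (cnj (echar (axis j 1) x0) / (4 * ?n)) * ?h (p + axis j 1) x
          + (echar (axis j 1) x0 / (4 * ?n)) * ?h (p + - axis j 1) x))" by simp
    also have "\<dots> = (1 / 2) * 0 + (\<Sum>j\<in>(UNIV::'n set). (cnj (echar (axis j 1) x0) / (4 * ?n)) * 0 + (echar (axis j 1) x0 / (4 * ?n)) * 0)"
      by (intro integral_unique has_integral_add has_integral_sum has_integral_mult_right)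
         (use integrable_integral[OF int] Suc.IH in auto)
    finally show ?case by simp
  qed
  have zero': "integral (cbox 0 1) (\<lambda>x. g x * Q x ^ N) = 0" for N
  proof -
    have "((\<lambda>x. echar 0 x * (f x * of_real (Q x) ^ N)) has_integral 0) (cbox 0 1)"
      unfolding zero[of 0 N, symmetric]
      by (intro integrable_integral integrable_continuous continuous_intros cf cQ)
    from has_integral_Re[OF has_integral_mult_right[OF this, of "cnj (f x0)"]]
    have "((\<lambda>x. g x * Q x ^ N) has_integral 0) (cbox 0 1)"
      by (simp add: g_def mult.assoc[symmetric] flip: of_real_power)
    thus ?thesis by (rule integral_unique)
  qed
  have gx0: "0 < g x0"
  proof -
    have "cnj (f x0) * f x0 = of_real ((cmod (f x0))\<^sup>2)" by (simp only: complex_norm_square mult.commute)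
    hence "g x0 = (cmod (f x0))\<^sup>2" by (simp only: g_def Re_complex_of_real)
    thus ?thesis using nz by simp
  qed
  define \<eta> where "\<eta> = g x0 / 2"
  have \<eta>: "0 < \<eta>" "\<eta> < g x0" using gx0 by (auto simp: \<eta>_def)
  have "open ({x. \<eta> < g x} \<inter> box 0 1)"
    by (intro open_Int open_Collect_less cg continuous_on_const open_box)
  moreover have "x0 \<in> {x. \<eta> < g x} \<inter> box 0 1" using \<eta> x0 by simp
  ultimately obtain \<delta> where \<delta>: "0 < \<delta>" "ball x0 \<delta> \<subseteq> {x. \<eta> < g x} \<inter> box 0 1"
    unfolding open_contains_ball by blast
  define Kc where "Kc = cbox 0 1 - ball x0 \<delta>"
  have "compact Kc" unfolding Kc_def by (intro compact_diff) auto
  obtain \<rho> where \<rho>: "1 / 2 \<le> \<rho>" "\<rho> < 1" "\<And>x. x \<in> Kc \<Longrightarrow> Q x \<le> \<rho>"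
  proof (cases "Kc = {}")
    case False
    obtain y where y: "y \<in> Kc" "\<And>x. x \<in> Kc \<Longrightarrow> Q x \<le> Q y"
      using continuous_attains_sup[OF \<open>compact Kc\<close> False cQ] by blast
    have "Q y < 1" using y(1) \<delta>(1) by (intro Q_less) (auto simp: Kc_def)
    thus thesis using y(2) by (intro that[of "max (1 / 2) (Q y)"]) (auto simp: le_max_iff_disj)
  qed (auto intro: that[of "1 / 2"])
  \<comment> \<open>\<open>Q\<close> is at most \<open>\<rho>\<close> away from \<open>x0\<close> and at least \<open>\<rho>'\<close> on a box around \<open>x0\<close>\<close>
  define \<rho>' where "\<rho>' = (1 + \<rho>) / 2"
  have \<rho>': "\<rho> < \<rho>'" "\<rho>' < 1" "0 < \<rho>" using \<rho> by (auto simp: \<rho>'_def)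
  have "open ({x. \<rho>' < Q x} \<inter> ball x0 \<delta>)"
    by (intro open_Int open_Collect_less cQ continuous_on_const open_ball)
  moreover have "x0 \<in> {x. \<rho>' < Q x} \<inter> ball x0 \<delta>" using Qx0 \<rho>' \<delta> by simp
  ultimately obtain c d where cd: "cbox c d \<subseteq> {x. \<rho>' < Q x} \<inter> ball x0 \<delta>" "x0 \<in> box c d"
    by (rule open_contains_cbox)
  have V: "0 < measure lborel (cbox c d)"
    using cd(2) by (intro content_pos_lt) (auto simp: mem_box intro: less_trans)
  have sub: "cbox c d \<subseteq> cbox 0 1" using cd(1) \<delta>(2) box_subset_cbox[of 0 "1 :: real ^ 'n"] by blast
  obtain M where M: "0 < M" "\<And>x. x \<in> cbox 0 1 \<Longrightarrow> \<bar>g x\<bar> \<le> M"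
  proof -
    have "bounded (g ` cbox 0 1)" by (intro compact_imp_bounded compact_continuous_image cg compact_cbox)
    thus thesis using that unfolding bounded_pos by auto
  qed
  \<comment> \<open>the contribution of the box against that of the points far from \<open>x0\<close>; in between \<open>g\<close> is positive\<close>
  have main: "\<eta> * measure lborel (cbox c d) * \<rho>' ^ N \<le> M * \<rho> ^ N" for N
  proof -
    have ind: "((\<lambda>x. if x \<in> cbox c d then \<eta> * \<rho>' ^ N else 0) has_integral (\<eta> * \<rho>' ^ N) * measure lborel (cbox c d)) (cbox 0 1)"
      using has_integral_restrict[OF sub, of "\<lambda>_. \<eta> * \<rho>' ^ N"] has_integral_const[of "\<eta> * \<rho>' ^ N" c d]
      by (simp add: mult.commute)
    have con: "((\<lambda>x. M * \<rho> ^ N) has_integral M * \<rho> ^ N) (cbox 0 (1 :: real ^ 'n))"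
      using has_integral_const[of "M * \<rho> ^ N" 0 "1 :: real ^ 'n"] by simp
    have gQ: "((\<lambda>x. g x * Q x ^ N) has_integral 0) (cbox 0 1)"
      unfolding zero'[of N, symmetric] by (intro integrable_integral integrable_continuous continuous_intros cg cQ)
    have "(\<eta> * \<rho>' ^ N) * measure lborel (cbox c d) - M * \<rho> ^ N \<le> 0"
    proof (rule has_integral_le[OF has_integral_diff[OF ind con] gQ])
      fix x :: "real ^ 'n" assume x: "x \<in> cbox 0 1"
      have Mr: "0 \<le> M * \<rho> ^ N" using M(1) \<rho>'(3) by simp
      show "(if x \<in> cbox c d then \<eta> * \<rho>' ^ N else 0) - M * \<rho> ^ N \<le> g x * Q x ^ N"
      proof (cases "x \<in> ball x0 \<delta>")
        case True
        hence gx: "\<eta> \<le> g x" using \<delta>(2) by auto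
        show ?thesis
        proof (cases "x \<in> cbox c d")
          case True
          hence "\<rho>' ^ N \<le> Q x ^ N" using cd(1) \<rho>' by (intro power_mono) auto
          hence "\<eta> * \<rho>' ^ N \<le> g x * Q x ^ N" using gx \<eta>(1) \<rho>' by (intro mult_mono) auto
          thus ?thesis using True Mr by simp
        next
          case False
          have "0 \<le> g x * Q x ^ N" using gx \<eta>(1) Q01(1)[of x] by simp
          thus ?thesis using False Mr by simp
        qed
      next
        case False
        hence xK: "x \<in> Kc" and "x \<notin> cbox c d" using x cd(1) by (auto simp: Kc_def)
        have "\<bar>g x * Q x ^ N\<bar> \<le> M * \<rho> ^ N"
          unfolding abs_mult using M(2)[OF x] \<rho>(3)[OF xK] Q01(1)[of x] M(1)
          by (intro mult_mono) (auto intro: power_mono)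
        thus ?thesis using \<open>x \<notin> cbox c d\<close> by auto
      qed
    qed
    thus ?thesis by (simp add: mult_ac)
  qed
  obtain N where "M / (\<eta> * measure lborel (cbox c d)) < (\<rho>' / \<rho>) ^ N"
    using real_arch_pow[of "\<rho>' / \<rho>"] \<rho>' by auto
  hence "M * \<rho> ^ N < \<eta> * measure lborel (cbox c d) * \<rho>' ^ N"
    using \<eta>(1) V \<rho>'(3) by (simp add: field_simps power_divide)
  with main[of N] show False by simp
qed

lemma fourier_coef_eq_0_imp_zero:
  fixes f :: "real ^ 'n::finite \<Rightarrow> complex"
  assumes f: "torus_continuous f" and fourier_coef: "\<And>p. fourier_coef f p = 0" and x: "x \<in> cbox 0 1"
  shows "f x = 0"
proof -
  have "box 0 (1 :: real ^ 'n) \<noteq> {}" by (auto simp: box_ne_empty Basis_vec_def inner_axis)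
  hence cl: "closure (box 0 (1 :: real ^ 'n)) = cbox 0 1" by (rule closure_box)
  show ?thesis
    by (rule continuous_constant_on_closure[of "box 0 1"])
       (use fourier_coef_eq_0_imp_interior[OF f fourier_coef] x torus_continuous_continuous[OF f] in \<open>auto simp: cl\<close>)
qed

text \<open>The series converges uniformly and has the same coefficients as the function, so uniqueness
  applies.\<close>

lemma fourier_inversion:
  fixes f :: "real ^ 'n::finite \<Rightarrow> complex"
  assumes f: "torus_continuous f" and le: "\<And>p. cmod (fourier_coef f p) \<le> C / japanese p ^ (2 * CARD('n))" and x: "x \<in> cbox 0 1"
  shows "(\<Sum>\<^sub>\<infinity>p. fourier_coef f p * echar (- p) x) = f x"
proof -
  let ?M = "\<lambda>p :: int ^ 'n. C * (1 / japanese p ^ (2 * CARD('n)))"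
  let ?F = "\<lambda>p x. fourier_coef f p * echar (- p) x"
  define g where "g = (\<lambda>x. \<Sum>\<^sub>\<infinity>p. ?F p x)"
  have M: "?M summable_on UNIV" by (intro summable_on_cmult_right summable_japanese)
  have "continuous_on UNIV g" unfolding g_def
    by (rule continuous_on_infsum[OF _ _ M]) (use le in \<open>auto intro!: continuous_intros simp: norm_mult\<close>)
  moreover have "g (x + axis j 1) = g x" for j x unfolding g_def by (simp add: echar_shift)
  ultimately have g: "torus_continuous g" by (simp add: torus_continuous_def)
  have "fourier_coef g q = fourier_coef f q" for q
  proof -
    have "((\<lambda>p. integral (cbox 0 1) (\<lambda>x. echar q x * ?F p x)) has_sum integral (cbox 0 1) (\<lambda>x. \<Sum>\<^sub>\<infinity>p. echar q x * ?F p x)) UNIV"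
      by (rule integral_infsum_cube[OF _ _ M]) (use le in \<open>auto intro!: continuous_intros simp: norm_mult\<close>)
    moreover have "integral (cbox 0 1) (\<lambda>x. \<Sum>\<^sub>\<infinity>p. echar q x * ?F p x) = fourier_coef g q"
      unfolding fourier_coef_def g_def by (simp add: infsum_cmult_right')
    moreover have "integral (cbox 0 1) (\<lambda>x. echar q x * ?F p x) = (if p = q then fourier_coef f q else 0)" for p
      using fourier_coef_cmult[of "fourier_coef f p" "echar (- p)" q] by (auto simp: fourier_coef_def[symmetric] fourier_coef_echar)
    ultimately have "((\<lambda>p. if p = q then fourier_coef f q else 0) has_sum fourier_coef g q) UNIV" by simp
    moreover have "((\<lambda>p. if p = q then fourier_coef f q else 0) has_sum fourier_coef f q) UNIV"
      using has_sum_finite_neutralI[of "{q}" UNIV "\<lambda>p. if p = q then fourier_coef f q else 0"] by simp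
    ultimately show ?thesis by (rule has_sum_unique)
  qed
  hence "fourier_coef (\<lambda>x. g x - f x) q = 0" for q by (simp add: fourier_coef_diff[OF g f])
  from fourier_coef_eq_0_imp_zero[OF torus_continuous_diff[OF g f] this x] show ?thesis by (simp add: g_def)
qed

text \<open>Insert the Fourier series of \<open>g\<close> and integrate term by term.\<close>

lemma fourier_coef_mult:
  fixes f g :: "real ^ 'n::finite \<Rightarrow> complex"
  assumes f: "torus_continuous f" and g: "torus_continuous g" and le: "\<And>p. cmod (fourier_coef g p) \<le> C / japanese p ^ (2 * CARD('n))"
  shows "fourier_coef (\<lambda>x. f x * g x) q = (\<Sum>\<^sub>\<infinity>p. fourier_coef f (q - p) * fourier_coef g p)"
proof -
  obtain B where B: "\<And>x. x \<in> cbox 0 1 \<Longrightarrow> cmod (f x) \<le> B"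
  proof -
    have "bounded (f ` cbox 0 1)" by (intro compact_imp_bounded compact_continuous_image torus_continuous_continuous f compact_cbox)
    thus thesis using that unfolding bounded_pos by auto
  qed
  let ?M = "\<lambda>p :: int ^ 'n. B * C * (1 / japanese p ^ (2 * CARD('n)))"
  let ?F = "\<lambda>p x. fourier_coef g p * (echar (q - p) x * f x)"
  have M: "?M summable_on UNIV" by (intro summable_on_cmult_right summable_japanese)
  have "cmod (?F p x) \<le> ?M p" if "x \<in> cbox 0 1" for p x
    using mult_mono[OF B[OF that] le[of p] order_trans[OF norm_ge_zero B[OF that]]] by (simp add: norm_mult mult_ac)
  hence "((\<lambda>p. integral (cbox 0 1) (?F p)) has_sum integral (cbox 0 1) (\<lambda>x. \<Sum>\<^sub>\<infinity>p. ?F p x)) UNIV"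
    by (intro integral_infsum_cube[OF _ _ M] continuous_intros torus_continuous_continuous[OF f]) auto
  moreover have "integral (cbox 0 1) (?F p) = fourier_coef f (q - p) * fourier_coef g p" for p
    by (simp add: fourier_coef_def[of f] mult.commute)
  moreover have "integral (cbox 0 1) (\<lambda>x. \<Sum>\<^sub>\<infinity>p. ?F p x) = fourier_coef (\<lambda>x. f x * g x) q"
    unfolding fourier_coef_def[of "\<lambda>x. f x * g x"]
  proof (rule integral_cong)
    fix x :: "real ^ 'n" assume x: "x \<in> cbox 0 1"
    have "(\<Sum>\<^sub>\<infinity>p. ?F p x) = (\<Sum>\<^sub>\<infinity>p. (echar q x * f x) * (fourier_coef g p * echar (- p) x))"
      using echar_add[of q "- _" x] by (simp add: mult_ac)
    also have "\<dots> = echar q x * f x * g x"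
      unfolding infsum_cmult_right' fourier_inversion[OF g le x] ..
    finally show "(\<Sum>\<^sub>\<infinity>p. ?F p x) = echar q x * (f x * g x)" by (simp add: mult.assoc)
  qed
  ultimately have "((\<lambda>p. fourier_coef f (q - p) * fourier_coef g p) has_sum fourier_coef (\<lambda>x. f x * g x) q) UNIV"
    by (simp only:)
  thus ?thesis by (rule infsumI[symmetric])
qed

section \<open>From symbols to matrices\<close>

text \<open>Pure derivatives along single coordinates are enough here: the largest coordinate of a
  frequency is comparable to its bracket.\<close>

definition torus_symbol :: "(int ^ 'n::finite \<Rightarrow> real) \<Rightarrow> (int ^ 'n \<Rightarrow> real ^ 'n \<Rightarrow> complex) \<Rightarrow> bool" where
  "torus_symbol q a \<longleftrightarrow> (\<forall>k. torus_continuous (a k)) \<and>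
     (\<forall>N. \<exists>C. \<forall>k x j. bdd_derivs N (C * q k) (\<lambda>t. a k (x + t *\<^sub>R axis j 1)))"

text \<open>First differences in \<open>k\<close> gain one order.  This is the part of the symbol estimates for differences
  that makes the remainders of order \<open>-1\<close>.\<close>

definition slow_torus_symbol :: "(int ^ 'n::finite \<Rightarrow> real) \<Rightarrow> (int ^ 'n \<Rightarrow> real ^ 'n \<Rightarrow> complex) \<Rightarrow> bool" where
  "slow_torus_symbol q a \<longleftrightarrow> torus_symbol q a \<and>
     (\<forall>i. torus_symbol (\<lambda>k. q k * inv_japanese k) (\<lambda>k x. a (k + axis i 1) x - a k x))"

text \<open>The matrix of the pseudo-differential operator with symbol \<open>a\<close>.\<close>

definition left_matrix :: "(int ^ 'n::finite \<Rightarrow> real ^ 'n \<Rightarrow> complex) \<Rightarrow> int ^ 'n \<Rightarrow> int ^ 'n \<Rightarrow> complex" where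
  "left_matrix a k l = fourier_coef (a k) (k - l)"

text \<open>The symbol is taken at the column index.  The adjoints of the matrices \<open>left_matrix a\<close> have this
  form, see \<open>adj_left_matrix\<close>.\<close>

definition right_matrix :: "(int ^ 'n::finite \<Rightarrow> real ^ 'n \<Rightarrow> complex) \<Rightarrow> int ^ 'n \<Rightarrow> int ^ 'n \<Rightarrow> complex" where
  "right_matrix a k l = fourier_coef (a l) (k - l)"

lemma fourier_coef_cnj: "fourier_coef (\<lambda>x. cnj (f x)) p = cnj (fourier_coef f (- p))"
proof -
  have "cnj (echar (- p) x) = echar p x" for x
    by (simp add: echar_def exp_cnj)
  hence "fourier_coef (\<lambda>x. cnj (f x)) p = integral (cbox 0 1) (\<lambda>x. cnj (echar (- p) x * f x))"
    by (simp add: fourier_coef_def)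
  thus ?thesis by (simp only: integral_cnj fourier_coef_def)
qed

lemma adj_left_matrix: "adj (left_matrix a) = right_matrix (\<lambda>k x. cnj (a k x))"
  by (simp add: fun_eq_iff adj_def left_matrix_def right_matrix_def fourier_coef_cnj)

lemma torus_symbol_cnj: "torus_symbol q a \<Longrightarrow> torus_symbol q (\<lambda>k x. cnj (a k x))"
proof -
  assume a: "torus_symbol q a"
  have "\<exists>C. \<forall>k x j. bdd_derivs N (C * q k) (\<lambda>t. cnj (a k (x + t *\<^sub>R axis j 1)))" for N
  proof -
    obtain C where "\<And>k x j. bdd_derivs N (C * q k) (\<lambda>t. a k (x + t *\<^sub>R axis j 1))"
      using a unfolding torus_symbol_def by blast
    thus ?thesis using bdd_derivs_cnj by blast
  qed
  thus ?thesis using a unfolding torus_symbol_def torus_continuous_def by (auto intro!: continuous_intros)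
qed

lemma slow_torus_symbol_cnj: "slow_torus_symbol q a \<Longrightarrow> slow_torus_symbol q (\<lambda>k x. cnj (a k x))"
  unfolding slow_torus_symbol_def complex_cnj_diff[symmetric] using torus_symbol_cnj by blast

lemma torus_symbol_coef:
  fixes a :: "int ^ 'n::finite \<Rightarrow> real ^ 'n \<Rightarrow> complex"
  assumes "torus_symbol q a" "moderate q"
  obtains C where "0 \<le> C" "\<And>k p. cmod (fourier_coef (a k) p) \<le> C * q k / japanese p ^ N"
proof -
  from assms(1) obtain C where C: "\<And>k x j. bdd_derivs N (C * q k) (\<lambda>t. a k (x + t *\<^sub>R axis j 1))" and cp: "\<And>k. torus_continuous (a k)"
    unfolding torus_symbol_def by blast
  have "0 \<le> C * q 0" using bdd_derivs_nonneg[OF C] .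
  hence "0 \<le> C" using moderate_pos[OF assms(2), of 0] by (simp add: zero_le_mult_iff)
  moreover have "cmod (fourier_coef (a k) p) \<le> ((real CARD('n) + 1) ^ N * C) * q k / japanese p ^ N" for k p
    using fourier_coef_decay[OF cp C, of k p] by (simp add: mult.assoc)
  ultimately show thesis using that by (metis mult_nonneg_nonneg zero_le_power of_nat_0_le_iff add_nonneg_nonneg zero_le_one)
qed

lemma left_matrix_decay:
  assumes "torus_symbol q a" "moderate q" shows "left_matrix a \<in> decay q"
  unfolding decay_def mem_Collect_eq
proof
  fix N
  obtain C where "\<And>k p. cmod (fourier_coef (a k) p) \<le> C * q k / japanese p ^ N"
    using torus_symbol_coef[OF assms] by metis
  thus "\<exists>C. \<forall>k l. cmod (left_matrix a k l) \<le> C * q k / japanese (k - l) ^ N" unfolding left_matrix_def by blast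
qed

text \<open>Sum the first differences along a lattice path from \<open>k\<close> to \<open>l\<close> that is monotone in every coordinate;
  the weight along the path exceeds its value at \<open>k\<close> by at most a power of the distance.\<close>

lemma telescoped_difference_bound:
  fixes f :: "int ^ 'n::finite \<Rightarrow> complex"
  assumes v: "\<And>k. 0 < v k" "\<And>k l. v k \<le> C * japanese (k - l) ^ M * v l" "0 < C"
    and D: "\<And>k i. cmod (f (k + axis i 1) - f k) \<le> D * v k"
  shows "cmod (f l - f k) \<le> D * (C * (real CARD('n) + 1) ^ (M + 1)) * v k * japanese (k - l) ^ (M + 1)"
proof -
  define dist1 where "dist1 = (\<lambda>l. \<Sum>i\<in>UNIV. nat \<bar>l $ i - k $ i\<bar>)"
  have D0: "0 \<le> D"
  proof -
    have "0 \<le> D * v k" using order_trans[OF norm_ge_zero D] .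
    thus ?thesis using v(1)[of k] by (simp add: zero_le_mult_iff)
  qed
  have d_real: "real (dist1 l) = (\<Sum>i\<in>UNIV. \<bar>lattice_vec (l - k) $ i\<bar>)" for l
    by (simp add: dist1_def)
  have vle: "D * v l \<le> D * C * (1 + real d) ^ M * v k" if "dist1 l \<le> d" for l d
  proof -
    have "japanese (l - k) \<le> 1 + norm (lattice_vec (l - k))" by (rule japanese_le_norm)
    also have "norm (lattice_vec (l - k)) \<le> real (dist1 l)" unfolding d_real by (rule norm_le_l1_cart)
    finally have "japanese (l - k) \<le> 1 + real d" using that by linarith
    hence "C * japanese (l - k) ^ M * v k \<le> C * (1 + real d) ^ M * v k"
      using v(1)[of k] v(3) by (intro mult_right_mono mult_left_mono power_mono) auto
    from mult_left_mono[OF order_trans[OF v(2)[of l k] this] D0] show ?thesis by (simp add: mult_ac)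
  qed
  have claim: "cmod (f l - f k) \<le> real d * (D * C * (1 + real d) ^ M * v k)" if "dist1 l = d" for l d
    using that
  proof (induction d arbitrary: l)
    case 0
    hence "l $ i = k $ i" for i by (simp add: dist1_def)
    hence "l = k" by (simp add: vec_eq_iff)
    thus ?case by simp
  next
    case (Suc d)
    have "\<exists>i. l $ i \<noteq> k $ i"
    proof (rule ccontr)
      assume "\<nexists>i. l $ i \<noteq> k $ i"
      thus False using Suc.prems by (simp add: dist1_def)
    qed
    then obtain i where i: "l $ i \<noteq> k $ i" by blast
    \<comment> \<open>one step towards \<open>k\<close>\<close>
    define s :: int where "s = (if l $ i > k $ i then - 1 else 1)"
    define l' where "l' = l + axis i s"
    have dist: "Suc (dist1 l') = dist1 l"
    proof -
      have "dist1 l = nat \<bar>l $ i - k $ i\<bar> + (\<Sum>j\<in>UNIV - {i}. nat \<bar>l $ j - k $ j\<bar>)"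
        unfolding dist1_def by (rule sum.remove) auto
      moreover have "dist1 l' = nat \<bar>l' $ i - k $ i\<bar> + (\<Sum>j\<in>UNIV - {i}. nat \<bar>l' $ j - k $ j\<bar>)"
        unfolding dist1_def by (rule sum.remove) auto
      moreover have "(\<Sum>j\<in>UNIV - {i}. nat \<bar>l' $ j - k $ j\<bar>) = (\<Sum>j\<in>UNIV - {i}. nat \<bar>l $ j - k $ j\<bar>)"
        by (rule sum.cong) (auto simp: l'_def axis_def)
      moreover have "Suc (nat \<bar>l' $ i - k $ i\<bar>) = nat \<bar>l $ i - k $ i\<bar>"
        using i by (auto simp: l'_def axis_def s_def)
      ultimately show ?thesis by simp
    qed
    have IH: "cmod (f l' - f k) \<le> real d * (D * C * (1 + real d) ^ M * v k)"
      by (rule Suc.IH) (use dist Suc.prems in simp)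
    have step: "cmod (f l - f l') \<le> D * C * (1 + real (Suc d)) ^ M * v k"
    proof (cases "l $ i > k $ i")
      case True
      hence "l = l' + axis i 1" by (simp add: l'_def s_def vec_eq_iff axis_def)
      hence "cmod (f l - f l') \<le> D * v l'" using D[of l' i] by simp
      also have "\<dots> \<le> D * C * (1 + real (Suc d)) ^ M * v k" by (rule vle) (use dist Suc.prems in simp)
      finally show ?thesis .
    next
      case False
      hence "l' = l + axis i 1" by (simp add: l'_def s_def)
      hence "cmod (f l - f l') \<le> D * v l" using D[of l i] by (simp add: norm_minus_commute)
      also have "\<dots> \<le> D * C * (1 + real (Suc d)) ^ M * v k" by (rule vle) (use Suc.prems in simp)
      finally show ?thesis .
    qed
    have "D * C * (1 + real d) ^ M * v k \<le> D * C * (1 + real (Suc d)) ^ M * v k"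
      using D0 v(1)[of k] v(3) by (intro mult_right_mono mult_left_mono power_mono) auto
    hence "real d * (D * C * (1 + real d) ^ M * v k) \<le> real d * (D * C * (1 + real (Suc d)) ^ M * v k)"
      by (rule mult_left_mono) simp
    with IH step have "cmod (f l' - f k) + cmod (f l - f l') \<le> real (Suc d) * (D * C * (1 + real (Suc d)) ^ M * v k)"
      by (simp add: distrib_right)
    thus ?case using norm_triangle_ineq[of "f l' - f k" "f l - f l'"] by simp
  qed
  let ?d = "real (dist1 l)" and ?J = "japanese (k - l)"
  have "?d \<le> real CARD('n) * ?J"
  proof -
    have "\<bar>lattice_vec (l - k) $ i\<bar> \<le> ?J" for i
      using component_le_norm_cart[of "lattice_vec (l - k)" i] norm_le_japanese[of "l - k"] japanese_diff_commute[of k l]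
      by linarith
    thus ?thesis unfolding d_real using sum_bounded_above[of UNIV "\<lambda>i. \<bar>lattice_vec (l - k) $ i\<bar>" ?J] by simp
  qed
  hence d1: "1 + ?d \<le> (real CARD('n) + 1) * ?J" using japanese_ge_1[of "k - l"] unfolding distrib_right mult_1 by linarith
  have "cmod (f l - f k) \<le> ?d * (D * C * (1 + ?d) ^ M * v k)" by (rule claim) simp
  also have "\<dots> \<le> (1 + ?d) * (D * C * (1 + ?d) ^ M * v k)"
    using D0 v(1)[of k] v(3) by (intro mult_right_mono) auto
  also have "\<dots> = D * C * v k * (1 + ?d) ^ (M + 1)" by (simp add: mult_ac)
  also have "\<dots> \<le> D * C * v k * ((real CARD('n) + 1) * ?J) ^ (M + 1)"
    using D0 v(1)[of k] v(3) by (intro mult_left_mono power_mono d1) auto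
  finally show ?thesis by (simp only: power_mult_distrib mult_ac)
qed

lemma slow_torus_symbol_coef:
  fixes a :: "int ^ 'n::finite \<Rightarrow> real ^ 'n \<Rightarrow> complex"
  assumes a: "slow_torus_symbol q a" and q: "moderate q"
  obtains M where "\<And>N. \<exists>C. \<forall>k l p.
    cmod (fourier_coef (a l) p - fourier_coef (a k) p) \<le> C * (q k * inv_japanese k) * japanese (k - l) ^ M / japanese p ^ N"
proof -
  let ?v = "\<lambda>k. q k * inv_japanese k"
  have v: "moderate ?v" by (rule moderate_mult[OF q moderate_inv_japanese])
  obtain C M where C: "0 < C" "\<And>k l. ?v k \<le> C * japanese (k - l) ^ M * ?v l" using moderateE[OF v] by blast
  have cp: "torus_continuous (a k)" for k using a by (simp add: slow_torus_symbol_def torus_symbol_def)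
  show thesis
  proof (rule that)
    fix N
    have "\<exists>C. 0 \<le> C \<and> (\<forall>k p. cmod (fourier_coef (a (k + axis i 1)) p - fourier_coef (a k) p) \<le> C * ?v k / japanese p ^ N)" for i
    proof -
      have "torus_symbol ?v (\<lambda>k x. a (k + axis i 1) x - a k x)" using a by (simp add: slow_torus_symbol_def)
      then obtain C where "0 \<le> C" "\<And>k p. cmod (fourier_coef (\<lambda>x. a (k + axis i 1) x - a k x) p) \<le> C * ?v k / japanese p ^ N"
        using torus_symbol_coef[OF _ v] by blast
      thus ?thesis by (auto simp: fourier_coef_diff[OF cp cp])
    qed
    then obtain B where B: "\<And>i. 0 \<le> B i"
      "\<And>i k p. cmod (fourier_coef (a (k + axis i 1)) p - fourier_coef (a k) p) \<le> B i * ?v k / japanese p ^ N" by metis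
    define D where "D = (\<Sum>i\<in>UNIV. B i)"
    have D: "B i \<le> D" for i unfolding D_def using B(1) by (intro member_le_sum) auto
    have step: "cmod (fourier_coef (a (k + axis i 1)) p - fourier_coef (a k) p) \<le> D / japanese p ^ N * ?v k" for i k p
    proof -
      have "B i * ?v k / japanese p ^ N \<le> D * ?v k / japanese p ^ N"
        using moderate_pos[OF q, of k] by (intro divide_right_mono mult_right_mono D) auto
      thus ?thesis using B(2)[of k i p] by (simp add: mult_ac)
    qed
    have "cmod (fourier_coef (a l) p - fourier_coef (a k) p) \<le>
        (D * (C * (real CARD('n) + 1) ^ (M + 1))) * ?v k * japanese (k - l) ^ (M + 1) / japanese p ^ N" for k l p
      using telescoped_difference_bound[of ?v C M "\<lambda>k. fourier_coef (a k) p" "D / japanese p ^ N" l k, OF moderate_pos[OF v] C(2,1) step]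
      by (simp add: mult.commute[of "japanese _ ^ N"])
    thus "\<exists>C. \<forall>k l p. cmod (fourier_coef (a l) p - fourier_coef (a k) p) \<le> C * ?v k * japanese (k - l) ^ (M + 1) / japanese p ^ N"
      by blast
  qed
qed

text \<open>If the entries \<open>X j l\<close> were the coefficients of \<open>a k\<close> at \<open>j - l\<close> for the row index \<open>k\<close> of the product,
  then the product would consist of the coefficients of \<open>b k * a k\<close> and hence be the identity outside
  \<open>F\<close>.  Up to finitely many rows the remainder is the sum of the errors that are made in this
  replacement; the hypothesis \<open>near\<close> says that they are of lower order.\<close>

lemma parametrix_remainder:
  fixes a b :: "int ^ 'n::finite \<Rightarrow> real ^ 'n \<Rightarrow> complex"
  assumes q: "moderate q" and a: "torus_symbol q a" and b: "torus_symbol (\<lambda>k. 1 / q k) b" and F: "finite F"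
    and ba: "\<And>k x. b k x * a k x = (if k \<in> F then 0 else 1)"
    and near: "\<And>N. \<exists>C. \<forall>k j l. cmod (X j l - fourier_coef (a k) (j - l)) \<le> C * (q k * inv_japanese k) * japanese (k - j) ^ M / japanese (j - l) ^ N"
  shows "(\<lambda>k l. mat_mult (left_matrix b) X k l - id_mat k l) \<in> decay inv_japanese"
  unfolding decay_def mem_Collect_eq
proof
  fix N
  let ?n = "2 * CARD('n)"
  have pos: "0 < q k" for k by (rule moderate_pos[OF q])
  obtain B where B: "0 \<le> B" "\<And>k p. cmod (fourier_coef (b k) p) \<le> B * (1 / q k) / japanese p ^ (N + ?n + M)"
    using torus_symbol_coef[OF b moderate_inverse[OF q]] by metis
  obtain A where A: "0 \<le> A" "\<And>k p. cmod (fourier_coef (a k) p) \<le> A * q k / japanese p ^ ?n"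
    using torus_symbol_coef[OF a q] by metis
  obtain C where C: "\<And>k j l. cmod (X j l - fourier_coef (a k) (j - l)) \<le> C * (q k * inv_japanese k) * japanese (k - j) ^ M / japanese (j - l) ^ (N + ?n)"
    using near by blast
  define BF where "BF = (\<Sum>k\<in>F. japanese k)"
  have "cmod (mat_mult (left_matrix b) X k l - id_mat k l) \<le> (2 ^ N * (B * C) * japanese_sum TYPE('n) + BF) * inv_japanese k / japanese (k - l) ^ N" for k l
  proof -
    \<comment> \<open>\<open>u\<close> sums to the coefficients of \<open>b k * a k\<close>, \<open>w\<close> collects the errors\<close>
    define u where "u = (\<lambda>j. fourier_coef (b k) (k - j) * fourier_coef (a k) (j - l))"
    define w where "w = (\<lambda>j. fourier_coef (b k) (k - j) * (X j l - fourier_coef (a k) (j - l)))"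
    have w_le: "cmod (w j) \<le> B * C * inv_japanese k / (japanese (k - j) ^ (N + ?n) * japanese (j - l) ^ (N + ?n))" for j
    proof -
      have "cmod (w j) \<le> (B * (1 / q k) / japanese (k - j) ^ (N + ?n + M)) * (C * (q k * inv_japanese k) * japanese (k - j) ^ M / japanese (j - l) ^ (N + ?n))"
        unfolding w_def norm_mult using B(1) pos[of k] by (intro mult_mono B(2) C) auto
      also have "\<dots> = B * C * inv_japanese k / (japanese (k - j) ^ (N + ?n) * japanese (j - l) ^ (N + ?n))"
        using pos[of k] by (simp add: power_add)
      finally show ?thesis .
    qed
    have u_le: "cmod (u j) \<le> (B * A) * (1 / japanese (k - j) ^ ?n)" for j
    proof -
      have "cmod (u j) \<le> (B * (1 / q k) / japanese (k - j) ^ (N + ?n + M)) * (A * q k / japanese (j - l) ^ ?n)"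
        unfolding u_def norm_mult using B(1) pos[of k] by (intro mult_mono B(2) A) auto
      also have "\<dots> = (B * A) * (1 / (japanese (k - j) ^ (N + ?n + M) * japanese (j - l) ^ ?n))"
        using pos[of k] by simp
      also have "\<dots> \<le> (B * A) * (1 / (japanese (k - j) ^ ?n * 1))"
        using B(1) A(1) by (intro mult_left_mono divide_left_mono mult_mono power_increasing) (auto intro!: mult_pos_pos)
      finally show ?thesis by simp
    qed
    have BC: "0 \<le> B * C * inv_japanese k"
    proof -
      have "0 < japanese (k - k) ^ (N + ?n) * japanese (k - l) ^ (N + ?n)" by simp
      thus ?thesis using order_trans[OF norm_ge_zero w_le[of k]] unfolding zero_le_divide_iff by linarith
    qed
    have w_le': "cmod (w j) \<le> (B * C * inv_japanese k) * (1 / japanese (k - j) ^ ?n)" for j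
    proof -
      have "cmod (w j) \<le> (B * C * inv_japanese k) * (1 / (japanese (k - j) ^ (N + ?n) * japanese (j - l) ^ (N + ?n)))"
        using w_le[of j] by simp
      also have "\<dots> \<le> (B * C * inv_japanese k) * (1 / (japanese (k - j) ^ ?n * 1))"
        by (intro mult_left_mono[OF _ BC] divide_left_mono mult_mono power_increasing) (auto intro!: mult_pos_pos)
      finally show ?thesis by simp
    qed
    have su: "u summable_on UNIV"
      by (rule abs_summable_summable, rule Infinite_Sum.abs_summable_on_comparison_test'[OF summable_on_cmult_right[OF summable_japanese_shift(1)] u_le])
    have sw: "w summable_on UNIV"
      by (rule abs_summable_summable, rule Infinite_Sum.abs_summable_on_comparison_test'[OF summable_on_cmult_right[OF summable_japanese_shift(1)] w_le'])
    have "mat_mult (left_matrix b) X k l = (\<Sum>\<^sub>\<infinity>j. u j + w j)"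
      unfolding mat_mult_def left_matrix_def u_def w_def by (simp add: algebra_simps)
    also have "\<dots> = infsum u UNIV + infsum w UNIV" by (rule infsum_add[OF su sw])
    also have "infsum u UNIV = (\<Sum>\<^sub>\<infinity>p. fourier_coef (b k) ((k - l) - p) * fourier_coef (a k) p)"
    proof -
      have "bij_betw (\<lambda>j. j - l) (UNIV :: (int ^ 'n) set) UNIV"
        by (rule bij_betw_byWitness[where f' = "\<lambda>j. j + l"]) auto
      from infsum_reindex_bij_betw[OF this, of "\<lambda>p. fourier_coef (b k) ((k - l) - p) * fourier_coef (a k) p"]
      show ?thesis by (simp add: u_def)
    qed
    also have "\<dots> = fourier_coef (\<lambda>x. b k x * a k x) (k - l)"
      by (rule fourier_coef_mult[symmetric, OF _ _ A(2)]) (use a b in \<open>auto simp: torus_symbol_def\<close>)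
    also have "\<dots> = id_mat k l - (if k \<in> F \<and> k = l then 1 else 0)"
      unfolding ba using fourier_coef_one[of "k - l"] by (auto simp: id_mat_def fourier_coef_def)
    finally have eq: "mat_mult (left_matrix b) X k l - id_mat k l = infsum w UNIV - (if k \<in> F \<and> k = l then 1 else 0)" by simp
    have "cmod (infsum w UNIV) \<le> 2 ^ N * (B * C * inv_japanese k) * japanese_sum TYPE('n) / japanese (k - l) ^ N"
      by (rule infsum_convolution_le[OF w_le])
    moreover have "cmod (if k \<in> F \<and> k = l then 1 else 0) \<le> BF * inv_japanese k / japanese (k - l) ^ N"
    proof (cases "k \<in> F \<and> k = l")
      case True
      hence "japanese k \<le> BF" unfolding BF_def using F by (intro member_le_sum) auto
      thus ?thesis using True by auto
    next
      case False
      have "0 \<le> BF" unfolding BF_def by (intro sum_nonneg) simp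
      hence "0 \<le> BF * inv_japanese k / japanese (k - l) ^ N" by simp
      thus ?thesis using False by auto
    qed
    ultimately show ?thesis
      unfolding eq using norm_triangle_ineq4[of "infsum w UNIV" "if k \<in> F \<and> k = l then 1 else 0"]
      by (simp add: distrib_right add_divide_distrib mult_ac)
  qed
  thus "\<exists>C. \<forall>k l. cmod (mat_mult (left_matrix b) X k l - id_mat k l) \<le> C * inv_japanese k / japanese (k - l) ^ N" by blast
qed

text \<open>In the first product the true entry uses \<open>a j\<close> in place of \<open>a k\<close>, in the second it uses \<open>a l\<close>.  In both
  cases the distance of the two indices is controlled by those of \<open>k, j\<close> and \<open>j, l\<close>.\<close>

lemma left_right_parametrix:
  fixes a b :: "int ^ 'n::finite \<Rightarrow> real ^ 'n \<Rightarrow> complex"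
  assumes q: "moderate q" and a: "slow_torus_symbol q a" and b: "torus_symbol (\<lambda>k. 1 / q k) b" and F: "finite F"
    and ba: "\<And>k x. b k x * a k x = (if k \<in> F then 0 else 1)"
  shows "(\<lambda>k l. mat_mult (left_matrix b) (left_matrix a) k l - id_mat k l) \<in> decay inv_japanese"
    and "(\<lambda>k l. mat_mult (left_matrix b) (right_matrix a) k l - id_mat k l) \<in> decay inv_japanese"
proof -
  have a': "torus_symbol q a" using a by (simp add: slow_torus_symbol_def)
  obtain M where M: "\<And>N. \<exists>C. \<forall>k l p.
    cmod (fourier_coef (a l) p - fourier_coef (a k) p) \<le> C * (q k * inv_japanese k) * japanese (k - l) ^ M / japanese p ^ N"
    using slow_torus_symbol_coef[OF a q] by blast
  show "(\<lambda>k l. mat_mult (left_matrix b) (left_matrix a) k l - id_mat k l) \<in> decay inv_japanese"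
    by (rule parametrix_remainder[OF q a' b F ba, where M = M]) (unfold left_matrix_def, use M in blast)
  show "(\<lambda>k l. mat_mult (left_matrix b) (right_matrix a) k l - id_mat k l) \<in> decay inv_japanese"
  proof (rule parametrix_remainder[OF q a' b F ba, where M = M])
    fix N
    obtain C where C: "\<And>k l p. cmod (fourier_coef (a l) p - fourier_coef (a k) p) \<le> C * (q k * inv_japanese k) * japanese (k - l) ^ M / japanese p ^ (N + M)"
      using M by blast
    have C0: "0 \<le> C"
    proof -
      have "0 \<le> C * q 0" using order_trans[OF norm_ge_zero C[of 0 0 0]] by simp
      thus ?thesis using moderate_pos[OF q, of 0] by (simp add: zero_le_mult_iff)
    qed
    have "cmod (right_matrix a j l - fourier_coef (a k) (j - l)) \<le> (C * 2 ^ M) * (q k * inv_japanese k) * japanese (k - j) ^ M / japanese (j - l) ^ N" for k j l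
    proof -
      have "cmod (right_matrix a j l - fourier_coef (a k) (j - l)) \<le> C * (q k * inv_japanese k) * japanese (k - l) ^ M / japanese (j - l) ^ (N + M)"
        unfolding right_matrix_def by (rule C)
      also have "\<dots> \<le> C * (q k * inv_japanese k) * (2 ^ M * japanese (k - j) ^ M * japanese (j - l) ^ M) / japanese (j - l) ^ (N + M)"
        using C0 moderate_pos[OF q, of k] by (intro divide_right_mono mult_left_mono japanese_triangle_power) auto
      finally show ?thesis by (simp add: power_add mult_ac)
    qed
    thus "\<exists>C. \<forall>k j l. cmod (right_matrix a j l - fourier_coef (a k) (j - l)) \<le> C * (q k * inv_japanese k) * japanese (k - j) ^ M / japanese (j - l) ^ N"
      by blast
  qed
qed

lemma bdd_derivs_zero: "0 \<le> C \<Longrightarrow> bdd_derivs N C (\<lambda>t. 0)"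
  by (induction N) (simp, rule bdd_derivs_SucI[where f' = "\<lambda>t. 0"], auto)

text \<open>The normalised functions \<open>a k / q k\<close> satisfy bounds that do not depend on \<open>k\<close>, from above and from
  below, so the reciprocals do too.\<close>

lemma torus_symbol_reciprocal:
  assumes q: "moderate q" and a: "torus_symbol q a" and c: "0 < c" and low: "\<And>k x. k \<notin> F \<Longrightarrow> c * q k \<le> cmod (a k x)"
  shows "torus_symbol (\<lambda>k. 1 / q k) (\<lambda>k x. if k \<in> F then 0 else inverse (a k x))"
  unfolding torus_symbol_def
proof (intro conjI allI)
  have pos: "0 < q k" for k by (rule moderate_pos[OF q])
  have nz: "a k x \<noteq> 0" if "k \<notin> F" for k x
    using low[OF that, of x] mult_pos_pos[OF c pos[of k]] by auto
  show "torus_continuous (\<lambda>x. if k \<in> F then 0 else inverse (a k x))" for k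
    using a nz[of k] by (cases "k \<in> F") (auto simp: torus_continuous_const torus_symbol_def torus_continuous_def intro!: continuous_intros)
  fix N
  obtain C where C: "\<And>k x j. bdd_derivs N (C * q k) (\<lambda>t. a k (x + t *\<^sub>R axis j 1))" using a unfolding torus_symbol_def by blast
  obtain E where E: "\<And>f. bdd_derivs N C f \<Longrightarrow> \<forall>t. c \<le> cmod (f t) \<Longrightarrow> bdd_derivs N E (\<lambda>t. inverse (f t))"
    using bdd_derivs_inverse[OF c, of N C] by blast
  have "bdd_derivs N (\<bar>E\<bar> * (1 / q k)) (\<lambda>t. if k \<in> F then 0 else inverse (a k (x + t *\<^sub>R axis j 1)))" for k x j
  proof (cases "k \<in> F")
    case False
    let ?r = "complex_of_real (1 / q k)"
    have n: "cmod ?r = 1 / q k" using pos[of k] by (simp add: norm_divide)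
    have "bdd_derivs N C (\<lambda>t. ?r * a k (x + t *\<^sub>R axis j 1))"
      using bdd_derivs_cmult[OF C[of k x j], of ?r] pos[of k] unfolding n by simp
    moreover have "c \<le> cmod (?r * a k (x + t *\<^sub>R axis j 1))" for t
      using low[OF False, of "x + t *\<^sub>R axis j 1"] pos[of k] unfolding norm_mult n by (simp add: field_simps)
    ultimately have "bdd_derivs N E (\<lambda>t. inverse (?r * a k (x + t *\<^sub>R axis j 1)))" using E by blast
    from bdd_derivs_cmult[OF this, of ?r]
    have "bdd_derivs N (E * (1 / q k)) (\<lambda>t. ?r * inverse (?r * a k (x + t *\<^sub>R axis j 1)))"
      unfolding n by (simp only: mult.commute)
    moreover have "?r * inverse (?r * z) = inverse z" for z using pos[of k] by (simp add: inverse_eq_divide)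
    ultimately have "bdd_derivs N (E * (1 / q k)) (\<lambda>t. inverse (a k (x + t *\<^sub>R axis j 1)))" by simp
    thus ?thesis using False pos[of k] by (auto elim!: bdd_derivs_mono intro!: divide_right_mono)
  qed (use pos[of k] in \<open>simp add: bdd_derivs_zero\<close>)
  thus "\<exists>C. \<forall>k x j. bdd_derivs N (C * (1 / q k)) (\<lambda>t. if k \<in> F then 0 else inverse (a k (x + t *\<^sub>R axis j 1)))" by blast
qed

text \<open>The adjoint of \<open>left_matrix a\<close> has a left parametrix built from the conjugate symbol; the adjoint of
  this parametrix is the right parametrix.\<close>

lemma elliptic_matrix_if_bounded_below:
  fixes a :: "int ^ 'n::finite \<Rightarrow> real ^ 'n \<Rightarrow> complex"
  assumes q: "moderate q" and a: "slow_torus_symbol q a" and F: "finite F" and c: "0 < c"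
    and low: "\<And>k x. k \<notin> F \<Longrightarrow> c * q k \<le> cmod (a k x)"
  obtains B B' R R' where "elliptic_matrix q (left_matrix a) B B' R R'"
proof -
  define b where "b = (\<lambda>k x. if k \<in> F then 0 else inverse (a k x))"
  define a' where "a' = (\<lambda>k x. cnj (a k x))"
  define b' where "b' = (\<lambda>k x. if k \<in> F then 0 else inverse (a' k x))"
  have at: "torus_symbol q a" using a by (simp add: slow_torus_symbol_def)
  have q': "moderate (\<lambda>k. 1 / q k)" by (rule moderate_inverse[OF q])
  have nz: "a k x \<noteq> 0" if "k \<notin> F" for k x
    using low[OF that, of x] mult_pos_pos[OF c moderate_pos[OF q, of k]] by auto
  have b: "torus_symbol (\<lambda>k. 1 / q k) b" unfolding b_def by (rule torus_symbol_reciprocal[OF q at c low])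
  have a's: "slow_torus_symbol q a'" unfolding a'_def by (rule slow_torus_symbol_cnj[OF a])
  have b't: "torus_symbol (\<lambda>k. 1 / q k) b'" unfolding b'_def
    by (rule torus_symbol_reciprocal[OF q _ c]) (use a's low in \<open>auto simp: slow_torus_symbol_def a'_def\<close>)
  define R where "R = (\<lambda>k l. mat_mult (left_matrix b) (left_matrix a) k l - id_mat k l)"
  define R' where "R' = adj (\<lambda>k l. mat_mult (left_matrix b') (right_matrix a') k l - id_mat k l)"
  have "elliptic_matrix q (left_matrix a) (left_matrix b) (adj (left_matrix b')) R R'"
  proof
    show "left_matrix a \<in> decay q" by (rule left_matrix_decay[OF at q])
    show "left_matrix b \<in> decay (\<lambda>k. 1 / q k)" by (rule left_matrix_decay[OF b q'])
    show "adj (left_matrix b') \<in> decay (\<lambda>k. 1 / q k)" by (rule decay_adj[OF left_matrix_decay[OF b't q'] q'])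
    show "R \<in> decay inv_japanese" unfolding R_def
      by (rule left_right_parametrix(1)[OF q a b F]) (auto simp: b_def nz)
    show "R' \<in> decay inv_japanese" unfolding R'_def
      by (rule decay_adj[OF left_right_parametrix(2)[OF q a's b't F] moderate_inv_japanese]) (auto simp: b'_def a'_def nz)
    show "mat_mult (left_matrix b) (left_matrix a) = (\<lambda>k l. id_mat k l + R k l)" by (simp add: R_def)
    have "adj (right_matrix a') = left_matrix a" unfolding a'_def adj_left_matrix[symmetric] by simp
    hence "mat_mult (left_matrix a) (adj (left_matrix b')) = adj (mat_mult (left_matrix b') (right_matrix a'))" by (simp add: adj_mat_mult)
    thus "mat_mult (left_matrix a) (adj (left_matrix b')) = (\<lambda>k l. id_mat k l + R' k l)"
      by (simp add: R'_def adj_def id_mat_def fun_eq_iff)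
  qed (rule q)
  thus thesis by (rule that)
qed

section \<open>Symbols of order \<open>m\<close>\<close>

lemma distinct_coords: "distinct (coords :: 'n::finite list)" and set_coords: "set (coords :: 'n list) = UNIV"
proof -
  obtain js :: "'n list" where "set js = UNIV" "distinct js"
    using finite_distinct_list[of "UNIV :: 'n set"] by auto
  hence "distinct (coords :: 'n list) \<and> set (coords :: 'n list) = UNIV"
    unfolding coords_def by (intro someI[of "\<lambda>js. distinct js \<and> set js = UNIV"]) auto
  thus "distinct (coords :: 'n list)" "set (coords :: 'n list) = UNIV" by auto
qed

text \<open>Multi-index powers with a single nonzero exponent do not depend on the enumeration \<open>coords\<close>.\<close>

lemma foldr_single:
  assumes "distinct js" "\<And>i. i \<noteq> j \<Longrightarrow> F i = id"
  shows "foldr F js x = (if j \<in> set js then F j x else x)"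
  using assms(1) by (induction js) (use assms(2) in \<open>auto, metis id_apply\<close>)

lemma D_multi_single: "D_multi (\<lambda>i. if i = j then l else 0) f = D_coord l j f"
proof -
  let ?F = "\<lambda>i. D_coord (if i = j then l else 0) i"
  have "?F i = id" if "i \<noteq> j" for i using that by (simp add: fun_eq_iff)
  from foldr_single[where F = ?F and j = j and x = f, OF distinct_coords this] show ?thesis
    unfolding D_multi_def by (simp add: set_coords)
qed

lemma multi_difference_zero: "multi_difference (\<lambda>_. 0) u = u"
proof -
  have "foldr (\<lambda>j. difference j ^^ 0) js u = u" for js by (induction js) auto
  thus ?thesis by (simp add: multi_difference_def)
qed

lemma multi_difference_single: "multi_difference (\<lambda>i. if i = j then 1 else 0) u = difference j u"
proof -
  let ?F = "\<lambda>i. difference i ^^ (if i = j then 1 else 0)"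
  have "?F i = id" if "i \<noteq> j" for i using that by (simp add: fun_eq_iff)
  from foldr_single[where F = ?F and j = j and x = u, OF distinct_coords this] show ?thesis
    unfolding multi_difference_def by (simp add: set_coords)
qed

text \<open>The part of \<open>smooth_on_torus\<close> that concerns repeated differentiation along one coordinate; unlike the
  full condition it is easily seen to be preserved by the operators \<open>D_coord\<close>.\<close>

definition line_smooth :: "'n::finite \<Rightarrow> (real ^ 'n \<Rightarrow> complex) \<Rightarrow> bool" where
  "line_smooth j f \<longleftrightarrow> (\<forall>i x. (\<lambda>t. (partial_deriv j ^^ i) f (x + t *\<^sub>R axis j 1)) differentiable (at 0))"

lemma smooth_on_torus_line_smooth: "smooth_on_torus f \<Longrightarrow> line_smooth j f"
  unfolding line_smooth_def
proof (intro allI)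
  fix i x assume "smooth_on_torus f"
  hence "(\<lambda>t. foldr partial_deriv (replicate i j) f (x + t *\<^sub>R axis j 1)) differentiable (at 0)"
    unfolding smooth_on_torus_def by blast
  thus "(\<lambda>t. (partial_deriv j ^^ i) f (x + t *\<^sub>R axis j 1)) differentiable (at 0)"
    by (simp add: foldr_replicate)
qed

lemma smooth_on_torus_torus_continuous: "smooth_on_torus f \<Longrightarrow> torus_continuous f"
proof -
  assume *: "smooth_on_torus f"
  hence "continuous_on UNIV (foldr partial_deriv [] f)" unfolding smooth_on_torus_def by blast
  thus ?thesis using * by (simp add: torus_continuous_def smooth_on_torus_def)
qed

lemma line_smooth_partial_deriv: "line_smooth j f \<Longrightarrow> line_smooth j (partial_deriv j f)"
  unfolding line_smooth_def
proof (intro allI)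
  fix i x assume *: "\<forall>i x. (\<lambda>t. (partial_deriv j ^^ i) f (x + t *\<^sub>R axis j 1)) differentiable (at 0)"
  show "(\<lambda>t. (partial_deriv j ^^ i) (partial_deriv j f) (x + t *\<^sub>R axis j 1)) differentiable (at 0)"
    using *[rule_format, of "Suc i" x] by (simp only: funpow_Suc_right o_apply)
qed

lemma line_smooth_deriv:
  assumes "line_smooth j f"
  shows "((\<lambda>t. f (x + t *\<^sub>R axis j 1)) has_vector_derivative partial_deriv j f (x + t *\<^sub>R axis j 1)) (at t)"
proof -
  have "(\<lambda>s. f ((x + t *\<^sub>R axis j 1) + s *\<^sub>R axis j 1)) differentiable (at 0)"
    using assms[unfolded line_smooth_def, rule_format, of 0 "x + t *\<^sub>R axis j 1"] by simp
  hence "((\<lambda>s. f ((x + t *\<^sub>R axis j 1) + s *\<^sub>R axis j 1)) has_vector_derivative partial_deriv j f (x + t *\<^sub>R axis j 1)) (at (t - t))"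
    unfolding partial_deriv_def by (simp only: vector_derivative_works diff_self)
  moreover have "((\<lambda>s. s - t) has_vector_derivative 1) (at t)" by (auto intro!: derivative_eq_intros)
  ultimately show ?thesis
    using vector_diff_chain_at[of "\<lambda>s. s - t" 1 t] by (fastforce simp: o_def algebra_simps)
qed

lemma partial_deriv_lincomb:
  assumes "line_smooth j f" "line_smooth j g"
  shows "partial_deriv j (\<lambda>x. c * f x + d * g x) = (\<lambda>x. c * partial_deriv j f x + d * partial_deriv j g x)"
proof
  fix x
  have "((\<lambda>t. c * f (x + t *\<^sub>R axis j 1) + d * g (x + t *\<^sub>R axis j 1)) has_vector_derivative
      c * partial_deriv j f (x + 0 *\<^sub>R axis j 1) + d * partial_deriv j g (x + 0 *\<^sub>R axis j 1)) (at 0)"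
    by (intro derivative_intros line_smooth_deriv assms)
  thus "partial_deriv j (\<lambda>x. c * f x + d * g x) x = c * partial_deriv j f x + d * partial_deriv j g x"
    unfolding partial_deriv_def[of j "\<lambda>x. c * f x + d * g x"] by (simp add: vector_derivative_at)
qed

lemma line_smooth_lincomb:
  assumes "line_smooth j f" "line_smooth j g"
  shows "line_smooth j (\<lambda>x. c * f x + d * g x)"
proof -
  have "(partial_deriv j ^^ i) (\<lambda>x. c * f x + d * g x) =
      (\<lambda>x. c * (partial_deriv j ^^ i) f x + d * (partial_deriv j ^^ i) g x)
    \<and> line_smooth j ((partial_deriv j ^^ i) f) \<and> line_smooth j ((partial_deriv j ^^ i) g)" for i
    by (induction i) (auto simp: assms partial_deriv_lincomb line_smooth_partial_deriv)
  hence eq: "(partial_deriv j ^^ i) (\<lambda>x. c * f x + d * g x) =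
      (\<lambda>x. c * (partial_deriv j ^^ i) f x + d * (partial_deriv j ^^ i) g x)" for i by blast
  show ?thesis
    unfolding line_smooth_def eq using assms unfolding line_smooth_def
    by (intro allI differentiable_add differentiable_mult differentiable_const) auto
qed

lemma D_coord_Suc_eq:
  "D_coord (Suc l) j f = (\<lambda>x. (1 / (2 * pi * \<i>)) * partial_deriv j (D_coord l j f) x + (- of_nat l) * D_coord l j f x)"
  by (simp add: fun_eq_iff)

lemma D_coord_line_smooth: "line_smooth j f \<Longrightarrow> line_smooth j (D_coord l j f)"
proof (induction l)
  case (Suc l)
  thus ?case unfolding D_coord_Suc_eq by (intro line_smooth_lincomb line_smooth_partial_deriv) auto
qed simp

lemma partial_deriv_D_coord:
  "partial_deriv j (D_coord l j f) x = (2 * pi * \<i>) * (D_coord (Suc l) j f x + of_nat l * D_coord l j f x)"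
  by simp

text \<open>The relation \<open>partial_deriv_D_coord\<close> expresses a derivative of \<open>D_coord l j f\<close> by \<open>D_coord\<close> of the next and
  of the same degree, so bounds for \<open>D_coord\<close> up to degree \<open>L\<close> bound the ordinary derivatives.\<close>

lemma bdd_derivs_D_coord:
  "\<exists>c\<ge>0. \<forall>f C. line_smooth j f \<longrightarrow> (\<forall>l\<le>L. \<forall>x. cmod (D_coord l j f x) \<le> C) \<longrightarrow>
     (\<forall>l x. l + N \<le> L \<longrightarrow> bdd_derivs N (c * C) (\<lambda>t. D_coord l j f (x + t *\<^sub>R axis j 1)))"
proof (induction N)
  case 0
  show ?case by (intro exI[of _ 1]) auto
next
  case (Suc N)
  then obtain c where c: "0 \<le> c" "\<And>f C l x. line_smooth j f \<Longrightarrow> (\<forall>l\<le>L. \<forall>x. cmod (D_coord l j f x) \<le> C) \<Longrightarrow>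
     l + N \<le> L \<Longrightarrow> bdd_derivs N (c * C) (\<lambda>t. D_coord l j f (x + t *\<^sub>R axis j 1))" by blast
  let ?c = "1 + 2 * pi * (1 + real L) * c"
  show ?case
  proof (intro exI[of _ ?c] conjI allI impI)
    fix f C l x assume f: "line_smooth j f" and C: "\<forall>l\<le>L. \<forall>x. cmod (D_coord l j f x) \<le> C" and l: "l + Suc N \<le> L"
    have C0: "0 \<le> C" using order_trans[OF norm_ge_zero C[rule_format, of 0 0]] by simp
    have cC: "0 \<le> c * C" using c(1) C0 by simp
    have "bdd_derivs N (cmod (2 * pi * \<i>) * (c * C + cmod (of_nat l) * (c * C)))
       (\<lambda>t. (2 * pi * \<i>) * (D_coord (Suc l) j f (x + t *\<^sub>R axis j 1) + of_nat l * D_coord l j f (x + t *\<^sub>R axis j 1)))"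
      using l by (intro bdd_derivs_cmult bdd_derivs_add c(2) f C) auto
    hence b: "bdd_derivs N (?c * C)
       (\<lambda>t. (2 * pi * \<i>) * (D_coord (Suc l) j f (x + t *\<^sub>R axis j 1) + of_nat l * D_coord l j f (x + t *\<^sub>R axis j 1)))"
    proof (rule bdd_derivs_mono)
      have "c * C + real l * (c * C) \<le> (1 + real L) * (c * C)"
        using l cC mult_right_mono[of "real l" "real L" "c * C"] by (simp add: distrib_right)
      hence "2 * pi * (c * C + real l * (c * C)) \<le> 2 * pi * ((1 + real L) * (c * C))" by (intro mult_left_mono) auto
      also have "\<dots> \<le> 1 * C + 2 * pi * ((1 + real L) * (c * C))" using C0 by simp
      also have "\<dots> = ?c * C" by (simp add: algebra_simps)
      finally show "cmod (2 * pi * \<i>) * (c * C + cmod (of_nat l) * (c * C)) \<le> ?c * C" by (simp add: norm_mult)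
    qed
    show "bdd_derivs (Suc N) (?c * C) (\<lambda>t. D_coord l j f (x + t *\<^sub>R axis j 1))"
    proof (rule bdd_derivs_SucI[OF _ _ b])
      fix t
      have "cmod (D_coord l j f (x + t *\<^sub>R axis j 1)) \<le> C" using C l by simp
      also have "C \<le> ?c * C" using C0 c(1) by (simp add: distrib_right)
      finally show "cmod (D_coord l j f (x + t *\<^sub>R axis j 1)) \<le> ?c * C" .
      show "((\<lambda>t. D_coord l j f (x + t *\<^sub>R axis j 1)) has_vector_derivative
        (2 * pi * \<i>) * (D_coord (Suc l) j f (x + t *\<^sub>R axis j 1) + of_nat l * D_coord l j f (x + t *\<^sub>R axis j 1))) (at t)"
        unfolding partial_deriv_D_coord[symmetric] by (rule line_smooth_deriv[OF D_coord_line_smooth[OF f]])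
    qed
  qed (use c in simp)
qed

lemma powr_norm_le_japanese:
  "\<exists>c>0. \<forall>k. (1 + norm (lattice_vec k)) powr s \<le> c * japanese k powr s"
proof (cases "0 \<le> s")
  case True
  have "(1 + norm (lattice_vec k)) powr s \<le> 2 powr s * japanese k powr s" for k
  proof -
    have "(1 + norm (lattice_vec k)) powr s \<le> (2 * japanese k) powr s"
    proof (rule powr_mono2[OF True])
      show "1 + norm (lattice_vec k) \<le> 2 * japanese k"
        using norm_le_japanese[of k] japanese_ge_1[of k] by linarith
    qed simp
    thus ?thesis by (simp add: powr_mult)
  qed
  thus ?thesis by (intro exI[of _ "2 powr s"]) auto
next
  case False
  have "(1 + norm (lattice_vec k)) powr s \<le> 1 * japanese k powr s" for k
    using False japanese_le_norm[of k] by (simp add: powr_mono2')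
  thus ?thesis by (intro exI[of _ 1]) auto
qed

lemma powr_japanese_le_norm:
  "\<exists>c>0. \<forall>k. c * japanese k powr s \<le> (1 + norm (lattice_vec k)) powr s"
proof -
  obtain c where c: "0 < c" "\<And>k :: int ^ 'a. (1 + norm (lattice_vec k)) powr (- s) \<le> c * japanese k powr (- s)"
    using powr_norm_le_japanese by blast
  have "(1 / c) * japanese k powr s \<le> (1 + norm (lattice_vec k)) powr s" for k :: "int ^ 'a"
  proof -
    have "0 < 1 + norm (lattice_vec k)" by (simp add: add_pos_nonneg)
    hence "0 < (1 + norm (lattice_vec k)) powr s" by simp
    moreover have "0 < japanese k powr s" by simp
    ultimately show ?thesis using c(1) c(2)[of k] by (simp add: powr_minus field_simps)
  qed
  thus ?thesis using c(1) by (intro exI[of _ "1 / c"]) auto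
qed

lemma torus_symbol_if_D_multi_bounded:
  fixes a :: "int ^ 'n::finite \<Rightarrow> real ^ 'n \<Rightarrow> complex"
  assumes a: "\<And>k. torus_continuous (a k)" "\<And>j k. line_smooth j (a k)"
    and D: "\<And>\<beta>. \<exists>C. \<forall>k x. cmod (D_multi \<beta> (a k) x) \<le> C * q k" and q: "\<And>k. 0 < q k"
  shows "torus_symbol q a"
  unfolding torus_symbol_def
proof (intro conjI allI a)
  fix N
  have "\<exists>C. \<forall>k x. bdd_derivs N (C * q k) (\<lambda>t. a k (x + t *\<^sub>R axis j 1))" for j
  proof -
    have "\<forall>l. \<exists>C. \<forall>k x. cmod (D_coord l j (a k) x) \<le> C * q k"
      using D[of "\<lambda>i. if i = j then _ else 0"] unfolding D_multi_single by blast
    then obtain C where C: "\<And>l k x. cmod (D_coord l j (a k) x) \<le> C l * q k" by metis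
    have C0: "0 \<le> C l" for l
    proof -
      have "0 \<le> C l * q 0" using order_trans[OF norm_ge_zero C] .
      thus ?thesis using q[of 0] by (simp add: zero_le_mult_iff)
    qed
    define S where "S = (\<Sum>l\<le>N. C l)"
    have S: "\<forall>l\<le>N. \<forall>x. cmod (D_coord l j (a k) x) \<le> S * q k" for k
    proof (intro allI impI)
      fix l x assume "l \<le> N"
      hence "C l \<le> S" unfolding S_def using C0 by (intro member_le_sum) auto
      thus "cmod (D_coord l j (a k) x) \<le> S * q k"
        using C[of l k x] q[of k] by (meson less_imp_le mult_right_mono order_trans)
    qed
    obtain c where c: "\<forall>f C. line_smooth j f \<longrightarrow> (\<forall>l\<le>N. \<forall>x. cmod (D_coord l j f x) \<le> C) \<longrightarrow>
     (\<forall>l x. l + N \<le> N \<longrightarrow> bdd_derivs N (c * C) (\<lambda>t. D_coord l j f (x + t *\<^sub>R axis j 1)))"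
      using bdd_derivs_D_coord[of j N N] by blast
    have "bdd_derivs N ((c * S) * q k) (\<lambda>t. a k (x + t *\<^sub>R axis j 1))" for k x
    proof -
      have "\<forall>l x. l + N \<le> N \<longrightarrow> bdd_derivs N (c * (S * q k)) (\<lambda>t. D_coord l j (a k) (x + t *\<^sub>R axis j 1))"
        using c a(2) S[of k] by blast
      from this[rule_format, of 0 x] show ?thesis by (simp add: mult.assoc)
    qed
    thus ?thesis by blast
  qed
  then obtain C where C: "\<And>j k x. bdd_derivs N (C j * q k) (\<lambda>t. a k (x + t *\<^sub>R axis j 1))" by metis
  have C0: "0 \<le> C j" for j
    using bdd_derivs_nonneg[OF C[of j 0]] q[of 0] by (simp add: zero_le_mult_iff)
  have "bdd_derivs N ((\<Sum>j\<in>UNIV. C j) * q k) (\<lambda>t. a k (x + t *\<^sub>R axis j 1))" for k x j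
  proof (rule bdd_derivs_mono[OF C])
    have "C j \<le> (\<Sum>j\<in>UNIV. C j)" using C0 by (intro member_le_sum) auto
    thus "C j * q k \<le> (\<Sum>j\<in>UNIV. C j) * q k" using q[of k] by (intro mult_right_mono) auto
  qed
  thus "\<exists>C. \<forall>k x j. bdd_derivs N (C * q k) (\<lambda>t. a k (x + t *\<^sub>R axis j 1))" by blast
qed

lemma symbols_slow_torus_symbol:
  fixes a :: "int ^ 'n::finite \<Rightarrow> real ^ 'n \<Rightarrow> complex"
  assumes a: "a \<in> symbols m"
  shows "slow_torus_symbol (\<lambda>k. japanese k powr m) a"
proof -
  have sm: "smooth_on_torus (a k)" for k using a by (simp add: symbols_def)
  have bound: "\<exists>C. \<forall>k x. cmod (D_multi \<beta> (\<lambda>y. multi_difference \<alpha> (\<lambda>l. a l y) k) x)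
          \<le> C * japanese k powr (m - real (\<Sum>j\<in>UNIV. \<alpha> j))" for \<alpha> \<beta>
  proof -
    obtain C where C: "0 < C" "\<And>k x. cmod (D_multi \<beta> (\<lambda>y. multi_difference \<alpha> (\<lambda>l. a l y) k) x)
          \<le> C * (1 + norm (lattice_vec k)) powr (m - real (\<Sum>j\<in>UNIV. \<alpha> j))"
      using a unfolding symbols_def by blast
    obtain c where c: "0 < c" "\<And>k :: int ^ 'n. (1 + norm (lattice_vec k)) powr (m - real (\<Sum>j\<in>UNIV. \<alpha> j)) \<le> c * japanese k powr (m - real (\<Sum>j\<in>UNIV. \<alpha> j))"
      using powr_norm_le_japanese by blast
    have "cmod (D_multi \<beta> (\<lambda>y. multi_difference \<alpha> (\<lambda>l. a l y) k) x) \<le> (C * c) * japanese k powr (m - real (\<Sum>j\<in>UNIV. \<alpha> j))" for k x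
      using order_trans[OF C(2)[of k x] mult_left_mono[OF c(2)[of k] less_imp_le[OF C(1)]]] by (simp add: mult.assoc)
    thus ?thesis by blast
  qed
  have pos: "0 < japanese k powr s" for s and k :: "int ^ 'n" by simp
  have "torus_symbol (\<lambda>k. japanese k powr m) a"
    by (rule torus_symbol_if_D_multi_bounded[OF smooth_on_torus_torus_continuous[OF sm] smooth_on_torus_line_smooth[OF sm] _ pos])
       (use bound[of _ "\<lambda>_. 0"] in \<open>simp add: multi_difference_zero\<close>)
  moreover have "torus_symbol (\<lambda>k. japanese k powr m * inv_japanese k) (\<lambda>k x. a (k + axis i 1) x - a k x)" for i
  proof (rule torus_symbol_if_D_multi_bounded)
    show "torus_continuous (\<lambda>x. a (k + axis i 1) x - a k x)" for k by (intro torus_continuous_diff smooth_on_torus_torus_continuous sm)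
    show "line_smooth j (\<lambda>x. a (k + axis i 1) x - a k x)" for j k
      using line_smooth_lincomb[OF smooth_on_torus_line_smooth[OF sm] smooth_on_torus_line_smooth[OF sm], of j 1 "k + axis i 1" "- 1" k] by simp
    show "0 < japanese k powr m * inv_japanese k" for k :: "int ^ 'n" using pos by simp
    have eq: "japanese k powr (m - 1) = japanese k powr m * inv_japanese k" for k :: "int ^ 'n"
      by (simp add: powr_diff)
    show "\<exists>C. \<forall>k x. cmod (D_multi \<beta> (\<lambda>x. a (k + axis i 1) x - a k x) x) \<le> C * (japanese k powr m * inv_japanese k)" for \<beta>
      using bound[of \<beta> "\<lambda>j. if j = i then 1 else 0"] unfolding multi_difference_single
      by (simp add: difference_def eq)
  qed
  ultimately show ?thesis by (simp add: slow_torus_symbol_def)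
qed

lemma elliptic_symbols_matrix:
  fixes a :: "int ^ 'n::finite \<Rightarrow> real ^ 'n \<Rightarrow> complex"
  assumes a: "a \<in> elliptic_symbols m"
  obtains B B' R R' where "elliptic_matrix (\<lambda>k. japanese k powr m) (left_matrix a) B B' R R'"
proof -
  obtain C r where C: "0 < C" "\<And>k x. r < norm (lattice_vec k) \<Longrightarrow> C * (1 + norm (lattice_vec k)) powr m \<le> cmod (a k x)"
    using a unfolding elliptic_symbols_def by blast
  obtain c where c: "0 < c" "\<And>k :: int ^ 'n. c * japanese k powr m \<le> (1 + norm (lattice_vec k)) powr m"
    using powr_japanese_le_norm by blast
  let ?F = "{k :: int ^ 'n. japanese k \<le> r + 1}"
  have low: "(C * c) * japanese k powr m \<le> cmod (a k x)" if "k \<notin> ?F" for k x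
  proof -
    have "r < norm (lattice_vec k)" using that japanese_le_norm[of k] by simp
    thus ?thesis using C(2)[of k x] mult_left_mono[OF c(2)[of k] less_imp_le[OF C(1)]] by (simp add: mult.assoc)
  qed
  show thesis
    by (rule elliptic_matrix_if_bounded_below[OF moderate_powr symbols_slow_torus_symbol finite_japanese_ball _ low])
       (use a C(1) c(1) that in \<open>auto simp: elliptic_symbols_def\<close>)
qed

section \<open>The function spaces\<close>

lemma rapid_shift:
  assumes "u \<in> rapid" shows "(\<lambda>k. u (k + y)) \<in> rapid"
  unfolding rapid_def mem_Collect_eq
proof
  fix N
  obtain C where C: "0 \<le> C" "\<And>k. cmod (u k) \<le> C / japanese k ^ N" using rapidE[OF assms] by blast
  have "cmod (u (k + y)) \<le> (C * (2 ^ N * japanese y ^ N)) / japanese k ^ N" for k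
  proof -
    have "japanese k ^ N \<le> 2 ^ N * japanese (k + y) ^ N * japanese y ^ N"
      using japanese_peetre_power[of k N "k + y"] by simp
    hence "C * japanese k ^ N \<le> C * (2 ^ N * japanese (k + y) ^ N * japanese y ^ N)"
      using C(1) by (rule mult_left_mono)
    hence "C / japanese (k + y) ^ N \<le> (C * (2 ^ N * japanese y ^ N)) / japanese k ^ N"
      by (simp add: field_simps)
    thus ?thesis using C(2)[of "k + y"] by linarith
  qed
  thus "\<exists>C. \<forall>k. cmod (u (k + y)) \<le> C / japanese k ^ N" by blast
qed

lemma rapid_multi_difference:
  assumes "u \<in> rapid" shows "multi_difference \<beta> u \<in> rapid"
proof -
  have d: "difference j v \<in> rapid" if "v \<in> rapid" for j v
    using rapid_add[OF rapid_shift[OF that] rapid_smult[OF that, of "-1"]]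
    unfolding difference_def[abs_def] by simp
  have "(difference j ^^ n) v \<in> rapid" if "v \<in> rapid" for j n v
    using that by (induction n) (auto intro: d)
  hence "foldr (\<lambda>j. difference j ^^ \<beta> j) js u \<in> rapid" for js
    using assms by (induction js) auto
  thus ?thesis unfolding multi_difference_def .
qed

text \<open>Taking \<open>\<beta> = 0\<close> and a power of a single coordinate gives one inclusion; for the other, differences of
  rapidly decreasing functions are rapidly decreasing and monomials are bounded by powers of the
  bracket.\<close>

lemma schwartz_eq_rapid: "(schwartz :: (int ^ 'n::finite \<Rightarrow> complex) set) = rapid"
proof (intro equalityI subsetI)
  fix u :: "int ^ 'n \<Rightarrow> complex" assume u: "u \<in> schwartz"
  have ex: "\<exists>C. \<forall>k. cmod (of_int (\<Prod>j\<in>UNIV. (k $ j) ^ \<alpha> j) * u k) \<le> C" for \<alpha>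
  proof -
    have "bdd_above (range (\<lambda>k. cmod (of_int (\<Prod>j\<in>UNIV. (k $ j) ^ \<alpha> j) * multi_difference (\<lambda>_. 0) u k)))"
      using u unfolding schwartz_def mem_Collect_eq
      by (elim allE[where x = \<alpha>] allE[where x = "\<lambda>_. 0"])
    thus ?thesis unfolding multi_difference_zero bdd_above_def by blast
  qed
  show "u \<in> rapid"
    unfolding rapid_def mem_Collect_eq
  proof
    fix N
    have "\<exists>C. \<forall>k. \<bar>real_of_int (k $ j)\<bar> ^ N * cmod (u k) \<le> C" for j
    proof -
      have "(\<Prod>i\<in>UNIV. (k $ i) ^ (if i = j then N else 0)) = (k $ j) ^ N" for k :: "int ^ 'n"
      proof -
        have "(\<Prod>i\<in>UNIV. (k $ i) ^ (if i = j then N else 0)) = (\<Prod>i\<in>UNIV. if i = j then (k $ i) ^ N else 1)"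
          by (rule prod.cong) auto
        thus ?thesis by (simp add: prod.delta)
      qed
      with ex[of "\<lambda>i. if i = j then N else 0"] show ?thesis by (simp add: norm_mult norm_power)
    qed
    then obtain C where C: "\<And>j k. \<bar>real_of_int (k $ j)\<bar> ^ N * cmod (u k) \<le> C j" by metis
    obtain C' where C': "\<And>k. cmod (u k) \<le> C'" using ex[of "\<lambda>_. 0"] by auto
    have C'0: "0 \<le> C'" using order_trans[OF norm_ge_zero C'] .
    have C0: "0 \<le> C j" for j using order_trans[OF _ C[of 0 j]] by (smt (verit) mult_nonneg_nonneg norm_ge_zero zero_le_power abs_ge_zero)
    define D where "D = C' + (\<Sum>j\<in>UNIV. C j)"
    have D: "C j \<le> D" "C' \<le> D" for j
    proof -
      have "C j \<le> (\<Sum>j\<in>UNIV. C j)" using C0 by (intro member_le_sum) auto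
      thus "C j \<le> D" using C'0 by (simp add: D_def)
      show "C' \<le> D" using C0 by (simp add: D_def sum_nonneg)
    qed
    have "japanese k ^ N * cmod (u k) \<le> (real CARD('n) + 1) ^ N * D" for k
      by (rule japanese_power_le_coordinates) (auto intro: order_trans[OF C D(1)] order_trans[OF C' D(2)])
    hence "cmod (u k) \<le> ((real CARD('n) + 1) ^ N * D) / japanese k ^ N" for k
      by (simp add: field_simps)
    thus "\<exists>C. \<forall>k. cmod (u k) \<le> C / japanese k ^ N" by blast
  qed
next
  fix u :: "int ^ 'n \<Rightarrow> complex" assume u: "u \<in> rapid"
  show "u \<in> schwartz"
    unfolding schwartz_def mem_Collect_eq
  proof (intro allI)
    fix \<alpha> \<beta> :: "'n \<Rightarrow> nat"
    let ?N = "\<Sum>j\<in>UNIV. \<alpha> j"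
    obtain C where C: "\<And>k. cmod (multi_difference \<beta> u k) \<le> C / japanese k ^ ?N"
      using rapidE[OF rapid_multi_difference[OF u, of \<beta>]] by metis
    have "cmod (of_int (\<Prod>j\<in>UNIV. (k $ j) ^ \<alpha> j) * multi_difference \<beta> u k) \<le> C" for k
    proof -
      have "cmod (of_int (\<Prod>j\<in>UNIV. (k $ j) ^ \<alpha> j)) = (\<Prod>j\<in>UNIV. \<bar>real_of_int (k $ j)\<bar> ^ \<alpha> j)"
        by (simp add: prod_norm[symmetric] norm_power)
      also have "\<dots> \<le> (\<Prod>j\<in>UNIV. japanese k ^ \<alpha> j)"
        using component_le_norm_cart[of "lattice_vec k"] norm_le_japanese[of k]
        by (intro prod_mono) (auto intro!: power_mono intro: order_trans)
      also have "\<dots> = japanese k ^ ?N" by (simp add: power_sum)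
      finally have "cmod (of_int (\<Prod>j\<in>UNIV. (k $ j) ^ \<alpha> j)) * cmod (multi_difference \<beta> u k) \<le> japanese k ^ ?N * (C / japanese k ^ ?N)"
        using C[of k] by (intro mult_mono) auto
      thus ?thesis by (simp add: norm_mult)
    qed
    thus "bdd_above (range (\<lambda>k. cmod (of_int (\<Prod>j\<in>UNIV. (k $ j) ^ \<alpha> j) * multi_difference \<beta> u k)))"
      by (auto simp: bdd_above_def)
  qed
qed

lemma H_set_eq_wl2:
  assumes "moderate (\<lambda>k :: int ^ 'n::finite. \<phi> (japanese k))"
  shows "H_set \<phi> = wl2 (\<lambda>k :: int ^ 'n. \<phi> (japanese k))"
proof -
  have "cmod (of_real (\<phi> (japanese k)) * u k) = \<phi> (japanese k) * cmod (u k)" for u and k :: "int ^ 'n"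
    using moderate_pos[OF assms, of k] by (simp add: norm_mult)
  thus ?thesis
    using wl2_subset_tempered[OF assms] unfolding H_set_def ell2_def by (auto simp: wl2_def)
qed

lemma H_sobolev_eq_H_set: "H_sobolev s = H_set (\<lambda>t. t powr s)"
  by (simp add: H_sobolev_def H_set_def)

lemma H_infinity_eq_rapid: "(H_infinity :: (int ^ 'n::finite \<Rightarrow> complex) set) = rapid"
proof -
  have *: "H_sobolev s = wl2 (\<lambda>k :: int ^ 'n. japanese k powr s)" for s
    unfolding H_sobolev_eq_H_set by (rule H_set_eq_wl2[OF moderate_powr])
  have "u \<in> rapid" if "\<forall>s. u \<in> wl2 (\<lambda>k :: int ^ 'n. japanese k powr s)" for u
  proof (rule rapid_if_wl2_all[OF moderate_const[of 1]])
    show "u \<in> wl2 (\<lambda>k. 1 * japanese k ^ j)" for j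
      using that[rule_format, of "real j"] by (simp add: powr_realpow)
  qed simp
  moreover have "rapid \<subseteq> wl2 (\<lambda>k :: int ^ 'n. japanese k powr s)" for s
    by (rule rapid_subset_wl2[OF moderate_powr])
  ultimately show ?thesis unfolding H_infinity_def * by auto
qed

lemma H_norm_eq_wnorm:
  assumes "u \<in> wl2 (\<lambda>k. \<phi> (japanese k))"
  shows "H_norm \<phi> u = wnorm (\<lambda>k. \<phi> (japanese k)) u"
proof -
  have "H_inner \<phi> u u = (\<Sum>\<^sub>\<infinity>k. complex_of_real ((\<phi> (japanese k) * cmod (u k))\<^sup>2))"
  proof -
    have "of_real ((\<phi> (japanese k))\<^sup>2) * u k * cnj (u k) = complex_of_real ((\<phi> (japanese k) * cmod (u k))\<^sup>2)" for k
      unfolding power_mult_distrib of_real_mult complex_norm_square by (simp add: mult.assoc)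
    thus ?thesis unfolding H_inner_def by simp
  qed
  also have "\<dots> = complex_of_real (\<Sum>\<^sub>\<infinity>k. (\<phi> (japanese k) * cmod (u k))\<^sup>2)"
    by (rule infsumI[OF has_sum_of_real[OF has_sum_infsum[OF wl2D[OF assms]]]])
  finally show ?thesis by (simp add: H_norm_def wnorm_def l2n_def)
qed

lemma RO_pos: "\<phi> \<in> RO \<Longrightarrow> 1 \<le> t \<Longrightarrow> 0 < \<phi> t"
  by (simp add: RO_def)

text \<open>Moving from \<open>t\<close> to \<open>s\<close> in \<open>N\<close> steps with ratio at most \<open>a\<close> costs a factor \<open>c\<close> for each step.\<close>

lemma RO_power_growth:
  assumes "\<phi> \<in> RO"
  obtains a c where "1 < a" "1 \<le> c"
    "\<And>N s t. 1 \<le> t \<Longrightarrow> t \<le> s \<Longrightarrow> s \<le> a ^ N * t \<Longrightarrow> \<phi> s \<le> c ^ N * \<phi> t \<and> \<phi> t \<le> c ^ N * \<phi> s"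
proof -
  obtain a c where a: "1 < a" "1 \<le> c" "\<And>t l. 1 \<le> t \<Longrightarrow> l \<in> {1..a} \<Longrightarrow>
        inverse c \<le> \<phi> (l * t) / \<phi> t \<and> \<phi> (l * t) / \<phi> t \<le> c"
    using assms unfolding RO_def by blast
  have one: "\<phi> s \<le> c * \<phi> t \<and> \<phi> t \<le> c * \<phi> s" if st: "1 \<le> t" "t \<le> s" "s \<le> a * t" for s t
  proof -
    have "s / t \<in> {1..a}" using st by (auto simp: field_simps)
    from a(3)[OF st(1) this] have "inverse c \<le> \<phi> s / \<phi> t \<and> \<phi> s / \<phi> t \<le> c" using st(1) by simp
    thus ?thesis using RO_pos[OF assms st(1)] a(2) by (simp add: field_simps)
  qed
  have "\<phi> s \<le> c ^ N * \<phi> t \<and> \<phi> t \<le> c ^ N * \<phi> s" if "1 \<le> t" "t \<le> s" "s \<le> a ^ N * t" for N s t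
    using that
  proof (induction N arbitrary: s)
    case (Suc N)
    define s' where "s' = max t (s / a)"
    have sa: "s / a \<le> s" "s / a \<le> a ^ N * t" using Suc.prems a(1) by (simp_all add: divide_le_eq mult_ac)
    have "1 * t \<le> a ^ N * t" using a(1) Suc.prems(1) by (intro mult_right_mono one_le_power) auto
    hence s': "1 \<le> s'" "t \<le> s'" "s' \<le> s" "s' \<le> a ^ N * t"
      using Suc.prems sa by (auto simp: s'_def)
    have "s / a \<le> s'" by (simp add: s'_def)
    hence s'': "s \<le> a * s'" using a(1) by (simp add: divide_le_eq mult_ac)
    from Suc.IH[OF Suc.prems(1) s'(2,4)] have IH: "\<phi> s' \<le> c ^ N * \<phi> t" "\<phi> t \<le> c ^ N * \<phi> s'" by auto
    from one[OF s'(1,3) s''] have st: "\<phi> s \<le> c * \<phi> s'" "\<phi> s' \<le> c * \<phi> s" by auto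
    have "\<phi> s \<le> c * (c ^ N * \<phi> t)" using st(1) mult_left_mono[OF IH(1), of c] a(2) by linarith
    moreover have "\<phi> t \<le> c ^ N * (c * \<phi> s)" using IH(2) mult_left_mono[OF st(2), of "c ^ N"] a(2) by (meson order_trans zero_le_power zero_le_one)
    ultimately show ?case by (simp add: mult_ac)
  qed (auto intro: antisym)
  with a(1,2) that show thesis by blast
qed

text \<open>The ratio of two brackets is at most \<open>2 * \<langle>k - l\<rangle>\<close>, so the number \<open>N\<close> of steps is logarithmic in
  \<open>\<langle>k - l\<rangle>\<close> and the factor \<open>c ^ N\<close> is at most a power of it.\<close>

lemma RO_moderate:
  assumes "\<phi> \<in> RO"
  shows "moderate (\<lambda>k :: int ^ 'n::finite. \<phi> (japanese k))"
proof -
  obtain a c where a: "1 < a" "1 \<le> c"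
    "\<And>N s t. 1 \<le> t \<Longrightarrow> t \<le> s \<Longrightarrow> s \<le> a ^ N * t \<Longrightarrow> \<phi> s \<le> c ^ N * \<phi> t \<and> \<phi> t \<le> c ^ N * \<phi> s"
    using RO_power_growth[OF assms] by blast
  obtain M where M: "c < a ^ M" using real_arch_pow[OF a(1)] by blast
  have "\<phi> (japanese k) \<le> (a * 2) ^ M * japanese (k - l) ^ M * \<phi> (japanese l)" for k l :: "int ^ 'n"
  proof -
    let ?x = "2 * japanese (k - l)"
    have x1: "1 < ?x" using japanese_ge_1[of "k - l"] by linarith
    obtain N0 where "?x < a ^ N0" using real_arch_pow[OF a(1)] by blast
    define N where "N = (LEAST N. ?x \<le> a ^ N)"
    have N: "?x \<le> a ^ N" unfolding N_def by (rule LeastI[of _ N0]) (use \<open>?x < a ^ N0\<close> in simp)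
    have "N \<noteq> 0" using N x1 by (auto intro: ccontr)
    then obtain N' where N': "N = Suc N'" by (cases N) auto
    have "\<not> ?x \<le> a ^ N'" by (rule not_less_Least) (simp add: N_def[symmetric] N')
    hence aN: "a ^ N \<le> a * ?x" using a(1) by (simp add: N')
    have "\<phi> (japanese k) \<le> c ^ N * \<phi> (japanese l)"
    proof (cases "japanese l \<le> japanese k")
      case True
      have "japanese k \<le> ?x * japanese l" using japanese_peetre[of k l] by (simp add: mult_ac)
      also have "\<dots> \<le> a ^ N * japanese l" by (intro mult_right_mono N) simp
      finally show ?thesis using a(3)[OF japanese_ge_1 True] by blast
    next
      case False
      hence le: "japanese k \<le> japanese l" by simp
      have "japanese l \<le> ?x * japanese k" using japanese_peetre[of l k] by (simp add: mult_ac japanese_diff_commute)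
      also have "\<dots> \<le> a ^ N * japanese k" by (intro mult_right_mono N) simp
      finally show ?thesis using a(3)[OF japanese_ge_1 le] by blast
    qed
    also have "c ^ N * \<phi> (japanese l) \<le> (a * ?x) ^ M * \<phi> (japanese l)"
    proof (rule mult_right_mono)
      have "c ^ N \<le> (a ^ M) ^ N" using M a(2) by (intro power_mono) auto
      also have "\<dots> = (a ^ N) ^ M" by (simp add: power_mult[symmetric] mult.commute)
      also have "\<dots> \<le> (a * ?x) ^ M" using a(1) by (intro power_mono aN) auto
      finally show "c ^ N \<le> (a * ?x) ^ M" .
      show "0 \<le> \<phi> (japanese l)" using RO_pos[OF assms, of "japanese l"] by simp
    qed
    finally show ?thesis by (simp add: power_mult_distrib mult_ac)
  qed
  thus ?thesis using RO_pos[OF assms] by (intro moderateI[where C = "(a * 2) ^ M" and M = M]) auto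
qed

section \<open>The operators as matrices\<close>

definition delta :: "int ^ 'n::finite \<Rightarrow> int ^ 'n \<Rightarrow> complex" where
  "delta l k = (if k = l then 1 else 0)"

lemma delta_rapid: "delta l \<in> rapid"
  by (rule finite_support_rapid[of "{l}"]) (auto simp: delta_def)

lemma ell2_form_delta: "ell2_form u (delta l) = u l" "ell2_form (delta l) u = cnj (u l)"
proof -
  have "ell2_form u (delta l) = (\<Sum>\<^sub>\<infinity>k\<in>{l}. u k * cnj (delta l k))"
    unfolding ell2_form_def by (rule infsum_cong_neutral) (auto simp: delta_def)
  thus "ell2_form u (delta l) = u l" by (simp add: delta_def)
  thus "ell2_form (delta l) u = cnj (u l)" by (subst ell2_form_cnj) simp
qed

text \<open>The series of \<open>fourier u\<close> converges uniformly and may be integrated term by term.\<close>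

lemma pdo_eq_mat_apply:
  fixes a :: "int ^ 'n::finite \<Rightarrow> real ^ 'n \<Rightarrow> complex"
  assumes a: "torus_continuous (a k)" and u: "u \<in> rapid"
  shows "pdo a u k = mat_apply (left_matrix a) u k"
proof -
  obtain B where B: "0 \<le> B" "\<And>x. x \<in> cbox 0 1 \<Longrightarrow> cmod (a k x) \<le> B"
  proof -
    have "bounded (a k ` cbox 0 1)" by (intro compact_imp_bounded compact_continuous_image torus_continuous_continuous a compact_cbox)
    thus thesis using that unfolding bounded_pos by (auto intro: less_imp_le)
  qed
  obtain C where C: "0 \<le> C" "\<And>k. cmod (u k) \<le> C / japanese k ^ (2 * CARD('n))" using rapidE[OF u] by blast
  let ?F = "\<lambda>l x. u l * (echar (k - l) x * a k x)"
  have M: "(\<lambda>l :: int ^ 'n. C * B * (1 / japanese l ^ (2 * CARD('n)))) summable_on UNIV"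
    by (intro summable_on_cmult_right summable_japanese)
  have le: "cmod (?F l x) \<le> C * B * (1 / japanese l ^ (2 * CARD('n)))" if "x \<in> cbox 0 1" for l x
    using mult_mono[OF C(2)[of l] B(2)[OF that]] C(1) by (simp add: norm_mult)
  have "((\<lambda>l. integral (cbox 0 1) (?F l)) has_sum integral (cbox 0 1) (\<lambda>x. \<Sum>\<^sub>\<infinity>l. ?F l x)) UNIV"
    by (rule integral_infsum_cube[OF _ le M]) (intro continuous_intros torus_continuous_continuous[OF a])
  moreover have "integral (cbox 0 1) (?F l) = left_matrix a k l * u l" for l
    by (simp add: left_matrix_def fourier_coef_def mult.commute)
  moreover have "(\<Sum>\<^sub>\<infinity>l. ?F l x) = exp (2 * pi * \<i> * of_real (lattice_vec k \<bullet> x)) * a k x * fourier u x" for x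
  proof -
    have "(\<Sum>\<^sub>\<infinity>l. ?F l x) = (\<Sum>\<^sub>\<infinity>l. (echar k x * a k x) * (exp (- 2 * pi * \<i> * of_real (lattice_vec l \<bullet> x)) * u l))"
    proof (rule infsum_cong)
      fix l
      have "echar (k - l) x = echar k x * exp (- 2 * pi * \<i> * of_real (lattice_vec l \<bullet> x))"
        using echar_add[of k "- l" x] by (simp add: echar_def)
      thus "?F l x = (echar k x * a k x) * (exp (- 2 * pi * \<i> * of_real (lattice_vec l \<bullet> x)) * u l)"
        by (simp add: mult_ac)
    qed
    also have "\<dots> = (echar k x * a k x) * fourier u x"
      unfolding fourier_def by (rule infsum_cmult_right')
    finally show ?thesis by (simp add: echar_def)
  qed
  ultimately have "((\<lambda>l. left_matrix a k l * u l) has_sum pdo a u k) UNIV" by (simp only: pdo_def)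
  thus ?thesis unfolding mat_apply_def by (rule infsumI[symmetric])
qed

text \<open>The adjoint matrix satisfies the defining identity, and testing with the functions \<open>delta l\<close> shows
  that nothing else does.\<close>

lemma formal_adjoint_pdo:
  fixes a :: "int ^ 'n::finite \<Rightarrow> real ^ 'n \<Rightarrow> complex"
  assumes q: "moderate q" and a: "torus_symbol q a" and v: "v \<in> rapid"
  shows "formal_adjoint (pdo a) v = mat_apply (adj (left_matrix a)) v"
  unfolding formal_adjoint_def schwartz_eq_rapid
proof (rule the_equality)
  note K = left_matrix_decay[OF a q]
  have pdo: "pdo a u = mat_apply (left_matrix a) u" if "u \<in> rapid" for u
    using pdo_eq_mat_apply[OF _ that] a by (auto simp: torus_symbol_def)
  have form: "ell2_form (pdo a u) v = ell2_form u (mat_apply (adj (left_matrix a)) v)" if "u \<in> rapid" for u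
    unfolding pdo[OF that] using that rapid_subset_tempered by (intro ell2_form_mat_apply[OF K q _ v]) auto
  show "mat_apply (adj (left_matrix a)) v \<in> rapid \<and> (\<forall>u\<in>rapid. ell2_form (pdo a u) v = ell2_form u (mat_apply (adj (left_matrix a)) v))"
    using form mat_apply_rapid[OF decay_adj[OF K q] q v] by blast
  fix w assume "w \<in> rapid \<and> (\<forall>u\<in>rapid. ell2_form (pdo a u) v = ell2_form u w)"
  hence "ell2_form (delta l) w = ell2_form (delta l) (mat_apply (adj (left_matrix a)) v)" for l
    using form[OF delta_rapid[of l]] delta_rapid[of l] by metis
  thus "w = mat_apply (adj (left_matrix a)) v" unfolding ell2_form_delta by (simp add: fun_eq_iff)
qed

text \<open>The defining identity of the extension is again the identity for the adjoint matrix, now between a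
  tempered and a rapidly decreasing function.\<close>

lemma T_op_eq_mat_apply:
  fixes a :: "int ^ 'n::finite \<Rightarrow> real ^ 'n \<Rightarrow> complex"
  assumes q: "moderate q" and a: "torus_symbol q a" and F: "F \<in> tempered"
  shows "T_op a F = mat_apply (left_matrix a) F"
  unfolding tempered_extension_def schwartz_eq_rapid
proof (rule the_equality)
  note K = left_matrix_decay[OF a q]
  have form: "dist_apply (mat_apply (left_matrix a) F) (\<lambda>k. cnj (u k)) = dist_apply F (\<lambda>k. cnj (formal_adjoint (pdo a) u k))"
    if "u \<in> rapid" for u
    using ell2_form_mat_apply[OF K q F that]
    unfolding formal_adjoint_pdo[OF q a that] dist_apply_def ell2_form_def .
  thus "mat_apply (left_matrix a) F \<in> tempered \<and> (\<forall>u\<in>rapid. dist_apply (mat_apply (left_matrix a) F) (\<lambda>k. cnj (u k)) =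
      dist_apply F (\<lambda>k. cnj (formal_adjoint (pdo a) u k)))"
    using mat_apply_tempered[OF K q F] by blast
  fix G assume "G \<in> tempered \<and> (\<forall>u\<in>rapid. dist_apply G (\<lambda>k. cnj (u k)) = dist_apply F (\<lambda>k. cnj (formal_adjoint (pdo a) u k)))"
  hence "dist_apply G (\<lambda>k. cnj (delta l k)) = dist_apply (mat_apply (left_matrix a) F) (\<lambda>k. cnj (delta l k))" for l
    using form[OF delta_rapid[of l]] delta_rapid[of l] by metis
  thus "G = mat_apply (left_matrix a) F"
    unfolding dist_apply_def ell2_form_def[symmetric] ell2_form_delta by (simp add: fun_eq_iff)
qed

section \<open>The duality as a sum\<close>

text \<open>Density of the rapidly decreasing functions, by cutting off at a large radius.  It makes the limit in
  the definition of \<open>duality\<close> unique.\<close>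

lemma truncation_converges:
  fixes u :: "int ^ 'n::finite \<Rightarrow> complex"
  assumes p: "moderate p" and u: "u \<in> wl2 p"
  defines "\<sigma> \<equiv> \<lambda>(i::nat) k. if japanese k \<le> real i then u k else 0"
  shows "\<sigma> i \<in> rapid" "(\<lambda>i. wnorm p (\<lambda>k. \<sigma> i k - u k)) \<longlonglongrightarrow> 0"
proof -
  show "\<sigma> i \<in> rapid"
    by (rule finite_support_rapid[OF finite_japanese_ball[of "real i"]]) (simp add: \<sigma>_def)
  let ?F = "\<lambda>k. (p k * cmod (u k))\<^sup>2"
  have s: "?F summable_on UNIV" by (rule wl2D[OF u])
  show "(\<lambda>i. wnorm p (\<lambda>k. \<sigma> i k - u k)) \<longlonglongrightarrow> 0"
  proof (rule LIMSEQ_I)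
    fix e :: real assume e: "0 < e"
    obtain A where A: "finite A" "dist (sum ?F A) (infsum ?F UNIV) \<le> e\<^sup>2 / 2"
      using infsum_finite_approximation[OF s, of "e\<^sup>2 / 2"] e by auto
    obtain n where n: "\<And>k. k \<in> A \<Longrightarrow> japanese k \<le> real n"
    proof -
      have "japanese k \<le> (\<Sum>k\<in>A. japanese k)" if "k \<in> A" for k using A(1) that by (intro member_le_sum) auto
      thus thesis using that[of "nat \<lceil>\<Sum>k\<in>A. japanese k\<rceil>"] real_nat_ceiling_ge order_trans by blast
    qed
    have "wnorm p (\<lambda>k. \<sigma> i k - u k) < e" if "n \<le> i" for i
    proof -
      have "(\<Sum>\<^sub>\<infinity>k. (p k * cmod (\<sigma> i k - u k))\<^sup>2) \<le> e\<^sup>2 / 2"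
      proof -
        have sub: "?F summable_on (UNIV - A)" by (rule summable_on_subset_banach[OF s]) auto
        have "(\<Sum>\<^sub>\<infinity>k. (p k * cmod (\<sigma> i k - u k))\<^sup>2) \<le> infsum ?F (UNIV - A)"
        proof -
          have ni: "japanese k \<le> real i" if "k \<in> A" for k
            using n[OF that] \<open>n \<le> i\<close> by (meson of_nat_le_iff order_trans)
          show ?thesis
          proof (rule infsum_mono_neutral[OF _ sub])
          show "(\<lambda>k. (p k * cmod (\<sigma> i k - u k))\<^sup>2) summable_on UNIV"
            by (rule summable_on_comparison_test[OF s]) (auto simp: \<sigma>_def)
          qed (use ni in \<open>auto simp: \<sigma>_def\<close>)
        qed
        also have "\<dots> = infsum ?F UNIV - sum ?F A"
          using infsum_Diff[OF s, of A] A(1) by simp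
        also have "\<dots> \<le> e\<^sup>2 / 2" using A(2) unfolding dist_real_def by linarith
        finally show ?thesis .
      qed
      also have "\<dots> < e\<^sup>2" using e by simp
      finally show ?thesis using e unfolding wnorm_def l2n_def by (simp add: real_less_lsqrt)
    qed
    thus "\<exists>n. \<forall>i\<ge>n. norm (wnorm p (\<lambda>k. \<sigma> i k - u k) - 0) < e" by auto
  qed
qed

lemma duality_eq_ell2_form:
  fixes u v :: "int ^ 'n::finite \<Rightarrow> complex"
  assumes \<eta>: "moderate (\<lambda>k :: int ^ 'n. \<eta> (japanese k))" and u: "u \<in> wl2 (\<lambda>k. \<eta> (japanese k))"
    and v: "v \<in> wl2 (\<lambda>k. 1 / \<eta> (japanese k))"
  shows "duality \<eta> u v = ell2_form u v"
  unfolding duality_def schwartz_eq_rapid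
proof (rule the_equality)
  let ?p = "\<lambda>k :: int ^ 'n. \<eta> (japanese k)"
  let ?p' = "\<lambda>k :: int ^ 'n. 1 / \<eta> (japanese k)"
  have p': "moderate ?p'" by (rule moderate_inverse[OF \<eta>])
  note pos = moderate_pos[OF \<eta>] and pos' = moderate_pos[OF p']
  show lim: "\<forall>\<sigma> \<tau>. range \<sigma> \<subseteq> rapid \<longrightarrow> range \<tau> \<subseteq> rapid \<longrightarrow>
     (\<lambda>i. H_norm \<eta> (\<lambda>k. \<sigma> i k - u k)) \<longlonglongrightarrow> 0 \<longrightarrow>
     (\<lambda>i. H_norm (\<lambda>t. 1 / \<eta> t) (\<lambda>k. \<tau> i k - v k)) \<longlonglongrightarrow> 0 \<longrightarrow>
     (\<lambda>i. ell2_form (\<sigma> i) (\<tau> i)) \<longlonglongrightarrow> ell2_form u v"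
  proof (intro allI impI)
    fix \<sigma> \<tau> :: "nat \<Rightarrow> int ^ 'n \<Rightarrow> complex"
    assume \<sigma>: "range \<sigma> \<subseteq> rapid" and \<tau>: "range \<tau> \<subseteq> rapid"
      and \<sigma>u: "(\<lambda>i. H_norm \<eta> (\<lambda>k. \<sigma> i k - u k)) \<longlonglongrightarrow> 0"
      and \<tau>v: "(\<lambda>i. H_norm (\<lambda>t. 1 / \<eta> t) (\<lambda>k. \<tau> i k - v k)) \<longlonglongrightarrow> 0"
    have \<sigma>m: "\<sigma> i \<in> wl2 ?p" and \<tau>m: "\<tau> i \<in> wl2 ?p'" for i
      using \<sigma> \<tau> rapid_subset_wl2[OF \<eta>] rapid_subset_wl2[OF p'] by blast+
    note du = wl2_diff(1)[OF pos \<sigma>m u] and dv = wl2_diff(1)[OF pos' \<tau>m v]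
    let ?s = "\<lambda>i. wnorm ?p (\<lambda>k. \<sigma> i k - u k)" and ?t = "\<lambda>i. wnorm ?p' (\<lambda>k. \<tau> i k - v k)"
    have s: "?s \<longlonglongrightarrow> 0" using \<sigma>u by (simp add: H_norm_eq_wnorm[OF du])
    have t: "?t \<longlonglongrightarrow> 0" using \<tau>v by (simp add: H_norm_eq_wnorm[OF dv])
    have bound: "cmod (ell2_form (\<sigma> i) (\<tau> i) - ell2_form u v) \<le> ?s i * (?t i + wnorm ?p' v) + wnorm ?p u * ?t i" for i
    proof -
      have "ell2_form (\<sigma> i) (\<tau> i) - ell2_form u v =
          ell2_form (\<lambda>k. \<sigma> i k - u k) (\<tau> i) + ell2_form u (\<lambda>k. \<tau> i k + (- 1) * v k)"
        unfolding ell2_form_diff_left[OF pos \<sigma>m u \<tau>m] ell2_form_linear_right[OF pos u \<tau>m v] by simp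
      also have "cmod \<dots> \<le> ?s i * wnorm ?p' (\<tau> i) + wnorm ?p u * ?t i"
        using wl2_pair(2)[OF pos du \<tau>m] wl2_pair(2)[OF pos u dv]
        by (intro order_trans[OF norm_triangle_ineq] add_mono) auto
      also have "wnorm ?p' (\<tau> i) \<le> ?t i + wnorm ?p' v"
        using wl2_add(2)[OF pos' dv v] by simp
      finally show ?thesis by (simp add: mult_left_mono)
    qed
    have "(\<lambda>i. ?s i * (?t i + wnorm ?p' v) + wnorm ?p u * ?t i) \<longlonglongrightarrow> 0 * (0 + wnorm ?p' v) + wnorm ?p u * 0"
      by (intro tendsto_intros s t)
    hence "(\<lambda>i. ?s i * (?t i + wnorm ?p' v) + wnorm ?p u * ?t i) \<longlonglongrightarrow> 0" by simp
    hence "(\<lambda>i. ell2_form (\<sigma> i) (\<tau> i) - ell2_form u v) \<longlonglongrightarrow> 0"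
      by (rule Lim_null_comparison[OF always_eventually[OF allI[OF bound]]])
    thus "(\<lambda>i. ell2_form (\<sigma> i) (\<tau> i)) \<longlonglongrightarrow> ell2_form u v" by (simp add: LIM_zero_iff)
  qed
  fix z assume z: "\<forall>\<sigma> \<tau>. range \<sigma> \<subseteq> rapid \<longrightarrow> range \<tau> \<subseteq> rapid \<longrightarrow>
     (\<lambda>i. H_norm \<eta> (\<lambda>k. \<sigma> i k - u k)) \<longlonglongrightarrow> 0 \<longrightarrow>
     (\<lambda>i. H_norm (\<lambda>t. 1 / \<eta> t) (\<lambda>k. \<tau> i k - v k)) \<longlonglongrightarrow> 0 \<longrightarrow>
     (\<lambda>i. ell2_form (\<sigma> i) (\<tau> i)) \<longlonglongrightarrow> z"
  define \<sigma> where "\<sigma> = (\<lambda>(i::nat) k. if japanese k \<le> real i then u k else 0)"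
  define \<tau> where "\<tau> = (\<lambda>(i::nat) k. if japanese k \<le> real i then v k else 0)"
  have tu: "\<sigma> i \<in> rapid" "(\<lambda>i. wnorm ?p (\<lambda>k. \<sigma> i k - u k)) \<longlonglongrightarrow> 0" for i
    unfolding \<sigma>_def by (rule truncation_converges[OF \<eta> u])+
  have tv: "\<tau> i \<in> rapid" "(\<lambda>i. wnorm ?p' (\<lambda>k. \<tau> i k - v k)) \<longlonglongrightarrow> 0" for i
    unfolding \<tau>_def by (rule truncation_converges[OF p' v])+
  have du: "(\<lambda>k. \<sigma> i k - u k) \<in> wl2 ?p" and dv: "(\<lambda>k. \<tau> i k - v k) \<in> wl2 ?p'" for i
    using wl2_diff(1)[OF pos subsetD[OF rapid_subset_wl2[OF \<eta>] tu(1)] u]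
      wl2_diff(1)[OF pos' subsetD[OF rapid_subset_wl2[OF p'] tv(1)] v] by blast+
  have 1: "range \<sigma> \<subseteq> rapid" "range \<tau> \<subseteq> rapid" using tu(1) tv(1) by auto
  have 2: "(\<lambda>i. H_norm \<eta> (\<lambda>k. \<sigma> i k - u k)) \<longlonglongrightarrow> 0" using tu(2) by (simp add: H_norm_eq_wnorm[OF du])
  have 3: "(\<lambda>i. H_norm (\<lambda>t. 1 / \<eta> t) (\<lambda>k. \<tau> i k - v k)) \<longlonglongrightarrow> 0" using tv(2) by (simp add: H_norm_eq_wnorm[OF dv])
  show "z = ell2_form u v"
    using LIMSEQ_unique z[rule_format, OF 1 2 3] lim[rule_format, OF 1 2 3] by blast
qed

section \<open>Vector spaces of functions\<close>

lemma complex_field_simps [simp]: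
  "carrier complex_field = UNIV" "x \<otimes>\<^bsub>complex_field\<^esub> y = x * y" "x \<oplus>\<^bsub>complex_field\<^esub> y = x + y"
  "\<one>\<^bsub>complex_field\<^esub> = 1" "\<zero>\<^bsub>complex_field\<^esub> = 0"
  by (simp_all add: complex_field_def)

lemma field_complex_field: "field complex_field"
proof -
  have "\<exists>y. y + x = 0" for x :: complex by (rule exI[of _ "- x"]) simp
  hence "abelian_group complex_field" by (intro abelian_groupI) auto
  moreover have "comm_monoid complex_field" by (intro comm_monoidI) auto
  ultimately have "cring complex_field" by (intro cringI) (auto simp: distrib_right)
  moreover have "\<exists>b. a * b = 1" if "a \<noteq> 0" for a :: complex using that by (intro exI[of _ "inverse a"]) simp
  ultimately show ?thesis by (intro cring.cring_fieldI2) auto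
qed

text \<open>The operations are those of functions; the carrier and further fields of the record are arbitrary.
  The spaces \<open>fun_space\<close>, the spaces \<open>H_space\<close> and their restrictions to subsets are of this kind.\<close>

definition function_module :: "(complex, 'i \<Rightarrow> complex, 'e) module_scheme \<Rightarrow> bool" where
  "function_module V \<longleftrightarrow> \<zero>\<^bsub>V\<^esub> = (\<lambda>k. 0) \<and> (\<forall>u v. u \<oplus>\<^bsub>V\<^esub> v = (\<lambda>k. u k + v k)) \<and>
     (\<forall>c u. c \<odot>\<^bsub>V\<^esub> u = (\<lambda>k. c * u k))"

definition linear_set :: "('i \<Rightarrow> complex) set \<Rightarrow> bool" where
  "linear_set U \<longleftrightarrow> (\<lambda>k. 0) \<in> U \<and> (\<forall>u\<in>U. \<forall>v\<in>U. \<forall>c. (\<lambda>k. u k + c * v k) \<in> U)"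

lemma linear_setD:
  assumes "linear_set U"
  shows "(\<lambda>k. 0) \<in> U" "u \<in> U \<Longrightarrow> v \<in> U \<Longrightarrow> (\<lambda>k. u k + c * v k) \<in> U"
  using assms by (simp_all add: linear_set_def)

lemma linear_set_add: "linear_set U \<Longrightarrow> u \<in> U \<Longrightarrow> v \<in> U \<Longrightarrow> (\<lambda>k. u k + v k) \<in> U"
  using linear_setD(2)[of U u v 1] by simp

lemma linear_set_smult: "linear_set U \<Longrightarrow> u \<in> U \<Longrightarrow> (\<lambda>k. c * u k) \<in> U"
  using linear_setD(2)[of U "\<lambda>k. 0" u c] linear_setD(1)[of U] by simp

lemma linear_set_diff: "linear_set U \<Longrightarrow> u \<in> U \<Longrightarrow> v \<in> U \<Longrightarrow> (\<lambda>k. u k - v k) \<in> U"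
  using linear_set_add[OF _ _ linear_set_smult, of U u v "-1"] by simp

lemma function_module_vectorspace:
  assumes V: "function_module V" and U: "linear_set (carrier V)"
  shows "vectorspace complex_field V"
proof (rule vs_criteria[OF field_complex_field])
  have ops: "\<zero>\<^bsub>V\<^esub> = (\<lambda>k. 0)" "u \<oplus>\<^bsub>V\<^esub> v = (\<lambda>k. u k + v k)" "c \<odot>\<^bsub>V\<^esub> u = (\<lambda>k. c * u k)" for u v c
    using V by (auto simp: function_module_def)
  show "\<zero>\<^bsub>V\<^esub> \<in> carrier V" using U by (simp add: ops linear_set_def)
  show "\<forall>v\<in>carrier V. \<exists>w\<in>carrier V. v \<oplus>\<^bsub>V\<^esub> w = \<zero>\<^bsub>V\<^esub>"
  proof
    fix v assume "v \<in> carrier V"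
    from linear_set_smult[OF U this, of "-1"] show "\<exists>w\<in>carrier V. v \<oplus>\<^bsub>V\<^esub> w = \<zero>\<^bsub>V\<^esub>"
      by (intro bexI[of _ "\<lambda>k. - 1 * v k"]) (auto simp: ops)
  qed
qed (use V linear_set_add[OF U] linear_set_smult[OF U] in \<open>auto simp: function_module_def algebra_simps\<close>)

lemma function_module_uminus:
  assumes V: "function_module V" and U: "linear_set (carrier V)" and v: "v \<in> carrier V"
  shows "u \<ominus>\<^bsub>V\<^esub> v = (\<lambda>k. u k - v k)"
proof -
  interpret vectorspace complex_field V by (rule function_module_vectorspace[OF V U])
  have "\<ominus>\<^bsub>V\<^esub> v = (\<lambda>k. - 1 * v k)"
    by (rule M.minus_equality[OF _ v linear_set_smult[OF U v]]) (use V in \<open>simp add: function_module_def\<close>)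
  thus ?thesis unfolding a_minus_def using V by (simp add: function_module_def)
qed

lemma linear_mapI:
  assumes "vectorspace K V" "vectorspace K W" "T \<in> module_hom K V W"
  shows "linear_map K V W T"
  using assms unfolding linear_map_def mod_hom_def mod_hom_axioms_def vectorspace_def by blast

text \<open>The structure, finite dimension and the dimension are carried along a bijection that respects the
  operations.  The vector space axioms of the target come out as well, which is convenient for
  quotients.\<close>

lemma vectorspace_transport:
  assumes V: "vectorspace complex_field V" and bij: "bij_betw f (carrier V) (carrier W)"
    and zero: "f \<zero>\<^bsub>V\<^esub> = \<zero>\<^bsub>W\<^esub>"
    and add: "\<And>x y. x \<in> carrier V \<Longrightarrow> y \<in> carrier V \<Longrightarrow> f (x \<oplus>\<^bsub>V\<^esub> y) = f x \<oplus>\<^bsub>W\<^esub> f y"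
    and smult: "\<And>c x. x \<in> carrier V \<Longrightarrow> f (c \<odot>\<^bsub>V\<^esub> x) = c \<odot>\<^bsub>W\<^esub> f x"
    and findim: "vectorspace.fin_dim complex_field V"
  shows "vectorspace complex_field W" "vectorspace.fin_dim complex_field W"
    "vectorspace.dim complex_field W = vectorspace.dim complex_field V"
proof -
  interpret V: vectorspace complex_field V by (rule V)
  have im: "carrier W = f ` carrier V" and inj: "inj_on f (carrier V)"
    using bij by (auto simp: bij_betw_def)
  have mem: "f x \<in> carrier W" if "x \<in> carrier V" for x using that im by blast
  have ball: "(\<forall>w\<in>carrier W. P w) \<longleftrightarrow> (\<forall>x\<in>carrier V. P (f x))" for P by (auto simp: im)
  have cl: "c \<odot>\<^bsub>V\<^esub> x \<in> carrier V" if "x \<in> carrier V" for c x using V.smult_closed[of c x] that by simp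
  have W: "vectorspace complex_field W"
  proof (rule vs_criteria[OF field_complex_field])
    show "\<zero>\<^bsub>W\<^esub> \<in> carrier W" unfolding zero[symmetric] by (rule mem) simp
    show "\<forall>v w. v \<in> carrier W \<and> w \<in> carrier W \<longrightarrow> v \<oplus>\<^bsub>W\<^esub> w \<in> carrier W"
      by (auto simp: im add[symmetric] intro!: imageI)
    show "\<forall>v\<in>carrier W. \<exists>w\<in>carrier W. v \<oplus>\<^bsub>W\<^esub> w = \<zero>\<^bsub>W\<^esub>"
      unfolding ball
    proof
      fix x assume x: "x \<in> carrier V"
      show "\<exists>w\<in>carrier W. f x \<oplus>\<^bsub>W\<^esub> w = \<zero>\<^bsub>W\<^esub>"
        by (rule bexI[of _ "f (\<ominus>\<^bsub>V\<^esub> x)"]) (use x in \<open>simp_all add: add[symmetric] mem zero V.M.r_neg\<close>)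
    qed
    show "\<forall>c v. c \<in> carrier complex_field \<and> v \<in> carrier W \<longrightarrow> c \<odot>\<^bsub>W\<^esub> v \<in> carrier W"
      by (auto simp: im smult[symmetric] cl intro!: imageI)
    show "\<forall>v w. v \<in> carrier W \<and> w \<in> carrier W \<longrightarrow> v \<oplus>\<^bsub>W\<^esub> w = w \<oplus>\<^bsub>W\<^esub> v"
      by (auto simp: im add[symmetric] V.M.a_comm)
    show "\<forall>v w x. v \<in> carrier W \<and> w \<in> carrier W \<and> x \<in> carrier W \<longrightarrow> v \<oplus>\<^bsub>W\<^esub> w \<oplus>\<^bsub>W\<^esub> x = v \<oplus>\<^bsub>W\<^esub> (w \<oplus>\<^bsub>W\<^esub> x)"
      by (auto simp: im add[symmetric] V.M.a_assoc)
    show "\<forall>v\<in>carrier W. v \<oplus>\<^bsub>W\<^esub> \<zero>\<^bsub>W\<^esub> = v"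
      unfolding ball zero[symmetric] by (simp add: add[symmetric])
    show "\<forall>a b v. a \<in> carrier complex_field \<and> b \<in> carrier complex_field \<and> v \<in> carrier W \<longrightarrow>
       (a \<otimes>\<^bsub>complex_field\<^esub> b) \<odot>\<^bsub>W\<^esub> v = a \<odot>\<^bsub>W\<^esub> (b \<odot>\<^bsub>W\<^esub> v)"
      using V.smult_assoc1 by (auto simp: im smult[symmetric] cl)
    show "\<forall>v\<in>carrier W. \<one>\<^bsub>complex_field\<^esub> \<odot>\<^bsub>W\<^esub> v = v"
      unfolding ball using V.smult_one by (auto simp: smult[symmetric])
    show "\<forall>a b v. a \<in> carrier complex_field \<and> b \<in> carrier complex_field \<and> v \<in> carrier W \<longrightarrow>
       (a \<oplus>\<^bsub>complex_field\<^esub> b) \<odot>\<^bsub>W\<^esub> v = a \<odot>\<^bsub>W\<^esub> v \<oplus>\<^bsub>W\<^esub> b \<odot>\<^bsub>W\<^esub> v"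
      using V.smult_l_distr by (auto simp: im smult[symmetric] add[symmetric] cl)
    show "\<forall>a v w. a \<in> carrier complex_field \<and> v \<in> carrier W \<and> w \<in> carrier W \<longrightarrow>
       a \<odot>\<^bsub>W\<^esub> (v \<oplus>\<^bsub>W\<^esub> w) = a \<odot>\<^bsub>W\<^esub> v \<oplus>\<^bsub>W\<^esub> a \<odot>\<^bsub>W\<^esub> w"
      using V.smult_r_distr by (auto simp: im smult[symmetric] add[symmetric] cl)
  qed
  thus "vectorspace complex_field W" .
  have "f \<in> module_hom complex_field V W"
    unfolding module_hom_def using add smult mem by auto
  then interpret linear_map complex_field V W f by (rule linear_mapI[OF V W])
  show "vectorspace.fin_dim complex_field W" by (rule surj_fin_dim[OF findim im[symmetric]])
  show "vectorspace.dim complex_field W = vectorspace.dim complex_field V"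
    by (rule dim_eq[OF findim inj im[symmetric], symmetric])
qed

lemma fun_space_simps [simp]:
  "carrier (fun_space U) = U" "\<zero>\<^bsub>fun_space U\<^esub> = (\<lambda>k. 0)" "u \<oplus>\<^bsub>fun_space U\<^esub> v = (\<lambda>k. u k + v k)"
  "c \<odot>\<^bsub>fun_space U\<^esub> u = (\<lambda>k. c * u k)"
  by (simp_all add: fun_space_def)

lemma function_module_fun_space: "function_module (fun_space U)"
  by (simp add: function_module_def)

lemma H_space_simps [simp]:
  "carrier (H_space \<phi>) = H_set \<phi>" "\<zero>\<^bsub>H_space \<phi>\<^esub> = (\<lambda>k. 0)" "u \<oplus>\<^bsub>H_space \<phi>\<^esub> v = (\<lambda>k. u k + v k)"
  "c \<odot>\<^bsub>H_space \<phi>\<^esub> u = (\<lambda>k. c * u k)" "vnorm (H_space \<phi>) = H_norm \<phi>"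
  by (simp_all add: H_space_def fun_space_def module.defs)

lemma function_module_H_space: "function_module (H_space \<phi>)" "function_module (H_space \<phi>\<lparr>carrier := U\<rparr>)"
  by (simp_all add: function_module_def)

text \<open>The induction of \<open>projection_exists\<close>, with spanning sets in place of projections.\<close>

lemma fin_dim_fun_space:
  assumes "finite S" "linear_set U" "\<And>u. u \<in> U \<Longrightarrow> (\<And>k. k \<in> S \<Longrightarrow> u k = 0) \<Longrightarrow> u = (\<lambda>k. 0)"
  shows "fin_dim_space (fun_space U)"
  using assms
proof (induction S arbitrary: U rule: finite_induct)
  case empty
  interpret V: vectorspace complex_field "fun_space U"
    by (rule function_module_vectorspace[OF function_module_fun_space]) (simp add: empty.prems)
  have "u = (\<lambda>k. 0)" if "u \<in> U" for u by (rule empty.prems(2)[OF that]) simp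
  hence "U = {\<lambda>k. 0}" using empty.prems(1) unfolding linear_set_def by blast
  hence "V.span {} = carrier (fun_space U)" using V.span_empty by simp
  thus ?case unfolding V.fin_dim_def by blast
next
  case (insert s S)
  interpret V: vectorspace complex_field "fun_space U"
    by (rule function_module_vectorspace[OF function_module_fun_space]) (simp add: insert.prems)
  define U' where "U' = {u \<in> U. u s = 0}"
  have U': "linear_set U'" using insert.prems(1) unfolding linear_set_def U'_def by auto
  interpret V': vectorspace complex_field "fun_space U'"
    by (rule function_module_vectorspace[OF function_module_fun_space]) (simp add: U')
  have "fin_dim_space (fun_space U')"
  proof (rule insert.IH[OF U'])
    fix u assume "u \<in> U'" "\<And>k. k \<in> S \<Longrightarrow> u k = 0"
    thus "u = (\<lambda>k. 0)" using insert.prems(2)[of u] by (auto simp: U'_def)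
  qed
  then obtain A where A: "finite A" "A \<subseteq> U'" "V'.span A = U'" unfolding V'.fin_dim_def by auto
  have sub: "submodule complex_field U' (fun_space U)"
    using linear_set_add[OF U'] linear_set_smult[OF U'] U' V.module_axioms
    by (intro submodule.intro) (auto simp: U'_def linear_set_def)
  have "V.span A = U'"
    using V.span_li_not_depend(1)[OF A(2) sub] A(3) by (simp add: fun_space_def)
  hence spanA: "U' \<subseteq> V.span B" if "A \<subseteq> B" for B using V.span_is_monotone[OF that] by blast
  have UA: "A \<subseteq> U" using A(2) by (auto simp: U'_def)
  show ?case
  proof (cases "U' = U")
    case True
    hence "V.span A = carrier (fun_space U)" using \<open>V.span A = U'\<close> by simp
    thus ?thesis unfolding V.fin_dim_def using A(1) UA by auto
  next
    case False
    then obtain w where w: "w \<in> U" "w s \<noteq> 0" by (auto simp: U'_def)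
    let ?B = "insert w A"
    have B: "?B \<subseteq> carrier (fun_space U)" using UA w by simp
    have "u \<in> V.span ?B" if u: "u \<in> U" for u
    proof -
      define c where "c = u s / w s"
      have "(\<lambda>k. u k + (- c) * w k) \<in> U'"
        using linear_setD(2)[OF insert.prems(1) u w(1), of "- c"] w(2) unfolding U'_def by (simp add: c_def)
      hence 1: "(\<lambda>k. u k + (- c) * w k) \<in> V.span ?B" using spanA[of ?B] by blast
      have 2: "w \<in> V.span ?B" using V.in_own_span[OF B] by blast
      interpret S: submodule complex_field "V.span ?B" "fun_space U" by (rule V.span_is_submodule[OF B])
      have "(\<lambda>k. u k + (- c) * w k) \<oplus>\<^bsub>fun_space U\<^esub> (c \<odot>\<^bsub>fun_space U\<^esub> w) \<in> V.span ?B"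
        using 1 2 by (intro S.m_closed S.smult_closed) auto
      thus ?thesis by simp
    qed
    hence "V.span ?B = carrier (fun_space U)" using V.span_is_subset2[OF B] by auto
    thus ?thesis unfolding V.fin_dim_def using A(1) B by blast
  qed
qed

text \<open>The kernel of an operator on \<open>H_space \<phi>\<close> is a record with a norm, whereas \<open>fun_space U\<close> has none.\<close>

lemma carrier_update_dim:
  assumes U: "linear_set U" and fin: "fin_dim_space (fun_space U)"
  shows "fin_dim_space (H_space \<phi>\<lparr>carrier := U\<rparr>)"
    "dim_space (H_space \<phi>\<lparr>carrier := U\<rparr>) = dim_space (fun_space U)"
  by (rule vectorspace_transport[where f = "\<lambda>u. u", OF function_module_vectorspace[OF function_module_fun_space] _ _ _ _ fin];
      simp add: U bij_betw_def)+

section \<open>Quotients\<close>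

text \<open>A linear complement \<open>Y\<close> of \<open>U\<close> is isomorphic to the quotient, because every coset contains exactly one
  element of \<open>Y\<close>.\<close>

lemma quotient_fun_module:
  fixes V :: "(complex, 'i \<Rightarrow> complex, 'e) module_scheme"
  assumes V: "function_module V" "linear_set (carrier V)" and U: "linear_set U" "U \<subseteq> carrier V"
    and Y: "linear_set Y" "Y \<subseteq> carrier V" and fin: "fin_dim_space (fun_space Y)"
    and disjoint: "\<And>y. y \<in> Y \<Longrightarrow> y \<in> U \<Longrightarrow> y = (\<lambda>k. 0)"
    and cover: "\<And>v. v \<in> carrier V \<Longrightarrow> \<exists>y\<in>Y. (\<lambda>k. v k - y k) \<in> U"
  shows "fin_dim_space (quotient_module V U)" "dim_space (quotient_module V U) = dim_space (fun_space Y)"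
proof -
  have ops: "\<zero>\<^bsub>V\<^esub> = (\<lambda>k. 0)" "u \<oplus>\<^bsub>V\<^esub> v = (\<lambda>k. u k + v k)" "c \<odot>\<^bsub>V\<^esub> u = (\<lambda>k. c * u k)" for u v c
    using V by (auto simp: function_module_def)
  have coset: "v \<in> U +>\<^bsub>V\<^esub> x \<longleftrightarrow> (\<lambda>k. v k - x k) \<in> U" for v x
  proof
    assume "v \<in> U +>\<^bsub>V\<^esub> x"
    thus "(\<lambda>k. v k - x k) \<in> U" by (auto simp: a_r_coset_def' ops)
  next
    assume "(\<lambda>k. v k - x k) \<in> U"
    thus "v \<in> U +>\<^bsub>V\<^esub> x" unfolding a_r_coset_def' ops by (intro UN_I[of "\<lambda>k. v k - x k"]) auto
  qed
  have coset_eq: "U +>\<^bsub>V\<^esub> x = U +>\<^bsub>V\<^esub> y" if "(\<lambda>k. x k - y k) \<in> U" for x y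
  proof (rule Set.set_eqI)
    fix v
    show "v \<in> U +>\<^bsub>V\<^esub> x \<longleftrightarrow> v \<in> U +>\<^bsub>V\<^esub> y"
      unfolding coset
      using linear_set_add[OF U(1) _ that, of "\<lambda>k. v k - x k"] linear_set_diff[OF U(1) _ that, of "\<lambda>k. v k - y k"]
      by auto
  qed
  have self: "x \<in> U +>\<^bsub>V\<^esub> x" for x unfolding coset using U(1) by (simp add: linear_set_def)
  have quot: "carrier (quotient_module V U) = (\<lambda>x. U +>\<^bsub>V\<^esub> x) ` carrier V" "\<zero>\<^bsub>quotient_module V U\<^esub> = U"
    by (auto simp: quotient_module_def A_RCOSETS_def')
  have add: "U +>\<^bsub>V\<^esub> (\<lambda>k. x k + y k) = (U +>\<^bsub>V\<^esub> x) \<oplus>\<^bsub>quotient_module V U\<^esub> (U +>\<^bsub>V\<^esub> y)" for x y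
  proof (rule Set.set_eqI)
    fix v
    have "v \<in> (U +>\<^bsub>V\<^esub> x) \<oplus>\<^bsub>quotient_module V U\<^esub> (U +>\<^bsub>V\<^esub> y) \<longleftrightarrow>
        (\<exists>a\<in>U +>\<^bsub>V\<^esub> x. \<exists>b\<in>U +>\<^bsub>V\<^esub> y. v = (\<lambda>k. a k + b k))"
      by (simp add: quotient_module_def set_add_def' ops)
    also have "\<dots> \<longleftrightarrow> (\<exists>a b. (\<lambda>k. a k - x k) \<in> U \<and> (\<lambda>k. b k - y k) \<in> U \<and> v = (\<lambda>k. a k + b k))"
      unfolding Bex_def coset by simp
    also have "\<dots> \<longleftrightarrow> (\<lambda>k. v k - (x k + y k)) \<in> U"
    proof
      assume "\<exists>a b. (\<lambda>k. a k - x k) \<in> U \<and> (\<lambda>k. b k - y k) \<in> U \<and> v = (\<lambda>k. a k + b k)"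
      then obtain a b where "(\<lambda>k. a k - x k) \<in> U" "(\<lambda>k. b k - y k) \<in> U" "v = (\<lambda>k. a k + b k)" by blast
      thus "(\<lambda>k. v k - (x k + y k)) \<in> U" using linear_set_add[OF U(1), of "\<lambda>k. a k - x k" "\<lambda>k. b k - y k"]
        by (simp add: algebra_simps)
    next
      assume "(\<lambda>k. v k - (x k + y k)) \<in> U"
      thus "\<exists>a b. (\<lambda>k. a k - x k) \<in> U \<and> (\<lambda>k. b k - y k) \<in> U \<and> v = (\<lambda>k. a k + b k)"
        using U(1) by (intro exI[of _ "\<lambda>k. v k - y k"] exI[of _ y]) (auto simp: linear_set_def algebra_simps)
    qed
    finally show "v \<in> U +>\<^bsub>V\<^esub> (\<lambda>k. x k + y k) \<longleftrightarrow> v \<in> (U +>\<^bsub>V\<^esub> x) \<oplus>\<^bsub>quotient_module V U\<^esub> (U +>\<^bsub>V\<^esub> y)"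
      by (simp add: coset)
  qed
  have smult: "U +>\<^bsub>V\<^esub> (\<lambda>k. c * x k) = c \<odot>\<^bsub>quotient_module V U\<^esub> (U +>\<^bsub>V\<^esub> x)" for c x
  proof -
    have "c \<odot>\<^bsub>quotient_module V U\<^esub> (U +>\<^bsub>V\<^esub> x) = (\<Union>y\<in>U +>\<^bsub>V\<^esub> x. U +>\<^bsub>V\<^esub> (\<lambda>k. c * y k))"
      by (simp add: quotient_module_def ops)
    moreover have "U +>\<^bsub>V\<^esub> (\<lambda>k. c * y k) = U +>\<^bsub>V\<^esub> (\<lambda>k. c * x k)" if "y \<in> U +>\<^bsub>V\<^esub> x" for y
      using that linear_set_smult[OF U(1), of "\<lambda>k. y k - x k" c]
      by (intro coset_eq) (auto simp: coset algebra_simps)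
    ultimately show ?thesis using self[of x] by blast
  qed
  let ?f = "\<lambda>y. U +>\<^bsub>V\<^esub> y"
  have bij: "bij_betw ?f (carrier (fun_space Y)) (carrier (quotient_module V U))"
    unfolding bij_betw_def
  proof
    show "inj_on ?f (carrier (fun_space Y))"
    proof (rule inj_onI)
      fix x y assume xy: "x \<in> carrier (fun_space Y)" "y \<in> carrier (fun_space Y)" and eq: "?f x = ?f y"
      have "(\<lambda>k. x k - y k) \<in> U" using self[of x] unfolding eq coset .
      moreover have "(\<lambda>k. x k - y k) \<in> Y" using linear_set_diff[OF Y(1)] xy by simp
      ultimately have "(\<lambda>k. x k - y k) = (\<lambda>k. 0)" by (intro disjoint)
      thus "x = y" by (simp add: fun_eq_iff)
    qed
    show "?f ` carrier (fun_space Y) = carrier (quotient_module V U)"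
    proof
      show "?f ` carrier (fun_space Y) \<subseteq> carrier (quotient_module V U)" using Y(2) by (auto simp: quot)
      show "carrier (quotient_module V U) \<subseteq> ?f ` carrier (fun_space Y)"
      proof
        fix X assume "X \<in> carrier (quotient_module V U)"
        then obtain v where v: "v \<in> carrier V" "X = ?f v" by (auto simp: quot)
        obtain y where "y \<in> Y" "(\<lambda>k. v k - y k) \<in> U" using cover[OF v(1)] by blast
        thus "X \<in> ?f ` carrier (fun_space Y)" using coset_eq[of v y] v(2) by auto
      qed
    qed
  qed
  have zero: "?f (\<lambda>k. 0) = U" by (rule Set.set_eqI) (simp add: coset)
  note transport = vectorspace_transport[OF function_module_vectorspace[OF function_module_fun_space] bij _ _ _ fin]
  show "fin_dim_space (quotient_module V U)"
    by (rule transport(2)) (use Y(1) in \<open>simp_all add: zero quot add smult\<close>)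
  show "dim_space (quotient_module V U) = dim_space (fun_space Y)"
    by (rule transport(3)) (use Y(1) in \<open>simp_all add: zero quot add smult\<close>)
qed

section \<open>The spaces \<open>H_space\<close> as Banach spaces\<close>

lemma wl2_linear_set: "moderate p \<Longrightarrow> linear_set (wl2 p)"
proof -
  assume "moderate p"
  hence pos: "0 < p k" for k by (rule moderate_pos)
  show ?thesis
    unfolding linear_set_def
    using wl2_zero(1)[where p = p, OF pos] wl2_add(1)[where p = p, OF pos _ wl2_smult(1)[where p = p, OF pos]] by simp
qed

context
  fixes \<phi> :: "real \<Rightarrow> real" and p :: "int ^ 'n::finite \<Rightarrow> real"
  assumes p: "moderate p" and \<phi>: "\<And>k. \<phi> (japanese k) = p k"
begin

lemma H_set_wl2: "H_set \<phi> = wl2 p"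
  using H_set_eq_wl2[of \<phi>, where 'n = 'n] p \<phi> by simp

lemma H_norm_wl2: "u \<in> wl2 p \<Longrightarrow> H_norm \<phi> u = wnorm p u"
  using H_norm_eq_wnorm[of u \<phi>] \<phi> by simp

lemma H_space_vectorspace: "vectorspace complex_field (H_space \<phi> :: (complex, int ^ 'n \<Rightarrow> complex) normed_module)"
  by (rule function_module_vectorspace[OF function_module_H_space(1)]) (simp add: H_set_wl2 wl2_linear_set[OF p])

lemma vdist_H_space:
  "vdist (H_space \<phi>) = (\<lambda>u v. if u \<in> wl2 p \<and> v \<in> wl2 p then wnorm p (\<lambda>k. u k - v k) else 0)"
proof (intro ext)
  fix u v :: "int ^ 'n \<Rightarrow> complex"
  have "u \<ominus>\<^bsub>H_space \<phi>\<^esub> v = (\<lambda>k. u k - v k)" if "v \<in> wl2 p"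
    by (rule function_module_uminus[OF function_module_H_space(1)]) (use that in \<open>simp_all add: H_set_wl2 wl2_linear_set[OF p]\<close>)
  thus "vdist (H_space \<phi>) u v = (if u \<in> wl2 p \<and> v \<in> wl2 p then wnorm p (\<lambda>k. u k - v k) else 0)"
    unfolding vdist_def using wl2_diff(1)[where p = p and u = u and v = v, OF moderate_pos[OF p]] by (auto simp: H_set_wl2 H_norm_wl2)
qed

lemma H_space_banach: "banach_space (H_space \<phi> :: (complex, int ^ 'n \<Rightarrow> complex) normed_module)"
  unfolding banach_space_def vdist_H_space
  using H_space_vectorspace wl2_complete[where p = p, OF moderate_pos[OF p]]
    wl2_add[where p = p, OF moderate_pos[OF p]] wl2_smult[where p = p, OF moderate_pos[OF p]]
    wnorm_eq_0_iff[where p = p, OF moderate_pos[OF p]]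
  by (simp add: H_set_wl2 H_norm_wl2)

text \<open>The functionals in question are continuous by the Cauchy--Schwarz inequality for the pairing.\<close>

lemma closedin_annihilator:
  assumes "Y \<subseteq> rapid"
  shows "closedin (Metric_space.mtopology (carrier (H_space \<phi>)) (vdist (H_space \<phi>)))
    {v \<in> wl2 p. \<forall>w\<in>Y. ell2_form v w = 0}"
proof -
  have pos: "\<And>k. 0 < p k" by (rule moderate_pos[OF p])
  interpret Metric_space "wl2 p" "vdist (H_space \<phi>)"
    unfolding vdist_H_space by (rule wl2_Metric_space[OF pos])
  have "closedin mtopology {v \<in> wl2 p. \<forall>w\<in>Y. ell2_form v w = 0}"
    unfolding metric_closedin_iff_sequentially_closed
  proof (intro conjI allI impI; (elim conjE)?)
    fix \<sigma> l assume \<sigma>: "range \<sigma> \<subseteq> {v \<in> wl2 p. \<forall>w\<in>Y. ell2_form v w = 0}" and lim: "limitin mtopology \<sigma> l sequentially"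
    from lim have l: "l \<in> wl2 p" and d: "(\<lambda>i. vdist (H_space \<phi>) (\<sigma> i) l) \<longlonglongrightarrow> 0"
      unfolding limitin_metric_dist_null by auto
    have \<sigma>m: "\<sigma> i \<in> wl2 p" "\<And>w. w \<in> Y \<Longrightarrow> ell2_form (\<sigma> i) w = 0" for i using \<sigma> by auto
    have "ell2_form l w = 0" if w: "w \<in> Y" for w
    proof -
      have w': "w \<in> wl2 (\<lambda>k. 1 / p k)" using w assms rapid_subset_wl2[OF moderate_inverse[OF p]] by blast
      have "cmod (ell2_form l w) \<le> vdist (H_space \<phi>) (\<sigma> i) l * wnorm (\<lambda>k. 1 / p k) w" for i
        using wl2_pair(2)[OF pos wl2_diff(1)[OF pos \<sigma>m(1) l] w', of i] \<sigma>m(1)[of i] l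
        unfolding ell2_form_diff_left[OF pos \<sigma>m(1) l w'] \<sigma>m(2)[OF w] vdist_H_space by simp
      moreover have "(\<lambda>i. vdist (H_space \<phi>) (\<sigma> i) l * wnorm (\<lambda>k. 1 / p k) w) \<longlonglongrightarrow> 0 * wnorm (\<lambda>k. 1 / p k) w"
        by (intro tendsto_intros d)
      ultimately have "cmod (ell2_form l w) \<le> 0 * wnorm (\<lambda>k. 1 / p k) w"
        by (intro tendsto_lowerbound[where F = sequentially]) auto
      thus ?thesis by simp
    qed
    with l show "l \<in> {v \<in> wl2 p. \<forall>w\<in>Y. ell2_form v w = 0}" by blast
  qed auto
  thus ?thesis by (simp add: H_set_wl2)
qed

end

section \<open>The Fredholm property\<close>

lemma (in elliptic_matrix) adj_kernel_linear_set: "linear_set {u \<in> rapid. mat_apply (adj K) u = (\<lambda>k. 0)}"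
proof -
  have "(\<lambda>k. u k + c * v k) \<in> {u \<in> rapid. mat_apply (adj K) u = (\<lambda>k. 0)}"
    if "u \<in> {u \<in> rapid. mat_apply (adj K) u = (\<lambda>k. 0)}" "v \<in> {u \<in> rapid. mat_apply (adj K) u = (\<lambda>k. 0)}" for u v c
  proof -
    have "u \<in> tempered" "v \<in> tempered" using that rapid_subset_tempered by auto
    thus ?thesis
      using that mat_apply_add[OF decay_adj[OF K q] q _ tempered_smult] by (simp add: rapid_add rapid_smult mat_apply_smult)
  qed
  thus ?thesis using finite_support_rapid[of "{}" "\<lambda>k. 0"] unfolding linear_set_def by auto
qed

lemma (in elliptic_matrix) kernel_linear_set: "linear_set {u \<in> rapid. mat_apply K u = (\<lambda>k. 0)}"
  using elliptic_matrix.adj_kernel_linear_set[OF elliptic_matrix_adj] by simp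

lemma (in elliptic_matrix) kernel_fin_dim: "fin_dim_space (fun_space {u \<in> rapid. mat_apply K u = (\<lambda>k. 0)})"
proof -
  obtain r where r: "\<And>u. u \<in> rapid \<Longrightarrow> mat_apply K u = (\<lambda>k. 0) \<Longrightarrow> (\<And>k. japanese k \<le> r \<Longrightarrow> u k = 0) \<Longrightarrow> u = (\<lambda>k. 0)"
    using kernel_determined_by_ball by blast
  show ?thesis
    by (rule fin_dim_fun_space[OF finite_japanese_ball[of r] kernel_linear_set]) (use r in auto)
qed

lemma (in elliptic_matrix) range_eq_annihilator:
  assumes p: "moderate p"
  shows "mat_apply K ` wl2 p = {v \<in> wl2 (\<lambda>k. p k / q k). \<forall>w\<in>{u \<in> rapid. mat_apply (adj K) u = (\<lambda>k. 0)}. ell2_form v w = 0}"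
proof (intro equalityI subsetI)
  fix v assume "v \<in> mat_apply K ` wl2 p"
  then obtain u where u: "u \<in> wl2 p" "v = mat_apply K u" by blast
  have ut: "u \<in> tempered" using u(1) wl2_subset_tempered[OF p] by blast
  have "ell2_form v w = 0" if "w \<in> rapid" "mat_apply (adj K) w = (\<lambda>k. 0)" for w
    using ell2_form_mat_apply[OF K q ut that(1)] that(2) by (simp add: u(2) ell2_form_def)
  thus "v \<in> {v \<in> wl2 (\<lambda>k. p k / q k). \<forall>w\<in>{u \<in> rapid. mat_apply (adj K) u = (\<lambda>k. 0)}. ell2_form v w = 0}"
    using mat_apply_wl2_mem[OF K q p u(1)] u(2) by simp
next
  fix v assume "v \<in> {v \<in> wl2 (\<lambda>k. p k / q k). \<forall>w\<in>{u \<in> rapid. mat_apply (adj K) u = (\<lambda>k. 0)}. ell2_form v w = 0}"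
  then obtain u where "u \<in> wl2 p" "mat_apply K u = v" using range_if_orthogonal[OF p, of v] by auto
  thus "v \<in> mat_apply K ` wl2 p" by blast
qed

text \<open>The kernel of the adjoint is a complement of the range: an element of both is orthogonal to itself,
  and subtracting from \<open>v\<close> its projection onto the kernel of the adjoint leaves an element of the
  annihilator, that is of the range.\<close>

lemma (in elliptic_matrix) cokernel_fin_dim:
  fixes V :: "(complex, int ^ 'n \<Rightarrow> complex, 'e) module_scheme"
  assumes p: "moderate p" and V: "function_module V" "carrier V = wl2 (\<lambda>k. p k / q k)"
  shows "fin_dim_space (quotient_module V (mat_apply K ` wl2 p))"
    "dim_space (quotient_module V (mat_apply K ` wl2 p)) = dim_space (fun_space {u \<in> rapid. mat_apply (adj K) u = (\<lambda>k. 0)})"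
proof -
  let ?Y = "{u \<in> rapid. mat_apply (adj K) u = (\<lambda>k. 0)}"
  let ?s = "\<lambda>k. p k / q k"
  have s: "moderate ?s" by (rule moderate_divide[OF p q])
  note pos = moderate_pos[OF s]
  have Vlin: "linear_set (carrier V)" unfolding V(2) by (rule wl2_linear_set[OF s])
  have Y': "w \<in> wl2 (\<lambda>k. 1 / ?s k)" if "w \<in> ?Y" for w
    using that rapid_subset_wl2[OF moderate_inverse[OF s]] by auto
  have lin: "linear_set (mat_apply K ` wl2 p)"
    unfolding range_eq_annihilator[OF p] linear_set_def
    using wl2_linear_set[OF s] ell2_form_linear_left[OF pos _ _ Y'] unfolding linear_set_def
    by (auto simp: ell2_form_def)
  have disjoint: "y = (\<lambda>k. 0)" if "y \<in> ?Y" "y \<in> mat_apply K ` wl2 p" for y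
    using that ell2_form_self_eq_0 unfolding range_eq_annihilator[OF p] by auto
  have cover: "\<exists>y\<in>?Y. (\<lambda>k. v k - y k) \<in> mat_apply K ` wl2 p" if v: "v \<in> carrier V" for v
  proof -
    have vs: "v \<in> wl2 ?s" using v V(2) by simp
    obtain w where w: "w \<in> rapid" "mat_apply (adj K) w = (\<lambda>k. 0)"
      "\<And>u. u \<in> rapid \<Longrightarrow> mat_apply (adj K) u = (\<lambda>k. 0) \<Longrightarrow> ell2_form (\<lambda>k. v k - w k) u = 0"
      using elliptic_matrix.kernel_projection[OF elliptic_matrix_adj s vs] by blast
    have "(\<lambda>k. v k - w k) \<in> wl2 ?s" using wl2_diff(1)[OF pos vs] w(1) rapid_subset_wl2[OF s] by blast
    with w show ?thesis unfolding range_eq_annihilator[OF p] by (intro bexI[of _ w]) auto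
  qed
  have sub: "mat_apply K ` wl2 p \<subseteq> carrier V" "?Y \<subseteq> carrier V"
    unfolding V(2) range_eq_annihilator[OF p] using rapid_subset_wl2[OF s] by auto
  note fin = elliptic_matrix.kernel_fin_dim[OF elliptic_matrix_adj]
  show "fin_dim_space (quotient_module V (mat_apply K ` wl2 p))"
    by (rule quotient_fun_module(1)[OF V(1) Vlin lin sub(1) adj_kernel_linear_set sub(2) fin disjoint cover])
  show "dim_space (quotient_module V (mat_apply K ` wl2 p)) = dim_space (fun_space ?Y)"
    by (rule quotient_fun_module(2)[OF V(1) Vlin lin sub(1) adj_kernel_linear_set sub(2) fin disjoint cover])
qed

lemma fredholm_elliptic:
  fixes a :: "int ^ 'n::finite \<Rightarrow> real ^ 'n \<Rightarrow> complex"
  assumes a: "a \<in> elliptic_symbols m" and \<phi>: "\<phi> \<in> RO"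
  defines "\<psi> \<equiv> \<lambda>t. t powr (- m) * \<phi> t"
  shows "fredholm (H_space \<phi>) (H_space \<psi>) (T_op a)"
    and "op_kernel (H_space \<phi>) (H_space \<psi>) (T_op a) = smooth_kernel a"
    and "op_range (H_space \<phi>) (T_op a) = {v \<in> H_set \<psi>. \<forall>w\<in>smooth_adjoint_kernel a. duality \<psi> v w = 0}"
    and "fin_dim_space (fun_space (smooth_kernel a))"
    and "fin_dim_space (fun_space (smooth_adjoint_kernel a))"
    and "fredholm_index (H_space \<phi>) (H_space \<psi>) (T_op a) =
      int (dim_space (fun_space (smooth_kernel a))) - int (dim_space (fun_space (smooth_adjoint_kernel a)))"
proof -
  let ?q = "\<lambda>k :: int ^ 'n. japanese k powr m"
  obtain B B' R R' where "elliptic_matrix ?q (left_matrix a) B B' R R'" using elliptic_symbols_matrix[OF a] by blast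
  then interpret elliptic_matrix ?q "left_matrix a" B B' R R' .
  have at: "torus_symbol ?q a" using a symbols_slow_torus_symbol by (auto simp: elliptic_symbols_def slow_torus_symbol_def)
  define p where "p = (\<lambda>k :: int ^ 'n. \<phi> (japanese k))"
  define s where "s = (\<lambda>k. p k / ?q k)"
  have p: "moderate p" unfolding p_def by (rule RO_moderate[OF \<phi>])
  have s: "moderate s" unfolding s_def by (rule moderate_divide[OF p q])
  have \<phi>p: "\<phi> (japanese k) = p k" for k by (simp add: p_def)
  have \<psi>s: "\<psi> (japanese k) = s k" for k by (simp add: \<psi>_def s_def p_def powr_minus divide_inverse mult.commute)
  have Hp: "H_set \<phi> = wl2 p" by (rule H_set_wl2[OF p \<phi>p])
  have Hs: "H_set \<psi> = wl2 s" by (rule H_set_wl2[OF s \<psi>s])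
  have T: "T_op a u = mat_apply (left_matrix a) u" if "u \<in> tempered" for u by (rule T_op_eq_mat_apply[OF q at that])
  have Tp: "T_op a u = mat_apply (left_matrix a) u" if "u \<in> wl2 p" for u using T that wl2_subset_tempered[OF p] by blast
  have kern: "smooth_kernel a = {u \<in> rapid. mat_apply (left_matrix a) u = (\<lambda>k. 0)}"
    using T rapid_subset_tempered unfolding smooth_kernel_def H_infinity_eq_rapid by auto
  have adjkern: "smooth_adjoint_kernel a = {u \<in> rapid. mat_apply (adj (left_matrix a)) u = (\<lambda>k. 0)}"
    unfolding smooth_adjoint_kernel_def H_infinity_eq_rapid using formal_adjoint_pdo[OF q at] by auto
  have range: "op_range (H_space \<phi>) (T_op a) = mat_apply (left_matrix a) ` wl2 p"
    unfolding op_range_def H_space_simps Hp using Tp by (rule image_cong[OF refl])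
  have dual: "duality \<psi> v w = ell2_form v w" if "v \<in> wl2 s" "w \<in> rapid" for v w
  proof (rule duality_eq_ell2_form)
    show "moderate (\<lambda>k :: int ^ 'n. \<psi> (japanese k))" "v \<in> wl2 (\<lambda>k. \<psi> (japanese k))" unfolding \<psi>s by (rule s, rule that)
    show "w \<in> wl2 (\<lambda>k. 1 / \<psi> (japanese k))" unfolding \<psi>s using rapid_subset_wl2[OF moderate_inverse[OF s]] that(2) by blast
  qed
  show kernel: "op_kernel (H_space \<phi>) (H_space \<psi>) (T_op a) = smooth_kernel a"
    unfolding op_kernel_def H_space_simps Hp kern
    using Tp kernel_rapid[OF p] rapid_subset_wl2[OF p] by auto
  show "op_range (H_space \<phi>) (T_op a) = {v \<in> H_set \<psi>. \<forall>w\<in>smooth_adjoint_kernel a. duality \<psi> v w = 0}"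
    unfolding range range_eq_annihilator[OF p] Hs adjkern s_def[symmetric] using dual by auto
  show fin: "fin_dim_space (fun_space (smooth_kernel a))" unfolding kern by (rule kernel_fin_dim)
  show "fin_dim_space (fun_space (smooth_adjoint_kernel a))"
    unfolding adjkern by (rule elliptic_matrix.kernel_fin_dim[OF elliptic_matrix_adj])
  have klin: "linear_set (smooth_kernel a)" unfolding kern by (rule kernel_linear_set)
  have carrier: "carrier (H_space \<psi>) = wl2 (\<lambda>k. p k / ?q k)" using Hs by (simp add: s_def)
  note coker = cokernel_fin_dim[OF p function_module_H_space(1) carrier]
  show "fredholm_index (H_space \<phi>) (H_space \<psi>) (T_op a) =
      int (dim_space (fun_space (smooth_kernel a))) - int (dim_space (fun_space (smooth_adjoint_kernel a)))"
    unfolding fredholm_index_def kernel range adjkern coker(2) carrier_update_dim(2)[OF klin fin] ..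
  have "bounded_operator (H_space \<phi>) (H_space \<psi>) (T_op a)"
    unfolding bounded_operator_def
  proof
    have "T_op a \<in> module_hom complex_field (H_space \<phi>) (H_space \<psi>)"
      unfolding module_hom_def
    proof (intro CollectI conjI allI impI; (elim conjE)?)
      show "T_op a \<in> carrier (H_space \<phi>) \<rightarrow> carrier (H_space \<psi>)"
        using Tp mat_apply_wl2_mem[OF K q p] by (auto simp: Hp Hs s_def)
    next
      fix u v :: "int ^ 'n \<Rightarrow> complex" assume "u \<in> carrier (H_space \<phi>)" "v \<in> carrier (H_space \<phi>)"
      hence uv: "u \<in> tempered" "v \<in> tempered" using wl2_subset_tempered[OF p] by (auto simp: Hp)
      thus "T_op a (u \<oplus>\<^bsub>H_space \<phi>\<^esub> v) = T_op a u \<oplus>\<^bsub>H_space \<psi>\<^esub> T_op a v"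
        using mat_apply_add[OF K q uv] by (simp add: T tempered_add)
    next
      fix c :: complex and u :: "int ^ 'n \<Rightarrow> complex" assume "u \<in> carrier (H_space \<phi>)"
      hence "u \<in> tempered" using wl2_subset_tempered[OF p] by (auto simp: Hp)
      thus "T_op a (c \<odot>\<^bsub>H_space \<phi>\<^esub> u) = c \<odot>\<^bsub>H_space \<psi>\<^esub> T_op a u"
        by (simp add: T tempered_smult mat_apply_smult)
    qed
    thus "linear_map complex_field (H_space \<phi>) (H_space \<psi>) (T_op a)"
      by (rule linear_mapI[OF H_space_vectorspace[OF p \<phi>p] H_space_vectorspace[OF s \<psi>s]])
    obtain C where C: "\<And>u. u \<in> wl2 p \<Longrightarrow> wnorm s (mat_apply (left_matrix a) u) \<le> C * wnorm p u"
    proof -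
      show thesis by (rule mat_apply_wl2[OF K q p, folded s_def], rule that)
    qed
    thus "\<exists>C. \<forall>u\<in>carrier (H_space \<phi>). vnorm (H_space \<psi>) (T_op a u) \<le> C * vnorm (H_space \<phi>) u"
      using Tp C mat_apply_wl2_mem[OF K q p, folded s_def] by (intro exI[of _ C]) (simp add: Hp H_norm_wl2[OF p \<phi>p] H_norm_wl2[OF s \<psi>s])
  qed
  moreover have "closedin (Metric_space.mtopology (carrier (H_space \<psi>)) (vdist (H_space \<psi>))) (op_range (H_space \<phi>) (T_op a))"
    unfolding range range_eq_annihilator[OF p] s_def[symmetric]
    by (rule closedin_annihilator[OF s \<psi>s]) auto
  ultimately show "fredholm (H_space \<phi>) (H_space \<psi>) (T_op a)"
    unfolding fredholm_def kernel
    using H_space_banach[OF p \<phi>p] H_space_banach[OF s \<psi>s] carrier_update_dim(1)[OF klin fin] coker(1)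
    by (simp only: range)
qed

theorem theorem2p6:
  fixes a :: "int ^ 'n::finite \<Rightarrow> real ^ 'n \<Rightarrow> complex"
    and m :: real
    and \<phi> :: "real \<Rightarrow> real"
  assumes "a \<in> elliptic_symbols m"
    and "\<phi> \<in> RO"
  shows "fredholm (H_space \<phi>) (H_space (\<lambda>t. t powr (- m) * \<phi> t)) (T_op a) \<and>
    op_kernel (H_space \<phi>) (H_space (\<lambda>t. t powr (- m) * \<phi> t)) (T_op a) = smooth_kernel a \<and>
    op_range (H_space \<phi>) (T_op a) =
      {v \<in> H_set (\<lambda>t. t powr (- m) * \<phi> t).
         \<forall>w\<in>smooth_adjoint_kernel a. duality (\<lambda>t. t powr (- m) * \<phi> t) v w = 0} \<and>
    fin_dim_space (fun_space (smooth_kernel a)) \<and>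
    fin_dim_space (fun_space (smooth_adjoint_kernel a)) \<and>
    fredholm_index (H_space \<phi>) (H_space (\<lambda>t. t powr (- m) * \<phi> t)) (T_op a) =
      int (dim_space (fun_space (smooth_kernel a))) -
      int (dim_space (fun_space (smooth_adjoint_kernel a))) \<and>
    (\<forall>\<psi>\<in>RO.
      fredholm_index (H_space \<psi>) (H_space (\<lambda>t. t powr (- m) * \<psi> t)) (T_op a) =
      fredholm_index (H_space \<phi>) (H_space (\<lambda>t. t powr (- m) * \<phi> t)) (T_op a))"
  using fredholm_elliptic[OF assms] fredholm_elliptic(6)[OF assms(1)] by simp

end
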